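(* Let $n=2m$ with $m\in\mathbb N$, and let $\mathcal T\in\mathfrak T_n$ be fixed. Then $\mathcal D_F=\mathcal D_{\tilde F}$ for any $F,\tilde F\in\mathfrak F(\mathcal T)$.
   Context: All functions are complex-valued. $n=2m$, $m\in\mathbb N$. $\mathfrak D=C_0^\infty(0,1)$, $\mathfrak D'$ is the space of distributions on $(0,1)$. For $i\ge 0$, $W_2^{-i}[0,1]$ is the set of distributions $\sigma^{(i)}$ with $\sigma\in L_2[0,1]$ ($W_2^0=L_2$). Singularity orders: $i_{2k+j}:=m-k-j$ for $k\ge 0$, $j\in\{0,1\}$. Coefficient space: $\mathfrak T_n:=\{\mathcal T=(\tau_\nu)_{\nu=0}^{n-1}:\tau_\nu\in W_2^{-i_\nu}[0,1],\ \nu=0,\dots,n-1\}$. Differential expression with coefficients $\mathcal T$: $$\ell_n(y)=y^{(n)}+\sum_{k=0}^{m-1}(-1)^k(\tau_{2k}y^{(k)})^{(k)}+\sum_{k=0}^{m-1}(-1)^{k+1}\Bigl((\tau_{2k+1}y^{(k)})^{(k+1)}+(\tau_{2k+1}y^{(k+1)})^{(k)}\Bigr),$$ which is well defined in $\mathfrak D'$ for $y\in W_2^m[0,1]$; the product of $\tau=\sigma^{(i)}$, $\sigma\in L_2[0,1]$, and $g\in W_2^i[0,1]$ is $(\tau g,z)=(-1)^i\int_0^1\sigma\,(gz)^{(i)}\,dx$, $z\in\mathfrak D$. $\mathfrak F_n$ is the set of $n\times n$ matrix functions $F=[f_{k,j}]_{k,j=1}^n$ on $[0,1]$ such that for $k=m+1,\dots,n$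 and $j=1,\dots,m$: $f_{k,j}\in L_1[0,1]$, $f_{m,j}\in L_2[0,1]$, $f_{k,m+1}\in L_2[0,1]$; and $f_{k,j}=0$ whenever $k<m$ or $j>m+1$ or $(k,j)=(m,m+1)$. For $F\in\mathfrak F_n$ the quasi-derivatives are $y^{[0]}:=y$, $y^{[k]}:=(y^{[k-1]})'-\sum_{j=1}^k f_{k,j}y^{[j-1]}$, $k=1,\dots,n$, and $\mathcal D_F:=\{y: y^{[k]}\in W_1^1[0,1],\ k=0,\dots,n-1\}\subset W_2^m[0,1]$. $F\in\mathfrak F_n$ is called associated with $\ell_n(y)$ if $\ell_n(y)=y^{[n]}$ for every $y\in\mathcal D_F$. $\mathfrak F(\mathcal T)\subset\mathfrak F_n$ is the set of all matrices associated with the expression $\ell_n$ having coefficients $\mathcal T$. *)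

theory Defs
  imports "HOL-Analysis.Analysis"
begin

text \<open>Functions on \<open>[0,1]\<close> are total functions \<^typ>\<open>real \<Rightarrow> complex\<close>; all notions below only depend
  on their values almost everywhere on \<open>[0,1]\<close>, and membership in the function spaces is
  invariant under almost everywhere equality there.\<close>

abbreviation unit_leb :: "real measure" where
  "unit_leb \<equiv> lebesgue_on {0..1}"

definition Lp :: "nat \<Rightarrow> (real \<Rightarrow> complex) set" where
  "Lp p = {f. f \<in> borel_measurable unit_leb \<and> integrable unit_leb (\<lambda>x. cmod (f x) ^ p)}"

definition ddx :: "(real \<Rightarrow> complex) \<Rightarrow> real \<Rightarrow> complex" where
  "ddx z = (\<lambda>x. vector_derivative z (at x))"

text \<open>Elements of \<open>C\<^sub>0\<^sup>\<infinity>(0,1)\<close> are extended by zero to the whole line.\<close>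

definition test_fun :: "(real \<Rightarrow> complex) set" where
  "test_fun = {z. (\<forall>k x. (ddx ^^ k) z differentiable (at x)) \<and> closure {x. z x \<noteq> 0} \<subseteq> {0<..<1}}"

text \<open>Distributions are functionals of which only the values on \<^const>\<open>test_fun\<close> matter;
  \<open>dist_eq\<close> is therefore equality of distributions. The functionals considered below are built
  from regular distributions, so linearity and continuity on test functions need not be imposed.\<close>

type_synonym distr = "(real \<Rightarrow> complex) \<Rightarrow> complex"

definition dist_eq :: "distr \<Rightarrow> distr \<Rightarrow> bool" (infix \<open>=\<^sub>D\<close> 50) where
  "S =\<^sub>D T \<longleftrightarrow> (\<forall>z\<in>test_fun. S z = T z)"

definition reg_dist :: "(real \<Rightarrow> complex) \<Rightarrow> distr" where
  "reg_dist f = (\<lambda>z. LINT x|unit_leb. f x * z x)"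

definition dist_deriv :: "distr \<Rightarrow> distr" where
  "dist_deriv T = (\<lambda>z. - T (ddx z))"

definition has_weak_deriv :: "(real \<Rightarrow> complex) \<Rightarrow> (real \<Rightarrow> complex) \<Rightarrow> bool" where
  "has_weak_deriv f g \<longleftrightarrow> f \<in> Lp 1 \<and> g \<in> Lp 1 \<and> dist_deriv (reg_dist f) =\<^sub>D reg_dist g"

text \<open>The derivative of a function in \<open>W\<^sub>1\<^sup>1[0,1]\<close>, determined up to almost everywhere equality on
  \<open>[0,1]\<close>; unspecified for other functions.\<close>

definition weak_deriv :: "(real \<Rightarrow> complex) \<Rightarrow> real \<Rightarrow> complex" where
  "weak_deriv f = (SOME g. has_weak_deriv f g)"

text \<open>\<open>sobolev p k\<close> is \<open>W\<^sub>p\<^sup>k[0,1]\<close>.\<close>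

fun sobolev :: "nat \<Rightarrow> nat \<Rightarrow> (real \<Rightarrow> complex) set" where
  "sobolev p 0 = Lp p"
| "sobolev p (Suc k) = {f \<in> Lp p. \<exists>g\<in>sobolev p k. has_weak_deriv f g}"

text \<open>\<open>primitive i \<tau> \<sigma>\<close>: \<open>\<sigma> \<in> L\<^sub>2[0,1]\<close> and \<open>\<tau>\<close> is the \<open>i\<close>-th derivative of \<open>\<sigma>\<close>; \<open>W2_neg i\<close> is the
  space of distributions of order of singularity \<open>i\<close>.\<close>

definition primitive :: "nat \<Rightarrow> distr \<Rightarrow> (real \<Rightarrow> complex) \<Rightarrow> bool" where
  "primitive i \<tau> \<sigma> \<longleftrightarrow> \<sigma> \<in> Lp 2 \<and> \<tau> =\<^sub>D (dist_deriv ^^ i) (reg_dist \<sigma>)"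

definition W2_neg :: "nat \<Rightarrow> distr set" where
  "W2_neg i = {\<tau>. \<exists>\<sigma>. primitive i \<tau> \<sigma>}"

text \<open>Product of \<open>\<tau> \<in> W2_neg i\<close> and \<open>g \<in> sobolev 2 i\<close>. Two choices of \<open>\<sigma>\<close> differ almost everywhere
  by a polynomial of degree less than \<open>i\<close>, so the value on a test function does not depend on the
  choice.\<close>

definition dist_prod :: "nat \<Rightarrow> distr \<Rightarrow> (real \<Rightarrow> complex) \<Rightarrow> distr" where
  "dist_prod i \<tau> g = (\<lambda>z. (-1) ^ i *
     (LINT x|unit_leb. (SOME \<sigma>. primitive i \<tau> \<sigma>) x * (weak_deriv ^^ i) (\<lambda>t. g t * z t) x))"

text \<open>Throughout, the order of the differential expression is \<open>n = 2 * m\<close>.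
  For \<open>\<nu> = 2 * k + j < 2 * m\<close> with \<open>j \<le> 1\<close> the order is \<open>m - k - j\<close>, and no truncation occurs.\<close>

definition sing_order :: "nat \<Rightarrow> nat \<Rightarrow> nat" where
  "sing_order m \<nu> = m - \<nu> div 2 - \<nu> mod 2"

definition coeff_space :: "nat \<Rightarrow> (nat \<Rightarrow> distr) set" where
  "coeff_space m = {\<T>. \<forall>\<nu><2 * m. \<T> \<nu> \<in> W2_neg (sing_order m \<nu>)}"

definition diff_expr :: "nat \<Rightarrow> (nat \<Rightarrow> distr) \<Rightarrow> (real \<Rightarrow> complex) \<Rightarrow> distr" where
  "diff_expr m \<T> y = (\<lambda>z.
     (dist_deriv ^^ (2 * m)) (reg_dist y) z
     + (\<Sum>k<m. (-1) ^ k *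
         (dist_deriv ^^ k)
           (dist_prod (sing_order m (2 * k)) (\<T> (2 * k)) ((weak_deriv ^^ k) y)) z)
     + (\<Sum>k<m. (-1) ^ (k + 1) *
         ((dist_deriv ^^ (k + 1))
            (dist_prod (sing_order m (2 * k + 1)) (\<T> (2 * k + 1)) ((weak_deriv ^^ k) y)) z
        + (dist_deriv ^^ k)
            (dist_prod (sing_order m (2 * k + 1)) (\<T> (2 * k + 1)) ((weak_deriv ^^ (k + 1)) y)) z)))"

text \<open>Matrix functions are indexed from 1 to \<open>2 * m\<close>; other entries are irrelevant.\<close>

definition matrix_class :: "nat \<Rightarrow> (nat \<Rightarrow> nat \<Rightarrow> real \<Rightarrow> complex) set" where
  "matrix_class m = {F.
     (\<forall>k\<in>{m+1..2*m}. \<forall>j\<in>{1..m}. F k j \<in> Lp 1)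
     \<and> (\<forall>j\<in>{1..m}. F m j \<in> Lp 2)
     \<and> (\<forall>k\<in>{m+1..2*m}. F k (m + 1) \<in> Lp 2)
     \<and> (\<forall>k\<in>{1..2*m}. \<forall>j\<in>{1..2*m}. k < m \<or> j > m + 1 \<or> (k, j) = (m, m + 1)
          \<longrightarrow> (AE x in unit_leb. F k j x = 0))}"

fun quasi_deriv ::
  "(nat \<Rightarrow> nat \<Rightarrow> real \<Rightarrow> complex) \<Rightarrow> (real \<Rightarrow> complex) \<Rightarrow> nat \<Rightarrow> real \<Rightarrow> complex" where
  "quasi_deriv F y 0 = y"
| "quasi_deriv F y (Suc k) = (\<lambda>x. weak_deriv (quasi_deriv F y k) x
     - (\<Sum>j=1..Suc k. F (Suc k) j x * quasi_deriv F y (j - 1) x))"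

definition quasi_domain :: "nat \<Rightarrow> (nat \<Rightarrow> nat \<Rightarrow> real \<Rightarrow> complex) \<Rightarrow> (real \<Rightarrow> complex) set" where
  "quasi_domain m F = {y. \<forall>k<2 * m. quasi_deriv F y k \<in> sobolev 1 1}"

definition assoc_matrices ::
  "nat \<Rightarrow> (nat \<Rightarrow> distr) \<Rightarrow> (nat \<Rightarrow> nat \<Rightarrow> real \<Rightarrow> complex) set" where
  "assoc_matrices m \<T> = {F \<in> matrix_class m. \<forall>y\<in>quasi_domain m F.
     diff_expr m \<T> y =\<^sub>D reg_dist (quasi_deriv F y (2 * m))}"

end

theory Submission
  imports Defs "HOL-Probability.Discrete_Topology"
begin

text \<open>For a test function \<open>z\<close>, both \<open>y \<mapsto> (\<ell>(y), z)\<close> and the distributional expression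
  \<open>y \<mapsto> (y\<^sup>[\<^sup>n\<^sup>], z)\<close> built from \<open>F\<close> make sense for every \<open>y\<close> in \<open>W\<^sub>2\<^sup>m\<close>, and they agree on the
  domain of \<open>F\<close>. Their difference is an integral form in the quasi-derivatives of order at most \<open>m\<close>.
  Such a form vanishes on \<open>W\<^sub>2\<^sup>m\<close> as soon as it vanishes on the domain: pairing the solutions of the
  quasi-derivative system, whose right-hand side and boundary values are free, with a solution of
  the adjoint system whose inhomogeneity is given by the form shows that this adjoint solution is trivial
  where it matters. Hence a function \<open>y\<close> in the domain of \<open>F\<close> satisfies \<open>y\<^sup>[\<^sup>n\<^sup>] = \<ell>(y) \<in> L\<^sub>1\<close> in the
  distributional sense also with respect to any other associated matrix, and integrating this
  equation \<open>m\<close> times shows that the quasi-derivatives with respect to that matrix are absolutely continuous.\<close>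

subsection \<open>Test functions\<close>

text \<open>Neither domain is known to contain a test function, or any given function of the other
  domain, so the equations l(y) = y^[n] for two matrices cannot be compared on a set of functions
  fixed in advance. The common ground is W_2^m: entries of \<open>F\<close> occur only in columns up
  to m + 1, so all lower order terms involve quasi-derivatives of order at most m, and the
  derivatives beyond that order can be moved onto the test function. With z fixed, the difference
  becomes a form whose coefficients are in L_1 where they meet a continuous y^(i), i < m, and in L_2
  where they meet y^[m]. That such a form extends its vanishing from the domain to W_2^m amounts to
  density of the domain. It is obtained by duality instead of approximation, which needs many
  elements of the domain and hence an existence theorem for linear systems with merely integrable
  coefficients. The zero matrix serves as a reference: its quasi-derivatives up to order m are
  ordinary derivatives, so l is expanded with respect to it and the result is transferred to
  \<open>F\<close>.\<close>

definition smooth :: "(real \<Rightarrow> complex) \<Rightarrow> bool" where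
  "smooth z \<longleftrightarrow> (\<forall>k x. (ddx ^^ k) z differentiable (at x))"

lemma smooth_has_derivative: "smooth z \<Longrightarrow> (z has_vector_derivative ddx z x) (at x)"
  using vector_derivative_works[of z "at x"] by (auto simp: smooth_def ddx_def dest: spec[of _ 0])

lemma ddx_eqI: "(\<And>x. (f has_vector_derivative g x) (at x)) \<Longrightarrow> ddx f = g"
  by (auto simp: ddx_def vector_derivative_at)

lemma smooth_ddx: "smooth z \<Longrightarrow> smooth (ddx z)"
  unfolding smooth_def by (metis comp_apply funpow_Suc_right)

text \<open>Coinduction: if every member of \<open>S\<close> has a derivative in \<open>S\<close>,
  all iterated derivatives stay in \<open>S\<close> and are differentiable. Smoothness of a
  construction thus reduces to finding a family closed under differentiation.\<close>

lemma smooth_coinduct: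
  assumes "z \<in> S" and "\<And>f. f \<in> S \<Longrightarrow> \<exists>g\<in>S. \<forall>x. (f has_vector_derivative g x) (at x)"
  shows "smooth z"
proof -
  have "(ddx ^^ k) z \<in> S" for k
  proof (induction k)
    case (Suc k)
    then obtain g where "g \<in> S" "\<forall>x. ((ddx ^^ k) z has_vector_derivative g x) (at x)"
      using assms(2) by blast
    then show ?case using ddx_eqI[of "(ddx ^^ k) z" g] by simp
  qed (simp add: assms(1))
  then show ?thesis
    unfolding smooth_def using assms(2) differentiableI_vector by metis
qed

lemma smooth_const: "smooth (\<lambda>x. c)"
  by (rule smooth_coinduct[of _ "range (\<lambda>c x. c)"]) (auto intro!: exI[of _ 0] derivative_eq_intros)

lemma smooth_add:
  assumes "smooth f" "smooth g" shows "smooth (\<lambda>x. f x + g x)"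
proof (rule smooth_coinduct[of _ "{\<lambda>x. f x + g x | f g. smooth f \<and> smooth g}"])
  fix h assume "h \<in> {\<lambda>x. f x + g x | f g. smooth f \<and> smooth g}"
  then obtain f g where h: "h = (\<lambda>x. f x + g x)" "smooth f" "smooth g" by auto
  show "\<exists>g\<in>{\<lambda>x. f x + g x | f g. smooth f \<and> smooth g}. \<forall>x. (h has_vector_derivative g x) (at x)"
    by (rule bexI[of _ "\<lambda>x. ddx f x + ddx g x"])
      (use h in \<open>auto intro!: has_vector_derivative_add smooth_has_derivative intro: smooth_ddx\<close>)
qed (use assms in auto)

text \<open>The derivative of a product is a sum of two products, so products alone are not closed
  under differentiation; this closure is the family to which \<open>smooth_coinduct\<close> is
  applied.\<close>

inductive sum_of_products :: "(real \<Rightarrow> complex) \<Rightarrow> bool" where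
  product: "smooth f \<Longrightarrow> smooth g \<Longrightarrow> sum_of_products (\<lambda>x. f x * g x)"
| sum: "sum_of_products f \<Longrightarrow> sum_of_products g \<Longrightarrow> sum_of_products (\<lambda>x. f x + g x)"

lemma smooth_mult:
  assumes "smooth f" "smooth g" shows "smooth (\<lambda>x. f x * g x)"
proof (rule smooth_coinduct[of _ "Collect sum_of_products"])
  fix h assume "h \<in> Collect sum_of_products"
  then have "sum_of_products h" by simp
  then show "\<exists>g\<in>Collect sum_of_products. \<forall>x. (h has_vector_derivative g x) (at x)"
  proof induction
    case (product f g)
    then have "sum_of_products (\<lambda>x. f x * ddx g x + ddx f x * g x)"
      by (intro sum_of_products.intros smooth_ddx)
    moreover have "((\<lambda>x. f x * g x) has_vector_derivative (f x * ddx g x + ddx f x * g x)) (at x)" for x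
      using product by (intro has_vector_derivative_mult smooth_has_derivative)
    ultimately show ?case by (intro bexI[of _ "\<lambda>x. f x * ddx g x + ddx f x * g x"]) auto
  next
    case (sum f g)
    then obtain f' g' where "sum_of_products f'" "sum_of_products g'"
      "\<And>x. (f has_vector_derivative f' x) (at x)" "\<And>x. (g has_vector_derivative g' x) (at x)"
      by blast
    then show ?case
      by (intro bexI[of _ "\<lambda>x. f' x + g' x"])
         (auto intro!: has_vector_derivative_add sum_of_products.sum)
  qed
qed (use assms in \<open>auto intro: product\<close>)

lemma test_fun_iff: "z \<in> test_fun \<longleftrightarrow> smooth z \<and> closure {x. z x \<noteq> 0} \<subseteq> {0<..<1}"
  by (simp add: test_fun_def smooth_def)

lemma test_fun_smooth: "z \<in> test_fun \<Longrightarrow> smooth z"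
  by (simp add: test_fun_iff)

lemma test_fun_support:
  assumes "z \<in> test_fun"
  obtains a b where "0 < a" "a < b" "b < 1" "\<And>x. x \<notin> {a..b} \<Longrightarrow> z x = 0"
proof -
  \<comment> \<open>The points 1/3 and 1/2 make the set nonempty, so that extrema exist, and force
    \<open>a < b\<close>, also for the zero function.\<close>
  let ?S = "insert (1/3) (insert (1/2) (closure {x. z x \<noteq> 0}))"
  have sub: "?S \<subseteq> {0<..<1}" using assms by (auto simp: test_fun_iff)
  have "bounded ?S" by (rule bounded_subset[OF _ sub]) simp
  then have "compact ?S"
    by (simp add: compact_eq_bounded_closed)
  then obtain a b where ab: "a \<in> ?S" "b \<in> ?S" "\<And>x. x \<in> ?S \<Longrightarrow> a \<le> x \<and> x \<le> b"
    by (metis insertI1 insert_not_empty compact_attains_inf compact_attains_sup)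
  show ?thesis
  proof (rule that)
    show "0 < a" "b < 1" using ab sub by (auto simp: subset_iff)
    show "a < b" using ab(3)[of "1/2"] ab(3)[of "1/3"] by simp
    show "z x = 0" if "x \<notin> {a..b}" for x
      using ab(3)[of x] that closure_subset[of "{x. z x \<noteq> 0}"] by auto
  qed
qed

lemma test_funI:
  assumes "smooth z" "0 < a" "b < 1" "\<And>x. x \<notin> {a..b} \<Longrightarrow> z x = 0"
  shows "z \<in> test_fun"
proof -
  have "{x. z x \<noteq> 0} \<subseteq> {a..b}" using assms(4) by blast
  then have "closure {x. z x \<noteq> 0} \<subseteq> {a..b}" by (rule closure_minimal) auto
  then show ?thesis using assms by (auto simp: test_fun_iff)
qed

lemma test_fun_outside: "z \<in> test_fun \<Longrightarrow> x \<notin> {0<..<1} \<Longrightarrow> z x = 0"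
  using closure_subset[of "{x. z x \<noteq> 0}"] by (auto simp: test_fun_iff)

lemma test_fun_derivative: "z \<in> test_fun \<Longrightarrow> (z has_vector_derivative ddx z x) (at x)"
  by (simp add: test_fun_smooth smooth_has_derivative)

lemma test_fun_ddx:
  assumes "z \<in> test_fun" shows "ddx z \<in> test_fun"
proof -
  obtain a b where ab: "0 < a" "a < b" "b < 1" "\<And>x. x \<notin> {a..b} \<Longrightarrow> z x = 0"
    using test_fun_support[OF assms] by metis
  show ?thesis
  proof (rule test_funI)
    show "smooth (ddx z)" using assms by (simp add: test_fun_smooth smooth_ddx)
    fix x assume "x \<notin> {a..b}"
    then have x: "x \<in> - {a..b}" by simp
    have "((\<lambda>_. 0) has_vector_derivative 0) (at x)" by simp
    then have "(z has_vector_derivative 0) (at x)"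
      by (rule has_vector_derivative_transform_within_open[OF _ _ x]) (auto simp: ab(4) open_Compl)
    then show "ddx z x = 0" by (simp add: ddx_def vector_derivative_at)
  qed (use ab in auto)
qed

lemma test_fun_funpow_ddx: "z \<in> test_fun \<Longrightarrow> (ddx ^^ k) z \<in> test_fun"
  by (induction k) (auto intro: test_fun_ddx)

lemma test_fun_mult_smooth:
  assumes "z \<in> test_fun" "smooth c" shows "(\<lambda>x. c x * z x) \<in> test_fun"
  using test_fun_support[OF assms(1)] assms
  by (metis (no_types, lifting) mult_zero_right smooth_mult test_funI test_fun_smooth)

lemma test_fun_add:
  assumes "y \<in> test_fun" "z \<in> test_fun" shows "(\<lambda>x. y x + z x) \<in> test_fun"
proof -
  have "{x. y x + z x \<noteq> 0} \<subseteq> {x. y x \<noteq> 0} \<union> {x. z x \<noteq> 0}" by auto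
  then have "closure {x. y x + z x \<noteq> 0} \<subseteq> closure {x. y x \<noteq> 0} \<union> closure {x. z x \<noteq> 0}"
    by (metis closure_Un closure_mono)
  then show ?thesis using assms by (fastforce simp: test_fun_iff smooth_add)
qed

lemma test_fun_cmult: "z \<in> test_fun \<Longrightarrow> (\<lambda>x. c * z x) \<in> test_fun"
  by (rule test_fun_mult_smooth[OF _ smooth_const])

lemma test_fun_zero: "(\<lambda>x. 0) \<in> test_fun"
  by (simp add: test_fun_iff smooth_const)

lemma test_fun_mult: "y \<in> test_fun \<Longrightarrow> z \<in> test_fun \<Longrightarrow> (\<lambda>x. y x * z x) \<in> test_fun"
  by (rule test_fun_mult_smooth) (auto simp: test_fun_smooth)

section \<open>Bump functions built from exp(-1/t)\<close>

definition exp_inv :: "real poly \<Rightarrow> real \<Rightarrow> real" where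
  "exp_inv p t = (if t > 0 then poly p (inverse t) * exp (- inverse t) else 0)"

lemma poly_div_exp_tendsto_0: "((\<lambda>s. poly p s * exp (- s)) \<longlongrightarrow> (0::real)) at_top"
proof -
  have "((\<lambda>s. \<Sum>i\<le>degree p. coeff p i * (s ^ i / exp s)) \<longlongrightarrow> (\<Sum>i\<le>degree p. coeff p i * 0)) at_top"
    by (intro tendsto_intros tendsto_power_div_exp_0)
  then show ?thesis
    by (simp add: poly_altdef sum_distrib_right exp_minus divide_inverse mult.assoc)
qed

text \<open>With s = 1/t one has d/dt = -s^2 d/ds, so p(s) exp(-s) turns into s^2 (p - p')(s)
  exp(-s). The family indexed by polynomials is therefore closed under differentiation, also at 0,
  where the exponential beats every power of s.\<close>

lemma exp_inv_deriv:
  "(exp_inv p has_real_derivative exp_inv (monom 1 2 * (p - pderiv p)) t) (at t)"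
proof -
  consider "t < 0" | "t > 0" | "t = 0" by linarith
  then show ?thesis
  proof cases
    case 1
    have "((\<lambda>_. 0) has_real_derivative 0) (at t)" by simp
    then have "(exp_inv p has_real_derivative 0) (at t)"
      by (rule has_field_derivative_transform_within_open[of _ _ _ "{..<0}"]) 
         (use 1 in \<open>auto simp: exp_inv_def\<close>)
    then show ?thesis using 1 by (simp add: exp_inv_def)
  next
    case 2
    have "((\<lambda>t. poly p (inverse t) * exp (- inverse t)) has_real_derivative
        exp_inv (monom 1 2 * (p - pderiv p)) t) (at t)"
      using 2
      by (auto intro!: derivative_eq_intros DERIV_chain2[OF poly_DERIV]
          simp: exp_inv_def poly_monom algebra_simps power2_eq_square)
    then show ?thesis
      by (rule has_field_derivative_transform_within_open[of _ _ _ "{0<..}"]) 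
         (use 2 in \<open>auto simp: exp_inv_def\<close>)
  next
    case 3
    have "((\<lambda>h. exp_inv p h / h) \<longlongrightarrow> 0) (at_left 0)"
      by (rule tendsto_eventually)
         (auto simp: eventually_at_left_field exp_inv_def intro!: exI[of _ "-1"])
    moreover have "((\<lambda>h. exp_inv p h / h) \<longlongrightarrow> 0) (at_right 0)"
    proof -
      \<comment> \<open>The extra factor \<open>[:0, 1:]\<close> absorbs the division by
        \<open>h\<close> in the difference quotient at 0.\<close>
      have "((\<lambda>h. poly (p * [:0, 1:]) (inverse h) * exp (- inverse h)) \<longlongrightarrow> 0) (at_right (0::real))"
        by (rule filterlim_compose[OF poly_div_exp_tendsto_0 filterlim_inverse_at_top_right])
      then show ?thesis
        by (rule Lim_transform_eventually)
           (auto simp: eventually_at_right_field exp_inv_def field_simps intro!: exI[of _ 1])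
    qed
    ultimately have "((\<lambda>h. exp_inv p h / h) \<longlongrightarrow> 0) (at 0)"
      by (rule filterlim_split_at)
    then show ?thesis using 3 by (simp add: DERIV_def exp_inv_def)
  qed
qed

lemma smooth_exp_inv: "smooth (\<lambda>x. complex_of_real (exp_inv p (a * x + b)))"
proof (rule smooth_coinduct[of _ "range (\<lambda>p x. complex_of_real (exp_inv p (a * x + b)))"])
  fix f assume "f \<in> range (\<lambda>p x. complex_of_real (exp_inv p (a * x + b)))"
  then obtain p where f: "f = (\<lambda>x. complex_of_real (exp_inv p (a * x + b)))" by auto
  define q where "q = smult a (monom 1 2 * (p - pderiv p))"
  have "((\<lambda>x. exp_inv p (a * x + b)) has_real_derivative exp_inv q (a * x + b)) (at x)" for x
    by (rule DERIV_cong, rule DERIV_chain2[OF exp_inv_deriv])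
       (auto intro!: derivative_eq_intros simp: exp_inv_def q_def)
  then have "(f has_vector_derivative complex_of_real (exp_inv q (a * x + b))) (at x)" for x
    unfolding f by (rule has_vector_derivative_of_real)
  then show "\<exists>g\<in>range (\<lambda>p x. complex_of_real (exp_inv p (a * x + b))).
      \<forall>x. (f has_vector_derivative g x) (at x)"
    by (intro bexI[of _ "\<lambda>x. complex_of_real (exp_inv q (a * x + b))"]) auto
qed auto

subsection \<open>Integration on the unit interval\<close>

lemma finite_unit_leb: "finite_measure unit_leb"
  by (rule finite_measure_lebesgue_on) simp

lemma pair_unit_leb: "pair_sigma_finite unit_leb unit_leb"
  using finite_measure.axioms(1)[OF finite_unit_leb] by (intro pair_sigma_finite.intro)

lemma unit_leb_borel_sets: "B \<in> sets borel \<Longrightarrow> {x\<in>space unit_leb. x \<in> B} \<in> sets unit_leb"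
proof -
  assume "B \<in> sets borel"
  then have "{0..1} \<inter> B \<in> sets lebesgue" by (intro sets.Int) auto
  moreover have "{x\<in>space unit_leb. x \<in> B} = {0..1} \<inter> B" by auto
  ultimately show ?thesis by (simp only: sets_restrict_space_iff) (auto simp: sets_restrict_space_iff)
qed

lemma indicator_measurable_unit_leb [measurable]:
  "B \<in> sets borel \<Longrightarrow>
    (indicator B :: real \<Rightarrow> 'b::{t1_space, zero_neq_one}) \<in> borel_measurable unit_leb"
  using unit_leb_borel_sets[of B]
  by (simp add: borel_measurable_indicator_iff Int_def conj_commute)

lemma AE_unit_leb_neq: "AE x in unit_leb. x \<noteq> c"
proof -
  have "AE x in lebesgue. x \<noteq> c"
    by (intro AE_completion AE_lborel_singleton)
  then show ?thesis by (subst AE_restrict_space_iff) auto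
qed

lemma AE_unit_leb_mem: "AE x in unit_leb. x \<in> {0..1}"
  by (rule AE_I2) simp

lemma continuous_imp_measurable_unit_leb:
  "continuous_on {0..1} g \<Longrightarrow> g \<in> borel_measurable unit_leb"
  by (rule continuous_imp_measurable_on_sets_lebesgue) auto

lemma Lp_1_iff: "f \<in> Lp 1 \<longleftrightarrow> integrable unit_leb f"
  by (auto simp: Lp_def integrable_norm_iff)

lemma integrable_mult_bounded:
  fixes f g :: "real \<Rightarrow> complex"
  assumes "integrable unit_leb f" "g \<in> borel_measurable unit_leb" "\<And>x. x \<in> {0..1} \<Longrightarrow> norm (g x) \<le> B"
  shows "integrable unit_leb (\<lambda>x. f x * g x)"
proof (rule Bochner_Integration.integrable_bound)
  show "integrable unit_leb (\<lambda>x. B * norm (f x))" using assms by simp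
  show "(\<lambda>x. f x * g x) \<in> borel_measurable unit_leb"
    using assms borel_measurable_integrable by (intro borel_measurable_times) auto
  show "AE x in unit_leb. norm (f x * g x) \<le> norm (B * norm (f x))"
    using assms(3) by (auto intro!: AE_I2 mult_right_mono simp: norm_mult abs_mult mult.commute[of "norm (f _)"])
      (smt (verit, best) mult_right_mono norm_ge_zero)
qed

lemma continuous_on_unit_bounded:
  assumes "continuous_on {0..1::real} (g :: _ \<Rightarrow> complex)"
  obtains B where "\<And>x. x \<in> {0..1} \<Longrightarrow> norm (g x) \<le> B"
proof -
  have "bounded (g ` {0..1})"
    using assms compact_continuous_image compact_imp_bounded by blast
  then obtain B where "\<forall>x\<in>{0..1}. norm (g x) \<le> B" by (auto simp: bounded_iff)
  then show ?thesis using that[of B] by blast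
qed

lemma integrable_mult_continuous:
  assumes "integrable unit_leb f" "continuous_on {0..1} g"
  shows "integrable unit_leb (\<lambda>x. f x * g x :: complex)"
  using assms continuous_on_unit_bounded
  by (metis continuous_imp_measurable_unit_leb integrable_mult_bounded)

lemma integrable_continuous:
  assumes "continuous_on {0..1} (g :: real \<Rightarrow> complex)" shows "integrable unit_leb g"
  using integrable_mult_continuous[OF _ assms, of "\<lambda>_. 1"]
    finite_measure.integrable_const[OF finite_unit_leb] by simp

lemma Lp_2_imp_integrable:
  assumes "f \<in> Lp 2" shows "integrable unit_leb f"
proof (rule Bochner_Integration.integrable_bound)
  show "integrable unit_leb (\<lambda>x. 1 + cmod (f x) ^ 2)"
    using assms finite_measure.integrable_const[OF finite_unit_leb]
    by (intro Bochner_Integration.integrable_add) (auto simp: Lp_def)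
  have "t \<le> 1 + t ^ 2" for t :: real
    using sum_power2_ge_zero[of "t - 1/2" 0] by (simp add: power2_eq_square algebra_simps)
  then show "AE x in unit_leb. norm (f x) \<le> norm (1 + cmod (f x) ^ 2)"
    by (intro AE_I2) (simp add: abs_of_nonneg)
qed (use assms in \<open>simp add: Lp_def\<close>)

lemma integrable_mult_Lp_2:
  assumes "f \<in> Lp 2" "g \<in> Lp 2" shows "integrable unit_leb (\<lambda>x. f x * g x)"
proof (rule Bochner_Integration.integrable_bound)
  show "integrable unit_leb (\<lambda>x. cmod (f x) ^ 2 + cmod (g x) ^ 2)"
    using assms by (auto simp: Lp_def)
  show "(\<lambda>x. f x * g x) \<in> borel_measurable unit_leb"
    using assms by (auto simp: Lp_def intro!: borel_measurable_times)
  have "s * t \<le> s ^ 2 + t ^ 2" if "s \<ge> 0" "t \<ge> 0" for s t :: real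
    using sum_squares_bound[of s t] mult_nonneg_nonneg[OF that] by simp
  then show "AE x in unit_leb. norm (f x * g x) \<le> norm (cmod (f x) ^ 2 + cmod (g x) ^ 2)"
    by (intro AE_I2) (simp add: abs_of_nonneg norm_mult)
qed

lemma Lp_2_mult_bounded:
  assumes "f \<in> Lp 2" "g \<in> borel_measurable unit_leb" "\<And>x. x \<in> {0..1} \<Longrightarrow> norm (g x) \<le> B"
  shows "(\<lambda>x. f x * g x) \<in> Lp 2"
proof -
  have [measurable]: "f \<in> borel_measurable unit_leb" using assms by (simp add: Lp_def)
  have "integrable unit_leb (\<lambda>x. cmod (f x * g x) ^ 2)"
  proof (rule Bochner_Integration.integrable_bound)
    show "integrable unit_leb (\<lambda>x. B\<^sup>2 * cmod (f x) ^ 2)" using assms by (simp add: Lp_def)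
    have "cmod (f x * g x) ^ 2 \<le> B\<^sup>2 * cmod (f x) ^ 2" if "x \<in> {0..1}" for x
      using power_mono[OF assms(3)[OF that], of 2]
      by (simp add: norm_mult power_mult_distrib mult.commute[of "_ (f x) ^ 2"] mult_right_mono)
    then show "AE x in unit_leb. norm (cmod (f x * g x) ^ 2) \<le> norm (B\<^sup>2 * cmod (f x) ^ 2)"
      by (intro AE_I2) (simp add: abs_mult)
  qed (use assms in measurable)
  then show ?thesis using assms by (simp add: Lp_def)
qed

lemma Lp_2_mult_continuous:
  assumes "f \<in> Lp 2" "continuous_on {0..1} g" shows "(\<lambda>x. f x * g x) \<in> Lp 2"
  using assms continuous_on_unit_bounded
  by (metis continuous_imp_measurable_unit_leb Lp_2_mult_bounded)

lemma Lp_2_continuous: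
  assumes "continuous_on {0..1} g" shows "g \<in> Lp 2"
proof -
  have "(\<lambda>_. 1) \<in> Lp 2"
    using finite_measure.integrable_const[OF finite_unit_leb] by (simp add: Lp_def)
  from Lp_2_mult_continuous[OF this assms] show ?thesis by simp
qed

lemma Lp_2_cmult: "f \<in> Lp 2 \<Longrightarrow> (\<lambda>x. c * f x) \<in> Lp 2"
  using Lp_2_mult_continuous[of f "\<lambda>_. c"] by (simp add: mult.commute)

lemma Lp_2_add:
  assumes "f \<in> Lp 2" "g \<in> Lp 2" shows "(\<lambda>x. f x + g x) \<in> Lp 2"
proof -
  have [measurable]: "f \<in> borel_measurable unit_leb" "g \<in> borel_measurable unit_leb"
    using assms by (auto simp: Lp_def)
  have "integrable unit_leb (\<lambda>x. cmod (f x + g x) ^ 2)"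
  proof (rule Bochner_Integration.integrable_bound)
    show "integrable unit_leb (\<lambda>x. 2 * cmod (f x) ^ 2 + 2 * cmod (g x) ^ 2)"
      using assms by (auto simp: Lp_def)
    have "cmod (f x + g x) ^ 2 \<le> 2 * cmod (f x) ^ 2 + 2 * cmod (g x) ^ 2" for x
      using power_mono[OF norm_triangle_ineq[of "f x" "g x"], of 2] sum_squares_bound[of "cmod (f x)" "cmod (g x)"]
      by (simp add: power2_sum)
    then show "AE x in unit_leb. norm (cmod (f x + g x) ^ 2) \<le> norm (2 * cmod (f x) ^ 2 + 2 * cmod (g x) ^ 2)"
      by (intro AE_I2) (simp add: abs_of_nonneg)
  qed measurable
  then show ?thesis using assms by (simp add: Lp_def)
qed

lemma Lp_2_sum:
  assumes "\<And>i. i \<in> I \<Longrightarrow> f i \<in> Lp 2" shows "(\<lambda>x. \<Sum>i\<in>I. f i x) \<in> Lp 2"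
proof (cases "finite I")
  case True
  then show ?thesis using assms
    by (induction I) (auto intro!: Lp_2_add simp: Lp_2_continuous)
qed (simp add: Lp_2_continuous)

lemma test_fun_continuous: "z \<in> test_fun \<Longrightarrow> continuous_on S z"
  by (meson continuous_at_imp_continuous_on has_vector_derivative_continuous test_fun_derivative)

lemma integrable_mult_test_fun:
  "integrable unit_leb f \<Longrightarrow> z \<in> test_fun \<Longrightarrow> integrable unit_leb (\<lambda>x. f x * z x)"
  by (intro integrable_mult_continuous test_fun_continuous)

lemma integrable_test_fun: "z \<in> test_fun \<Longrightarrow> integrable unit_leb z"
  by (intro integrable_continuous test_fun_continuous)

section \<open>The fundamental lemma of the calculus of variations\<close>

lemma AE_zero_if_integral_atMost_zero:
  fixes f :: "real \<Rightarrow> real"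
  assumes f: "integrable unit_leb f" and zero: "\<And>c. (LINT x|unit_leb. indicator {..c} x * f x) = 0"
  shows "AE x in unit_leb. f x = 0"
proof -
  have f_ind: "integrable unit_leb (\<lambda>x. indicator B x * f x)" if "B \<in> sets borel" for B
  proof (rule Bochner_Integration.integrable_bound[OF f])
    show "(\<lambda>x. indicator B x * f x) \<in> borel_measurable unit_leb"
      using that borel_measurable_integrable[OF f] by measurable
  qed (simp add: indicator_def)
  have total: "(LINT x|unit_leb. f x) = 0"
    using zero[of 1] Bochner_Integration.integral_cong[of unit_leb unit_leb "\<lambda>x. indicator {..1} x * f x" f]
    by simp
  have borel: "(LINT x|unit_leb. indicator B x * f x) = 0" if "B \<in> sets borel" for B
  proof -
    \<comment> \<open>The half-lines form a pi-system generating the Borel sets; complements (by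
      \<open>total\<close>) and disjoint unions (by dominated convergence) preserve the vanishing of
      the integral.\<close>
    have "Int_stable (range (\<lambda>a. {..a::real}))"
      by (auto simp: Int_stable_def)
    moreover have "range (\<lambda>a. {..a::real}) \<subseteq> Pow UNIV" by simp
    moreover have "B \<in> sigma_sets UNIV (range (\<lambda>a. {..a::real}))"
      using that by (simp add: borel_eq_atMost)
    ultimately show ?thesis
    proof (induction rule: sigma_sets_induct_disjoint)
      case (compl A)
      have A: "A \<in> sets borel" using compl by (simp add: borel_eq_atMost)
      have "(LINT x|unit_leb. indicator (UNIV - A) x * f x)
          = (LINT x|unit_leb. f x - indicator A x * f x)"
        by (intro Bochner_Integration.integral_cong) (auto simp: indicator_def)
      also have "\<dots> = 0" using compl f f_ind[OF A] total by simp
      finally show ?case .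
    next
      case (union A)
      have A: "A i \<in> sets borel" for i using union by (auto simp: borel_eq_atMost)
      have "(\<lambda>n. LINT x|unit_leb. indicator (\<Union>i<n. A i) x * f x)
          \<longlonglongrightarrow> (LINT x|unit_leb. indicator (\<Union>i. A i) x * f x)"
      proof (rule integral_dominated_convergence[where w="\<lambda>x. norm (f x)"])
        show "AE x in unit_leb. (\<lambda>n. indicator (\<Union>i<n. A i) x * f x) \<longlonglongrightarrow> indicator (\<Union>i. A i) x * f x"
          by (intro AE_I2 tendsto_mult_right LIMSEQ_indicator_UN)
        show "(\<lambda>x. indicator (\<Union>i. A i) x * f x) \<in> borel_measurable unit_leb"
          using A by (intro borel_measurable_integrable f_ind) auto
        show "(\<lambda>x. indicator (\<Union>i<n. A i) x * f x) \<in> borel_measurable unit_leb" for n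
          using A by (intro borel_measurable_integrable f_ind) auto
        show "AE x in unit_leb. norm (indicator (\<Union>i<n. A i) x * f x) \<le> norm (f x)" for n
          by (simp add: indicator_def)
        show "integrable unit_leb (\<lambda>x. norm (f x))" using f by simp
      qed
      moreover have "(LINT x|unit_leb. indicator (\<Union>i<n. A i) x * f x) = 0" for n
      proof -
        have "(LINT x|unit_leb. indicator (\<Union>i<n. A i) x * f x)
           = (LINT x|unit_leb. (\<Sum>i<n. indicator (A i) x * f x))"
        proof (intro Bochner_Integration.integral_cong refl)
          fix x
          have "indicator (\<Union>i<n. A i) x = (\<Sum>i<n. indicat_real (A i) x)"
            using union(1) by (intro indicator_UN_disjoint) (auto intro: disjoint_family_on_mono)
          then show "indicator (\<Union>i<n. A i) x * f x = (\<Sum>i<n. indicator (A i) x * f x)"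
            by (simp add: sum_distrib_right)
        qed
        also have "\<dots> = (\<Sum>i<n. LINT x|unit_leb. indicator (A i) x * f x)"
          by (intro Bochner_Integration.integral_sum f_ind A)
        also have "\<dots> = 0" using union by simp
        finally show ?thesis .
      qed
      ultimately show ?case by (simp add: LIMSEQ_const_iff)
    qed (use zero in auto)
  qed
  show ?thesis
  proof (rule density_unique_real[OF f])
    fix A assume "A \<in> sets unit_leb"
    then have "A \<in> sets lebesgue"
      by (simp add: sets_restrict_space_iff)
    \<comment> \<open>A Lebesgue set is a Borel set up to a subset of a null set, which carries the
      Borel case to all measurable sets.\<close>
    then obtain B N N' where A: "A = B \<union> N" "N \<subseteq> N'" "N' \<in> null_sets lborel" "B \<in> sets lborel"
      by (rule sets_completionE)
    have "AE x in lborel. x \<notin> N'" using A(3) by (rule AE_not_in)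
    then have "AE x in unit_leb. x \<notin> N'"
      by (subst AE_restrict_space_iff) (auto intro: AE_completion)
    then have "AE x in unit_leb. indicator A x * f x = indicator B x * f x"
      by (rule AE_mp) (use A(1,2) in \<open>auto intro!: AE_I2 simp: indicator_def\<close>)
    then have "(LINT x|unit_leb. indicator A x * f x) = (LINT x|unit_leb. indicator B x * f x)"
    proof (rule integral_cong_AE[rotated 2])
      show "(\<lambda>x. indicator B x * f x) \<in> borel_measurable unit_leb"
        using A by (intro borel_measurable_integrable f_ind) simp
      show "(\<lambda>x. indicator A x * f x) \<in> borel_measurable unit_leb"
        using \<open>A \<in> sets unit_leb\<close> borel_measurable_integrable[OF f] by measurable
    qed
    then show "(\<integral>x\<in>A. f x \<partial>unit_leb) = (\<integral>x\<in>A. 0 \<partial>unit_leb)"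
      using borel A by (simp add: set_lebesgue_integral_def)
  qed simp
qed

lemma exp_inv_tendsto_1:
  assumes "filterlim g at_top sequentially"
  shows "(\<lambda>n. complex_of_real (exp_inv 1 (g n))) \<longlonglongrightarrow> 1"
proof -
  have "(\<lambda>n. exp (- inverse (g n))) \<longlonglongrightarrow> exp (- 0)"
    by (intro tendsto_intros tendsto_inverse_0_at_top assms)
  moreover have "\<forall>\<^sub>F n in sequentially. exp (- inverse (g n)) = exp_inv 1 (g n)"
    using eventually_compose_filterlim[OF eventually_gt_at_top[of 0] assms]
    by eventually_elim (simp add: exp_inv_def)
  ultimately have "(\<lambda>n. exp_inv 1 (g n)) \<longlonglongrightarrow> 1"
    by (simp add: tendsto_cong)
  from tendsto_of_real[OF this] show ?thesis by simp
qed

lemma integral_atMost_zero_if_orthogonal: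
  assumes v: "integrable unit_leb v" and orth: "\<And>z. z \<in> test_fun \<Longrightarrow> (LINT x|unit_leb. v x * z x) = 0"
    and b: "0 < b" "b \<le> 1"
  shows "(LINT x|unit_leb. v x * indicator {0<..<b} x) = 0"
proof -
  \<comment> \<open>Between 1/n and b - 1/n this is exp(-1/(n x - 1)) exp(-1/(n b - n x - 1)),
    elsewhere 0: for \<open>n \<ge> 1\<close> a test function, bounded by 1 and tending pointwise to
    the indicator of (0, b).\<close>
  define \<psi> where "\<psi> n x = complex_of_real (exp_inv 1 (real n * x + (-1)))
      * complex_of_real (exp_inv 1 (- real n * x + (n * b - 1)))" for n x
  have test: "\<psi> n \<in> test_fun" if "n \<ge> 1" for n
  proof (rule test_funI)
    show "smooth (\<psi> n)"
      unfolding \<psi>_def by (intro smooth_mult smooth_exp_inv)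
    have "0 < 1 / real n" using that by simp
    then show "0 < 1 / n" "b - 1 / n < 1" using b by linarith+
    fix x assume "x \<notin> {1 / real n..b - 1 / real n}"
    then have "\<not> (real n * x + (-1) > 0 \<and> - real n * x + (n * b - 1) > 0)"
      using that by (auto simp: field_simps)
    then show "\<psi> n x = 0" by (auto simp: \<psi>_def exp_inv_def)
  qed
  have bound: "norm (\<psi> n x) \<le> 1" for n x
  proof -
    have "\<bar>exp_inv 1 t\<bar> \<le> 1" for t by (simp add: exp_inv_def)
    then show ?thesis by (simp add: \<psi>_def norm_mult mult_le_one)
  qed
  have lim: "(\<lambda>n. \<psi> n x) \<longlonglongrightarrow> indicator {0<..<b} x" for x
  proof (cases "x \<in> {0<..<b}")
    case True
    have top: "filterlim (\<lambda>n. real n * c - 1) at_top sequentially" if "c > 0" for c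
      using filterlim_tendsto_add_at_top[OF tendsto_const[of "-1"]
          filterlim_tendsto_pos_mult_at_top[OF tendsto_const that filterlim_real_sequentially]]
      by (simp add: algebra_simps)
    have "(\<lambda>n. \<psi> n x) \<longlonglongrightarrow> 1 * 1"
      unfolding \<psi>_def
    proof (intro tendsto_mult exp_inv_tendsto_1)
      show "filterlim (\<lambda>n. real n * x + - 1) at_top sequentially" using top[of x] True by simp
      show "filterlim (\<lambda>n. - real n * x + (real n * b - 1)) at_top sequentially"
        using top[of "b - x"] True by (simp add: algebra_simps)
    qed
    then show ?thesis using True by simp
  next
    case False
    have "\<psi> n x = 0" for n
    proof -
      have "\<not> (real n * x + (-1) > 0 \<and> - real n * x + (n * b - 1) > 0)"
      proof (cases "x \<le> 0")
        case True
        then have "real n * x \<le> 0" by (simp add: mult_nonneg_nonpos)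
        then show ?thesis by simp
      next
        case x: False
        then have "real n * b \<le> real n * x" using False by (intro mult_left_mono) auto
        then show ?thesis by simp
      qed
      then show ?thesis by (auto simp: \<psi>_def exp_inv_def)
    qed
    then show ?thesis using False by simp
  qed
  have meas: "v \<in> borel_measurable unit_leb" using v by simp
  have "(\<lambda>n. LINT x|unit_leb. v x * \<psi> (Suc n) x)
      \<longlonglongrightarrow> (LINT x|unit_leb. v x * indicator {0<..<b} x)"
  proof (rule integral_dominated_convergence[where w="\<lambda>x. norm (v x)"])
    show "AE x in unit_leb. (\<lambda>n. v x * \<psi> (Suc n) x) \<longlonglongrightarrow> v x * indicator {0<..<b} x"
      by (intro AE_I2 tendsto_mult_left LIMSEQ_Suc lim)
    show "(\<lambda>x. v x * \<psi> (Suc n) x) \<in> borel_measurable unit_leb" for n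
      by (intro borel_measurable_integrable integrable_mult_test_fun v test) simp
    show "(\<lambda>x. v x * indicator {0<..<b} x) \<in> borel_measurable unit_leb"
      using meas by measurable
    show "AE x in unit_leb. norm (v x * \<psi> (Suc n) x) \<le> norm (v x)" for n
      using bound by (intro AE_I2) (simp add: norm_mult mult_left_le)
  qed (use v in simp)
  then show ?thesis using orth test by (simp add: LIMSEQ_const_iff)
qed

text \<open>Inside [0,1] a half-line agrees up to two points with an interval (0, b), whose
  indicator is a bounded limit of test functions. Real and imaginary parts are then treated
  separately by \<open>AE_zero_if_integral_atMost_zero\<close>.\<close>

lemma fundamental_lemma:
  assumes v: "integrable unit_leb v" and orth: "\<And>z. z \<in> test_fun \<Longrightarrow> (LINT x|unit_leb. v x * z x) = 0"
  shows "AE x in unit_leb. v x = 0"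
proof -
  have meas: "v \<in> borel_measurable unit_leb" using v by simp
  have zero: "(LINT x|unit_leb. indicator {..c} x * v x) = 0" for c
  proof -
    define b where "b = min 1 c"
    have "(LINT x|unit_leb. indicator {..c} x * v x) = (LINT x|unit_leb. v x * indicator {0<..<b} x)"
    proof (rule integral_cong_AE)
      show "AE x in unit_leb. indicator {..c} x * v x = v x * indicator {0<..<b} x"
        using AE_unit_leb_neq[of 0] AE_unit_leb_neq[of b] AE_unit_leb_mem
        by eventually_elim (auto simp: b_def indicator_def)
    qed (use meas in measurable)
    also have "\<dots> = 0"
      using integral_atMost_zero_if_orthogonal[OF v orth, of b] by (cases "b > 0") (auto simp: b_def)
    finally show ?thesis .
  qed
  have ind: "integrable unit_leb (\<lambda>x. indicator {..c} x * v x)" for c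
  proof (rule Bochner_Integration.integrable_bound[OF v])
    show "(\<lambda>x. indicator {..c} x * v x) \<in> borel_measurable unit_leb"
      using meas by measurable
  qed (simp add: indicator_def)
  have "AE x in unit_leb. Re (v x) = 0"
  proof (rule AE_zero_if_integral_atMost_zero)
    fix c
    have "(LINT x|unit_leb. indicator {..c} x * Re (v x))
        = (LINT x|unit_leb. Re (indicator {..c} x * v x))"
      by (intro Bochner_Integration.integral_cong) (auto simp: indicator_def)
    also have "\<dots> = 0" using integral_Re[OF ind[of c]] zero[of c] by simp
    finally show "(LINT x|unit_leb. indicator {..c} x * Re (v x)) = 0" .
  qed (use v in auto)
  moreover have "AE x in unit_leb. Im (v x) = 0"
  proof (rule AE_zero_if_integral_atMost_zero)
    fix c
    have "(LINT x|unit_leb. indicator {..c} x * Im (v x))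
        = (LINT x|unit_leb. Im (indicator {..c} x * v x))"
      by (intro Bochner_Integration.integral_cong) (auto simp: indicator_def)
    also have "\<dots> = 0" using integral_Im[OF ind[of c]] zero[of c] by simp
    finally show "(LINT x|unit_leb. indicator {..c} x * Im (v x)) = 0" .
  qed (use v in auto)
  ultimately show ?thesis by eventually_elim (simp add: complex_eq_iff)
qed

subsection \<open>Primitives and weak derivatives\<close>

text \<open>The primitive vanishing at 0. Expressing the upper limit by an indicator keeps the
  domain of integration fixed, so that linearity and Fubini apply directly.\<close>

definition prim :: "(real \<Rightarrow> complex) \<Rightarrow> real \<Rightarrow> complex" where
  "prim g x = (LINT t|unit_leb. indicator {..x} t * g t)"

lemma integrable_indicator_mult:
  assumes "integrable unit_leb (g :: real \<Rightarrow> complex)"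
  shows "integrable unit_leb (\<lambda>t. indicator {..x} t * g t)"
proof (rule Bochner_Integration.integrable_bound[OF assms])
  show "(\<lambda>t. indicator {..x} t * g t) \<in> borel_measurable unit_leb"
    using borel_measurable_integrable[OF assms] by measurable
qed (simp add: indicator_def)

lemma prim_eq_integral:
  assumes g: "integrable unit_leb g" and x: "x \<in> {0..1}"
  shows "prim g x = integral {0..x} g"
proof -
  have "prim g x = integral {0..1} (\<lambda>t. indicator {..x} t * g t)"
    unfolding prim_def by (rule lebesgue_integral_eq_integral) (auto intro: integrable_indicator_mult g)
  also have "\<dots> = integral {0..1} (\<lambda>t. if t \<in> {0..x} then g t else 0)"
    by (rule Henstock_Kurzweil_Integration.integral_cong) (auto simp: indicator_def)
  also have "\<dots> = integral ({0..x} \<inter> {0..1}) g" by (rule Henstock_Kurzweil_Integration.integral_restrict_Int)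
  also have "{0..x} \<inter> {0..1} = {0..x}" using x by auto
  finally show ?thesis .
qed

lemma prim_continuous:
  assumes "integrable unit_leb g" shows "continuous_on {0..1} (prim g)"
proof -
  have "g integrable_on {0..1}"
    using has_integral_integral_lebesgue_on[OF assms] by (auto simp: integrable_on_def)
  then have "continuous_on {0..1} (\<lambda>x. integral {0..x} g)"
    by (rule indefinite_integral_continuous_1)
  then show ?thesis
    using prim_eq_integral[OF assms] continuous_on_cong[of "{0..1}" "{0..1}" "prim g"] by simp
qed

lemma prim_0: "prim g 0 = 0"
  unfolding prim_def
proof (rule integral_eq_zero_AE)
  show "AE t in unit_leb. indicator {..0} t * g t = 0"
    using AE_unit_leb_neq[of 0] AE_unit_leb_mem by eventually_elim (auto simp: indicator_def)
qed

lemma prim_1: "prim g 1 = (LINT t|unit_leb. g t)"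
  unfolding prim_def by (intro Bochner_Integration.integral_cong) auto

lemma prim_cong_AE:
  assumes "AE x in unit_leb. f x = g x" "integrable unit_leb f" "integrable unit_leb g"
  shows "prim f x = prim g x"
  unfolding prim_def
  by (rule integral_cong_AE)
     (use assms in \<open>auto intro!: borel_measurable_integrable integrable_indicator_mult\<close>)

lemma prim_diff:
  assumes "integrable unit_leb f" "integrable unit_leb g"
  shows "prim (\<lambda>x. f x - g x) x = prim f x - prim g x"
  unfolding prim_def
  by (subst Bochner_Integration.integral_diff[symmetric])
     (auto simp: integrable_indicator_mult assms right_diff_distrib)

lemma norm_prim_diff_le:
  assumes f: "integrable unit_leb f" and g: "integrable unit_leb g"
    and bound: "\<And>t. t \<in> {0..1} \<Longrightarrow> min x y < t \<Longrightarrow> t \<le> max x y \<Longrightarrow> norm (f t) \<le> g t"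
    and g0: "\<And>t. 0 \<le> g t"
  shows "norm (prim f x - prim f y) \<le> (LINT t|unit_leb. g t)"
proof -
  have "prim f x - prim f y = (LINT t|unit_leb. indicator {..x} t * f t - indicator {..y} t * f t)"
    unfolding prim_def by (simp add: integrable_indicator_mult f)
  also have "norm \<dots> \<le> (LINT t|unit_leb. g t)"
  proof (rule order_trans[OF integral_norm_bound integral_mono_AE])
    show "integrable unit_leb (\<lambda>t. norm (indicator {..x} t * f t - indicator {..y} t * f t))"
      by (intro integrable_norm Bochner_Integration.integrable_diff integrable_indicator_mult f)
    show "AE t in unit_leb. norm (indicator {..x} t * f t - indicator {..y} t * f t) \<le> g t"
      using bound g0 by (intro AE_I2) (auto simp: indicator_def)
  qed (rule g)
  finally show ?thesis .
qed

text \<open>In coordinates (s, t) both integrals have the integrand f(s) g(t), the first over t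
  \<le> s and the second over s \<le> t. Together these triangles fill the unit square and overlap
  only in the diagonal.\<close>

lemma prim_by_parts:
  assumes f: "integrable unit_leb f" and g: "integrable unit_leb g"
  shows "(LINT x|unit_leb. f x * prim g x) + (LINT x|unit_leb. prim f x * g x) = prim f 1 * prim g 1"
proof -
  interpret pair_sigma_finite unit_leb unit_leb by (rule pair_unit_leb)
  have [measurable]: "f \<in> borel_measurable unit_leb" "g \<in> borel_measurable unit_leb"
    using f g by auto
  have id [measurable]: "(\<lambda>x. x) \<in> borel_measurable unit_leb"
    using id_borel_measurable_lebesgue_on by (simp add: id_def)
  have fg: "integrable (unit_leb \<Otimes>\<^sub>M unit_leb) (\<lambda>(s, t). f s * g t)"
  proof (rule Fubini_integrable)
    show "integrable unit_leb (\<lambda>s. LINT t|unit_leb. norm (case (s, t) of (s, t) \<Rightarrow> f s * g t))"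
      using f g by (simp add: norm_mult)
    show "AE s in unit_leb. integrable unit_leb (\<lambda>t. case (s, t) of (s, t) \<Rightarrow> f s * g t)"
      using g by simp
  qed measurable
  have H: "integrable (unit_leb \<Otimes>\<^sub>M unit_leb) (\<lambda>(s, t). indicator {..t} s * (f s * g t))"
  proof (rule Bochner_Integration.integrable_bound[OF fg])
    have eq: "(\<lambda>(s, t). indicator {..t} s * (f s * g t))
      = (\<lambda>p. (if fst p \<le> snd p then 1 else 0) * (f (fst p) * g (snd p)))"
      by (auto simp: indicator_def fun_eq_iff)
    show "(\<lambda>(s, t). indicator {..t} s * (f s * g t)) \<in> borel_measurable (unit_leb \<Otimes>\<^sub>M unit_leb)"
      unfolding eq by measurable
  qed (auto simp: indicator_def)
  have "(LINT t|unit_leb. prim f t * g t) = (LINT t|unit_leb. LINT s|unit_leb. indicator {..t} s * (f s * g t))"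
    by (intro Bochner_Integration.integral_cong refl)
       (simp add: prim_def mult.assoc flip: Bochner_Integration.integral_mult_left_zero)
  also have "\<dots> = (LINT s|unit_leb. LINT t|unit_leb. indicator {..t} s * (f s * g t))"
    using Fubini_integral[OF H] .
  also have "\<dots> = (LINT s|unit_leb. f s * prim g 1 - f s * prim g s)"
  proof (intro Bochner_Integration.integral_cong refl)
    fix s :: real
    have "(LINT t|unit_leb. indicator {..t} s * (f s * g t))
        = (LINT t|unit_leb. f s * g t - f s * (indicator {..s} t * g t))"
    proof (rule integral_cong_AE)
      show "AE t in unit_leb. indicator {..t} s * (f s * g t) = f s * g t - f s * (indicator {..s} t * g t)"
        using AE_unit_leb_neq[of s] by eventually_elim (auto simp: indicator_def)
      have eq: "(\<lambda>t. indicator {..t} s * (f s * g t)) = (\<lambda>t. indicator {s..} t * (f s * g t))"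
        by (auto simp: indicator_def)
      show "(\<lambda>t. indicator {..t} s * (f s * g t)) \<in> borel_measurable unit_leb"
        unfolding eq by measurable
    qed measurable
    also have "\<dots> = f s * prim g 1 - f s * prim g s"
      by (simp add: integrable_indicator_mult g flip: prim_def) (simp add: prim_1)
    finally show "(LINT t|unit_leb. indicator {..t} s * (f s * g t)) = f s * prim g 1 - f s * prim g s" .
  qed
  also have "\<dots> = prim f 1 * prim g 1 - (LINT s|unit_leb. f s * prim g s)"
    using integrable_mult_continuous[OF f prim_continuous[OF g]] f by (simp add: prim_1)
  finally show ?thesis by simp
qed

lemma integral_by_parts:
  assumes f: "integrable unit_leb f" and g: "integrable unit_leb g"
    and F: "\<And>x. x \<in> {0..1} \<Longrightarrow> F x = a + prim f x" and G: "\<And>x. x \<in> {0..1} \<Longrightarrow> G x = b + prim g x"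
  shows "(LINT x|unit_leb. f x * G x + F x * g x) = F 1 * G 1 - F 0 * G 0"
proof -
  have pg: "integrable unit_leb (\<lambda>x. f x * prim g x)" and pf: "integrable unit_leb (\<lambda>x. prim f x * g x)"
    using integrable_mult_continuous[OF f prim_continuous[OF g]]
      integrable_mult_continuous[OF g prim_continuous[OF f]] by (simp_all add: mult.commute)
  have "(LINT x|unit_leb. f x * G x + F x * g x)
     = (LINT x|unit_leb. (f x * b + a * g x) + (f x * prim g x + prim f x * g x))"
    by (intro Bochner_Integration.integral_cong) (auto simp: F G algebra_simps)
  also have "\<dots> = prim f 1 * b + a * prim g 1 + prim f 1 * prim g 1"
    using f g pf pg prim_by_parts[OF f g] by (simp add: prim_1)
  also have "\<dots> = F 1 * G 1 - F 0 * G 0"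
    by (simp add: F G prim_0 algebra_simps)
  finally show ?thesis .
qed

lemma test_fun_eq_prim:
  assumes z: "z \<in> test_fun" and x: "x \<in> {0..1}" shows "z x = prim (ddx z) x"
proof -
  have "(ddx z has_integral z x - z 0) {0..x}"
    using x z by (intro fundamental_theorem_of_calculus)
       (auto intro: has_vector_derivative_at_within test_fun_derivative)
  then show ?thesis
    using prim_eq_integral[OF integrable_test_fun[OF test_fun_ddx[OF z]] x] test_fun_outside[OF z, of 0]
    by (simp add: integral_unique)
qed

lemma has_weak_deriv_iff:
  "has_weak_deriv f g \<longleftrightarrow> integrable unit_leb f \<and> integrable unit_leb g \<and>
     (\<forall>z\<in>test_fun. (LINT x|unit_leb. f x * ddx z x) = - (LINT x|unit_leb. g x * z x))"
proof -
  have "(- a = b) \<longleftrightarrow> (a = - b)" for a b :: complex by (metis minus_minus)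
  then show ?thesis
    unfolding has_weak_deriv_def dist_eq_def dist_deriv_def reg_dist_def Lp_1_iff by simp
qed

lemma has_weak_deriv_integrable:
  "has_weak_deriv f g \<Longrightarrow> integrable unit_leb f" "has_weak_deriv f g \<Longrightarrow> integrable unit_leb g"
  by (simp_all add: has_weak_deriv_iff)

lemma has_weak_deriv_integral:
  "has_weak_deriv f g \<Longrightarrow> z \<in> test_fun \<Longrightarrow>
    (LINT x|unit_leb. g x * z x) = - (LINT x|unit_leb. f x * ddx z x)"
  by (simp add: has_weak_deriv_iff)

text \<open>With \<open>has_weak_deriv_imp_prim\<close> this identifies W_1^1 with the absolutely
  continuous functions up to null sets. Integration by parts leaves no boundary terms because test
  functions vanish at 0 and 1.\<close>

lemma has_weak_deriv_prim:
  assumes g: "integrable unit_leb g" and F: "\<And>x. x \<in> {0..1} \<Longrightarrow> F x = a + prim g x"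
  shows "has_weak_deriv F g"
proof -
  have F': "continuous_on {0..1} F"
    using prim_continuous[OF g] continuous_on_cong[of "{0..1}" "{0..1}" F "\<lambda>x. a + prim g x"] F
    by (simp add: continuous_on_add)
  have "(LINT x|unit_leb. F x * ddx z x) = - (LINT x|unit_leb. g x * z x)" if z: "z \<in> test_fun" for z
  proof -
    have "(LINT x|unit_leb. g x * z x + F x * ddx z x) = F 1 * z 1 - F 0 * z 0"
      using g F integrable_test_fun[OF test_fun_ddx[OF z]] test_fun_eq_prim[OF z]
      by (intro integral_by_parts[where b=0]) auto
    then have "(LINT x|unit_leb. g x * z x) + (LINT x|unit_leb. F x * ddx z x) = 0"
      using integrable_mult_test_fun[OF g z] integrable_mult_test_fun[OF integrable_continuous[OF F'] test_fun_ddx[OF z]]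
      by (simp add: test_fun_outside[OF z])
    then show ?thesis by (simp add: eq_neg_iff_add_eq_0 add.commute)
  qed
  then show ?thesis by (simp add: has_weak_deriv_iff g integrable_continuous[OF F'])
qed

lemma integral_cong_AE_mult:
  fixes f f' h :: "real \<Rightarrow> complex"
  assumes "AE x in unit_leb. f x = f' x" "f \<in> borel_measurable unit_leb" "f' \<in> borel_measurable unit_leb"
    "h \<in> borel_measurable unit_leb"
  shows "(LINT x|unit_leb. f x * h x) = (LINT x|unit_leb. f' x * h x)"
  by (rule integral_cong_AE) (use assms in auto)

lemma has_weak_deriv_unique:
  assumes "has_weak_deriv f g" "has_weak_deriv f' g'" "AE x in unit_leb. f x = f' x"
  shows "AE x in unit_leb. g x = g' x"
proof -
  have [simp]: "integrable unit_leb f" "integrable unit_leb f'" "integrable unit_leb g" "integrable unit_leb g'"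
    using assms by (auto dest: has_weak_deriv_integrable)
  have "AE x in unit_leb. g x - g' x = 0"
  proof (rule fundamental_lemma)
    fix z assume z: "z \<in> test_fun"
    have "(LINT x|unit_leb. f x * ddx z x) = (LINT x|unit_leb. f' x * ddx z x)"
      using assms(3) integrable_test_fun[OF test_fun_ddx[OF z]]
      by (intro integral_cong_AE_mult borel_measurable_integrable) auto
    then have "(LINT x|unit_leb. g x * z x) = (LINT x|unit_leb. g' x * z x)"
      using has_weak_deriv_integral[OF assms(1) z] has_weak_deriv_integral[OF assms(2) z] by simp
    then show "(LINT x|unit_leb. (g x - g' x) * z x) = 0"
      by (simp add: left_diff_distrib integrable_mult_test_fun z)
  qed simp
  then show ?thesis by simp
qed

lemma has_weak_deriv_cong:
  assumes "has_weak_deriv f g" "AE x in unit_leb. f x = f' x" "AE x in unit_leb. g x = g' x"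
    and "integrable unit_leb f'" "integrable unit_leb g'"
  shows "has_weak_deriv f' g'"
  unfolding has_weak_deriv_iff
proof (intro conjI ballI)
  fix z assume z: "z \<in> test_fun"
  have [simp]: "integrable unit_leb f" "integrable unit_leb g"
    using assms by (auto dest: has_weak_deriv_integrable)
  have "(LINT x|unit_leb. f x * ddx z x) = (LINT x|unit_leb. f' x * ddx z x)"
    using assms integrable_test_fun[OF test_fun_ddx[OF z]]
    by (intro integral_cong_AE_mult borel_measurable_integrable) auto
  moreover have "(LINT x|unit_leb. g x * z x) = (LINT x|unit_leb. g' x * z x)"
    using assms integrable_test_fun[OF z]
    by (intro integral_cong_AE_mult borel_measurable_integrable) auto
  ultimately show "(LINT x|unit_leb. f' x * ddx z x) = - (LINT x|unit_leb. g' x * z x)"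
    using has_weak_deriv_integral[OF assms(1) z] by (simp add: equation_minus_iff)
qed (use assms in auto)

lemma weak_deriv_eq:
  assumes "has_weak_deriv f g"
  shows "has_weak_deriv f (weak_deriv f)" "AE x in unit_leb. weak_deriv f x = g x"
proof -
  show *: "has_weak_deriv f (weak_deriv f)"
    unfolding weak_deriv_def by (rule someI[of "has_weak_deriv f"]) (rule assms)
  show "AE x in unit_leb. weak_deriv f x = g x"
    by (rule has_weak_deriv_unique[OF * assms]) simp
qed

section \<open>Distributions with zero derivative\<close>

lemma test_fun_antiderivative:
  assumes z: "z \<in> test_fun" and mean: "(LINT x|unit_leb. z x) = 0"
  shows "\<exists>y\<in>test_fun. ddx y = z"
proof -
  obtain a b where ab: "0 < a" "a < b" "b < 1" "\<And>x. x \<notin> {a..b} \<Longrightarrow> z x = 0"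
    using test_fun_support[OF z] by metis
  define y where "y x = integral {0..x} z" for x
  have zint: "z integrable_on {c..d}" for c d
    using test_fun_continuous[OF z] by (rule integrable_continuous_real)
  have y_left: "y x = 0" if "x < a" for x
  proof -
    have "y x = integral {0..x} (\<lambda>_. 0)"
      unfolding y_def using that ab by (intro Henstock_Kurzweil_Integration.integral_cong) auto
    then show ?thesis by simp
  qed
  have tail: "integral {c..d} z = 0" if "c > b" for c d
  proof -
    have "integral {c..d} z = integral {c..d} (\<lambda>_. 0)"
      using that ab by (intro Henstock_Kurzweil_Integration.integral_cong) auto
    then show ?thesis by simp
  qed
  \<comment> \<open>Here the mean value 0 enters; it makes the primitive vanish to the right of the
    support as well.\<close>
  have y1: "y 1 = 0"
    using mean lebesgue_integral_eq_integral[OF integrable_test_fun[OF z]] by (simp add: y_def)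
  have y_right: "y x = 0" if "x > b" for x
  proof (cases "x \<le> 1")
    case True
    then have "y x + integral {x..1} z = y 1"
      unfolding y_def using that ab zint by (intro Henstock_Kurzweil_Integration.integral_combine) auto
    then show ?thesis using tail[OF that] y1 by simp
  next
    case False
    then have "y 1 + integral {1..x} z = y x"
      unfolding y_def using that ab zint by (intro Henstock_Kurzweil_Integration.integral_combine) auto
    then show ?thesis using tail[of 1] ab y1 by simp
  qed
  have deriv: "(y has_vector_derivative z x) (at x)" for x
  proof (cases "x < a")
    case True
    have "((\<lambda>_. 0) has_vector_derivative z x) (at x)" using ab(4)[of x] True by simp
    then show ?thesis
      by (rule has_vector_derivative_transform_within_open[of _ _ _ "{..<a}"])
         (use True y_left in auto)
  next
    case False
    have "(y has_vector_derivative z x) (at x within {0..x + 1})"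
      unfolding y_def using test_fun_continuous[OF z] False ab
      by (intro integral_has_vector_derivative) auto
    then show ?thesis using False ab by (simp add: at_within_Icc_at)
  qed
  have "smooth y"
  proof (rule smooth_coinduct[of _ "insert y {f. smooth f}"])
    fix f assume "f \<in> insert y {f. smooth f}"
    then show "\<exists>g\<in>insert y {f. smooth f}. \<forall>x. (f has_vector_derivative g x) (at x)"
      using deriv test_fun_smooth[OF z] smooth_ddx smooth_has_derivative by blast
  qed simp
  then have "y \<in> test_fun"
    by (rule test_funI[of _ a b]) (use ab y_left y_right in auto)
  moreover have "ddx y = z" using deriv by (rule ddx_eqI)
  ultimately show ?thesis by blast
qed

text \<open>Indirect, which saves integrating a bump: without such a function, rescaling shows that
  all test functions have integral 0, and then the fundamental lemma makes the constant 1 vanish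
  almost everywhere.\<close>

lemma test_fun_unit_mean: "\<exists>\<rho>\<in>test_fun. (LINT x|unit_leb. \<rho> x) = 1"
proof (rule ccontr)
  assume none: "\<not> ?thesis"
  have "(LINT x|unit_leb. z x) = 0" if z: "z \<in> test_fun" for z
  proof (rule ccontr)
    assume nz: "(LINT x|unit_leb. z x) \<noteq> 0"
    define c where "c = inverse (LINT x|unit_leb. z x)"
    have "(LINT x|unit_leb. c * z x) = 1" using nz by (simp add: c_def)
    then show False using none test_fun_cmult[OF z] by blast
  qed
  then have "AE x in unit_leb. (1::complex) = 0"
    by (intro fundamental_lemma) (auto simp: finite_measure.integrable_const[OF finite_unit_leb])
  then have "(LINT x|unit_leb. (1::complex)) = (LINT x|unit_leb. 0)"
    by (intro integral_cong_AE) auto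
  moreover have "(LINT x|unit_leb. (1::complex)) = integral {0..1::real} (\<lambda>_. 1)"
    by (rule lebesgue_integral_eq_integral[of "{0..1}"]) (simp_all add: finite_measure.integrable_const[OF finite_unit_leb])
  ultimately show False by simp
qed

text \<open>Subtracting from \<open>z\<close> its integral times \<open>\<rho>\<close> leaves a
  function of mean 0, that is, the derivative of a test function, which \<open>S\<close>
  annihilates. The functional is abstract because the lemma serves both functions and distributional
  quasi-derivatives.\<close>

lemma constant_if_annihilates_derivatives:
  assumes zero: "\<And>z. z \<in> test_fun \<Longrightarrow> S (ddx z) = 0"
    and add: "\<And>y z. y \<in> test_fun \<Longrightarrow> z \<in> test_fun \<Longrightarrow> S (\<lambda>x. y x + z x) = S y + S z"
    and scale: "\<And>c z. z \<in> test_fun \<Longrightarrow> S (\<lambda>x. c * z x) = c * S z"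
  shows "\<exists>c::complex. \<forall>z\<in>test_fun. S z = c * (LINT x|unit_leb. z x)"
proof -
  obtain \<rho> where \<rho>: "\<rho> \<in> test_fun" "(LINT x|unit_leb. \<rho> x) = 1"
    using test_fun_unit_mean by blast
  have "S z = S \<rho> * (LINT x|unit_leb. z x)" if z: "z \<in> test_fun" for z
  proof -
    define c where "c = - (LINT x|unit_leb. z x)"
    have "(LINT x|unit_leb. z x + c * \<rho> x) = 0"
      using \<rho> integrable_test_fun[OF z] integrable_test_fun[OF \<rho>(1)] by (simp add: c_def)
    moreover have "(\<lambda>x. z x + c * \<rho> x) \<in> test_fun"
      using z \<rho> by (intro test_fun_add test_fun_cmult)
    ultimately have "S (\<lambda>x. z x + c * \<rho> x) = 0"
      using test_fun_antiderivative zero by metis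
    then show ?thesis
      using add[OF z test_fun_cmult[OF \<rho>(1)], of c] scale[OF \<rho>(1), of c] by (simp add: c_def algebra_simps)
  qed
  then show ?thesis by blast
qed

text \<open>Du Bois-Reymond's lemma: \<open>f - prim g\<close> has distributional derivative 0,
  hence is constant.\<close>

lemma has_weak_deriv_imp_prim:
  assumes "has_weak_deriv f g"
  shows "\<exists>c. AE x in unit_leb. f x = c + prim g x"
proof -
  have f: "integrable unit_leb f" and g: "integrable unit_leb g"
    using assms by (auto dest: has_weak_deriv_integrable)
  have p: "integrable unit_leb (prim g)" using prim_continuous[OF g] by (rule integrable_continuous)
  have pw: "has_weak_deriv (prim g) g" by (rule has_weak_deriv_prim[OF g, of _ 0]) simp
  define S where "S z = (LINT x|unit_leb. (f x - prim g x) * z x)" for z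
  have fp: "integrable unit_leb (\<lambda>x. f x - prim g x)" using f p by simp
  have S: "integrable unit_leb (\<lambda>x. (f x - prim g x) * z x)" if "z \<in> test_fun" for z
    using fp that by (rule integrable_mult_test_fun)
  have "\<exists>c. \<forall>z\<in>test_fun. S z = c * (LINT x|unit_leb. z x)"
  proof (rule constant_if_annihilates_derivatives)
    show "S (ddx z) = 0" if z: "z \<in> test_fun" for z
      using has_weak_deriv_integral[OF assms z] has_weak_deriv_integral[OF pw z]
        integrable_mult_test_fun[OF f test_fun_ddx[OF z]] integrable_mult_test_fun[OF p test_fun_ddx[OF z]]
      by (simp add: S_def left_diff_distrib)
    show "S (\<lambda>x. y x + z x) = S y + S z" if "y \<in> test_fun" "z \<in> test_fun" for y z
      using S[OF that(1)] S[OF that(2)] by (simp add: S_def distrib_left)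
    show "S (\<lambda>x. c * z x) = c * S z" if "z \<in> test_fun" for c z
      by (simp add: S_def mult.left_commute)
  qed
  then obtain c where c: "\<And>z. z \<in> test_fun \<Longrightarrow> S z = c * (LINT x|unit_leb. z x)" by blast
  have "AE x in unit_leb. (f x - prim g x) - c = 0"
  proof (rule fundamental_lemma)
    show "integrable unit_leb (\<lambda>x. f x - prim g x - c)"
      by (rule Bochner_Integration.integrable_diff[OF fp finite_measure.integrable_const[OF finite_unit_leb]])
    fix z assume z: "z \<in> test_fun"
    have "(LINT x|unit_leb. (f x - prim g x - c) * z x) = (LINT x|unit_leb. (f x - prim g x) * z x - c * z x)"
      by (simp add: algebra_simps)
    also have "\<dots> = 0" using c[OF z] S[OF z] integrable_test_fun[OF z] by (simp add: S_def)
    finally show "(LINT x|unit_leb. (f x - prim g x - c) * z x) = 0" .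
  qed
  then have "AE x in unit_leb. f x = c + prim g x"
    by eventually_elim (simp add: algebra_simps)
  then show ?thesis by blast
qed

subsection \<open>Linear systems with integrable coefficients\<close>

text \<open>As \<open>\<alpha>\<close> is only integrable, the weight has to be compared with its
  mass and not with a supremum. Uniform continuity of the primitive gives a window around
  \<open>x\<close> of mass at most 1/4, and outside the window the exponential leaves at most
  another 1/4.\<close>

lemma exp_weight_integral_small:
  assumes \<alpha>: "integrable unit_leb \<alpha>" and \<alpha>0: "\<And>t. \<alpha> t \<ge> (0::real)"
  obtains K :: real where "\<And>x. x \<in> {0..1} \<Longrightarrow> (LINT t|unit_leb. \<alpha> t * exp (- K * \<bar>x - t\<bar>)) \<le> 1 / 2"
proof -
  define I where "I = (LINT t|unit_leb. \<alpha> t)"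
  have I: "I \<ge> 0" unfolding I_def using \<alpha>0 by (intro integral_nonneg_AE) auto
  have \<alpha>c: "integrable unit_leb (\<lambda>t. complex_of_real (\<alpha> t))" using \<alpha> by simp
  have "uniformly_continuous_on {0..1} (prim (\<lambda>t. complex_of_real (\<alpha> t)))"
    by (intro compact_uniformly_continuous prim_continuous \<alpha>c) auto
  then obtain \<delta> where \<delta>: "\<delta> > 0" and small: "\<And>x y. x \<in> {0..1} \<Longrightarrow> y \<in> {0..1} \<Longrightarrow> dist y x < \<delta> \<Longrightarrow>
      dist (prim (\<lambda>t. complex_of_real (\<alpha> t)) y) (prim (\<lambda>t. complex_of_real (\<alpha> t)) x) < 1 / 4"
    unfolding uniformly_continuous_on_def by (metis zero_less_divide_1_iff zero_less_numeral)
  define \<eta> where "\<eta> = \<delta> / 3"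
  have \<eta>: "\<eta> > 0" using \<delta> by (simp add: \<eta>_def)
  \<comment> \<open>Chosen so that exp(K \<eta>) \<ge> 1 + K \<eta> = 1 + 4 I, whence exp(-K \<eta>)
    I \<le> 1/4.\<close>
  define K where "K = 4 * I / \<eta>"
  have K: "K \<ge> 0" using I \<eta> by (simp add: K_def)
  have "1 + K * \<eta> \<le> exp (K * \<eta>)" by (rule exp_ge_add_one_self)
  then have "1 + 4 * I \<le> exp (K * \<eta>)" using \<eta> by (simp add: K_def)
  then have exp_small: "exp (- K * \<eta>) * I \<le> 1 / 4"
    using I by (simp add: exp_minus field_simps)
  have ind: "integrable unit_leb (\<lambda>t. indicator {..c} t * \<alpha> t)" for c
  proof (rule Bochner_Integration.integrable_bound[OF \<alpha>])
    show "(\<lambda>t. indicator {..c} t * \<alpha> t) \<in> borel_measurable unit_leb"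
      using borel_measurable_integrable[OF \<alpha>] by measurable
  qed (simp add: indicator_def)
  have primr: "prim (\<lambda>t. complex_of_real (\<alpha> t)) c = complex_of_real (LINT t|unit_leb. indicator {..c} t * \<alpha> t)" for c
    unfolding prim_def integral_complex_of_real[symmetric]
    by (intro Bochner_Integration.integral_cong) (auto simp: indicator_def)
  have "(LINT t|unit_leb. \<alpha> t * exp (- K * \<bar>x - t\<bar>)) \<le> 1 / 2" if x: "x \<in> {0..1}" for x
  proof -
    define p q where "p = max 0 (x - \<eta>)" and "q = min 1 (x + \<eta>)"
    have pq: "p \<in> {0..1}" "q \<in> {0..1}" "dist q p < \<delta>"
      using x \<eta> by (auto simp: p_def q_def \<eta>_def dist_real_def)
    have "(LINT t|unit_leb. \<alpha> t * exp (- K * \<bar>x - t\<bar>))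
       \<le> (LINT t|unit_leb. (indicator {..q} t * \<alpha> t - indicator {..p} t * \<alpha> t) + exp (- K * \<eta>) * \<alpha> t)"
    proof (rule integral_mono_AE)
      show "integrable unit_leb (\<lambda>t. \<alpha> t * exp (- K * \<bar>x - t\<bar>))"
      proof (rule Bochner_Integration.integrable_bound[OF \<alpha>])
        have "(\<lambda>t. exp (- K * \<bar>x - t\<bar>)) \<in> borel_measurable unit_leb"
          by (intro continuous_imp_measurable_on_sets_lebesgue continuous_intros) auto
        then show "(\<lambda>t. \<alpha> t * exp (- K * \<bar>x - t\<bar>)) \<in> borel_measurable unit_leb"
          using borel_measurable_integrable[OF \<alpha>] by measurable
        show "AE t in unit_leb. norm (\<alpha> t * exp (- K * \<bar>x - t\<bar>)) \<le> norm (\<alpha> t)"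
          using K by (intro AE_I2) (simp add: abs_mult mult_left_le)
      qed
      show "integrable unit_leb (\<lambda>t. (indicator {..q} t * \<alpha> t - indicator {..p} t * \<alpha> t) + exp (- K * \<eta>) * \<alpha> t)"
        using ind \<alpha> by simp
      show "AE t in unit_leb. \<alpha> t * exp (- K * \<bar>x - t\<bar>)
          \<le> (indicator {..q} t * \<alpha> t - indicator {..p} t * \<alpha> t) + exp (- K * \<eta>) * \<alpha> t"
        using AE_unit_leb_neq[of 0] AE_unit_leb_mem
      proof eventually_elim
        case (elim t)
        show ?case
        proof (cases "p < t \<and> t \<le> q")
          case True
          have "\<alpha> t * exp (- K * \<bar>x - t\<bar>) \<le> \<alpha> t"
            using K \<alpha>0[of t] by (simp add: mult_left_le)
          then show ?thesis using True \<alpha>0[of t] by (simp add: indicator_def add_increasing2)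
        next
          case False
          have "\<eta> \<le> \<bar>x - t\<bar>" using False elim by (auto simp: p_def q_def)
          then have "exp (- K * \<bar>x - t\<bar>) \<le> exp (- K * \<eta>)" using K by (simp add: mult_left_mono)
          then have "\<alpha> t * exp (- K * \<bar>x - t\<bar>) \<le> exp (- K * \<eta>) * \<alpha> t"
            using \<alpha>0[of t] by (subst mult.commute) (rule mult_right_mono)
          moreover have "indicator {..q} t * \<alpha> t - indicator {..p} t * \<alpha> t = 0"
            using False x \<eta> by (auto simp: indicator_def p_def q_def)
          ultimately show ?thesis by linarith
        qed
      qed
    qed
    also have "\<dots> = ((LINT t|unit_leb. indicator {..q} t * \<alpha> t) - (LINT t|unit_leb. indicator {..p} t * \<alpha> t))
        + exp (- K * \<eta>) * I"
      using ind \<alpha> by (simp add: I_def)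
    also have "(LINT t|unit_leb. indicator {..q} t * \<alpha> t) - (LINT t|unit_leb. indicator {..p} t * \<alpha> t) \<le> 1 / 4"
      using order_trans[OF abs_ge_self less_imp_le[OF small[OF pq(1,2,3), unfolded primr dist_of_real dist_real_def]]]
      by simp
    finally show ?thesis using exp_small by simp
  qed
  then show ?thesis by (rule that)
qed

text \<open>Continuity can be checked on each slice \<open>{i} \<times> UNIV\<close> because these
  slices are open.\<close>

lemma continuous_on_discrete_times:
  fixes G :: "'a discrete \<times> real \<Rightarrow> complex"
  assumes "\<And>i. continuous_on UNIV (\<lambda>x. G (i, x))"
  shows "continuous_on UNIV G"
proof -
  have "continuous_on (\<Union>i. {i} \<times> UNIV) G"
  proof (rule continuous_on_open_UN)
    fix i :: "'a discrete"
    show "open ({i} \<times> (UNIV :: real set))" by (intro open_Times) (auto simp: open_discrete)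
    have "continuous_on ({i} \<times> UNIV) (\<lambda>p. (\<lambda>x. G (i, x)) (snd p))"
      by (rule continuous_on_compose2[OF assms]) (auto intro: continuous_on_snd)
    then show "continuous_on ({i} \<times> UNIV) G"
      by (rule continuous_on_eq) auto
  qed
  moreover have "(\<Union>i::'a discrete. {i} \<times> (UNIV :: real set)) = UNIV" by auto
  ultimately show ?thesis by simp
qed

text \<open>The solution operator is a contraction for the supremum norm weighted by
  \<open>exp (- K * \<bar>x - s\<bar>)\<close> with large \<open>K\<close>. Indexing by a discrete metric space makes
  vectors of continuous functions a single bounded continuous function.\<close>

lemma linear_system_solvable:
  fixes A :: "nat \<Rightarrow> nat \<Rightarrow> real \<Rightarrow> complex"
  assumes A: "\<And>i j. i < n \<Longrightarrow> j < n \<Longrightarrow> integrable unit_leb (A i j)"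
    and h: "\<And>i. i < n \<Longrightarrow> integrable unit_leb (h i)" and s: "s \<in> {0..1}"
  obtains Y where "\<And>i. i < n \<Longrightarrow> continuous_on {0..1} (Y i)"
    "\<And>i x. i < n \<Longrightarrow> x \<in> {0..1} \<Longrightarrow> Y i x = c i
      + (prim (\<lambda>t. (\<Sum>j<n. A i j t * Y j t) + h i t) x - prim (\<lambda>t. (\<Sum>j<n. A i j t * Y j t) + h i t) s)"
proof -
  define \<alpha> where "\<alpha> t = (\<Sum>i<n. \<Sum>j<n. norm (A i j t))" for t
  have \<alpha>: "integrable unit_leb \<alpha>"
    unfolding \<alpha>_def by (intro Bochner_Integration.integrable_sum integrable_norm A) auto
  have \<alpha>0: "\<alpha> t \<ge> 0" for t by (simp add: \<alpha>_def sum_nonneg)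
  obtain K where K: "\<And>x. x \<in> {0..1} \<Longrightarrow> (LINT t|unit_leb. \<alpha> t * exp (- K * \<bar>x - t\<bar>)) \<le> 1 / 2"
    using exp_weight_integral_small[OF \<alpha> \<alpha>0] by blast
  \<comment> \<open>The unknown of the fixed point equation is \<open>Z = W' * Y\<close>, so that
    the weighted norm of \<open>Y\<close> becomes the plain supremum norm of
    \<open>Z\<close>.\<close>
  define W where "W t = complex_of_real (exp (K * \<bar>t - s\<bar>))" for t
  define W' where "W' t = complex_of_real (exp (- K * \<bar>t - s\<bar>))" for t
  have WW: "W t * W' t = 1" "W' t * W t = 1" for t
    by (simp_all add: W_def W'_def flip: of_real_mult exp_add)
  have Wcont [continuous_intros]: "continuous_on S W" "continuous_on S W'" for S
    unfolding W_def W'_def by (intro continuous_intros)+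
  define f where "f Z i t = (\<Sum>j<n. A i j t * (W t * Z (discrete j, t))) + h i t"
    for Z :: "nat discrete \<times> real \<Rightarrow> complex" and i t
  define u where "u Z i x = W' x * (c i + (prim (f Z i) x - prim (f Z i) s))" for Z i x
  \<comment> \<open>Bounded continuous functions live on the whole line: \<open>cl\<close> retracts
    it onto [0,1], and in \<open>V\<close> the components of index at least \<open>n\<close> are set
    to 0.\<close>
  define cl :: "real \<Rightarrow> real" where "cl x = max 0 (min 1 x)" for x
  have cl: "cl x \<in> {0..1}" and cl_id: "x \<in> {0..1} \<Longrightarrow> cl x = x" for x by (auto simp: cl_def)
  define V where "V Z = (\<lambda>(i, x). if of_discrete i < n then u Z (of_discrete i) (cl x) else 0)" for Z
  have Zc: "continuous_on {0..1} (\<lambda>t. W t * apply_bcontfun Z (discrete j, t))" for Z j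
    by (intro continuous_intros continuous_on_compose2[OF continuous_on_apply_bcontfun[of UNIV Z]]) auto
  have fint: "integrable unit_leb (f (apply_bcontfun Z) i)" if "i < n" for Z i
    unfolding f_def
    by (intro Bochner_Integration.integrable_add Bochner_Integration.integrable_sum
        integrable_mult_continuous A h Zc) (use that in auto)
  have ucont: "continuous_on {0..1} (u (apply_bcontfun Z) i)" if "i < n" for Z i
    unfolding u_def by (intro continuous_intros prim_continuous fint that)
  have V: "V (apply_bcontfun Z) \<in> bcontfun" for Z
  proof -
    obtain B where B: "\<And>i x. i < n \<Longrightarrow> x \<in> {0..1} \<Longrightarrow> norm (u (apply_bcontfun Z) i x) \<le> B i"
    proof -
      have "\<exists>B. \<forall>x\<in>{0..1}. norm (u (apply_bcontfun Z) i x) \<le> B" if "i < n" for i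
        by (rule continuous_on_unit_bounded[OF ucont[OF that, of Z]]) blast
      then obtain B where "\<And>i. i < n \<Longrightarrow> \<forall>x\<in>{0..1}. norm (u (apply_bcontfun Z) i x) \<le> B i"
        by metis
      then show thesis using that by blast
    qed
    have "continuous_on UNIV (V (apply_bcontfun Z))"
    proof (rule continuous_on_discrete_times)
      fix i
      have "continuous_on UNIV (\<lambda>x. u (apply_bcontfun Z) (of_discrete i) (cl x))" if "of_discrete i < n"
        by (rule continuous_on_compose2[OF ucont[OF that]])
           (use cl in \<open>auto simp: cl_def intro!: continuous_intros\<close>)
      then show "continuous_on UNIV (\<lambda>x. V (apply_bcontfun Z) (i, x))"
        by (cases "of_discrete i < n") (simp_all add: V_def)
    qed
    moreover have "norm (V (apply_bcontfun Z) p) \<le> (\<Sum>i<n. \<bar>B i\<bar>)" for p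
    proof (cases p)
      case (Pair i x)
      have "norm (u (apply_bcontfun Z) (of_discrete i) (cl x)) \<le> (\<Sum>i<n. \<bar>B i\<bar>)" if "of_discrete i < n"
        using B[OF that cl[of x]] member_le_sum[of "of_discrete i" "{..<n}" "\<lambda>i. \<bar>B i\<bar>"] that by force
      then show ?thesis by (simp add: Pair V_def sum_nonneg)
    qed
    ultimately show ?thesis by (rule bcontfun_normI)
  qed
  define T where "T Z = Bcontfun (V (apply_bcontfun Z))" for Z
  have T: "apply_bcontfun (T Z) = V (apply_bcontfun Z)" for Z
    unfolding T_def using V by (rule Bcontfun_inverse)
  have "dist (T Z) (T Z') \<le> 1 / 2 * dist Z Z'" for Z Z'
  proof (rule dist_bound)
    fix p :: "nat discrete \<times> real"
    obtain d x where d: "p = (d, x)" by (cases p)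
    define i where "i = of_discrete d"
    have p: "p = (discrete i, x)" by (simp add: d i_def of_discrete_inverse)
    show "dist (apply_bcontfun (T Z) p) (apply_bcontfun (T Z') p) \<le> 1 / 2 * dist Z Z'"
    proof (cases "i < n")
      case i: True
      define y where "y = cl x"
      have y: "y \<in> {0..1}" using cl by (simp add: y_def)
      define D where "D = dist Z Z'"
      have D: "norm (apply_bcontfun Z q - apply_bcontfun Z' q) \<le> D" for q
        using dist_bounded[of Z q Z'] by (simp add: D_def dist_norm)
      define g where "g t = f (apply_bcontfun Z) i t - f (apply_bcontfun Z') i t" for t
      have g: "integrable unit_leb g" unfolding g_def using fint[OF i] by simp
      have g_le: "norm (g t) \<le> \<alpha> t * (exp (K * \<bar>t - s\<bar>) * D)" for t
      proof -
        have "g t = (\<Sum>j<n. A i j t * (W t * (apply_bcontfun Z (discrete j, t) - apply_bcontfun Z' (discrete j, t))))"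
          by (simp add: g_def f_def right_diff_distrib sum_subtractf)
        also have "norm \<dots> \<le> (\<Sum>j<n. norm (A i j t) * (exp (K * \<bar>t - s\<bar>) * D))"
          using D by (intro order_trans[OF norm_sum] sum_mono)
             (auto simp: norm_mult W_def intro!: mult_left_mono)
        also have "\<dots> = (\<Sum>j<n. norm (A i j t)) * (exp (K * \<bar>t - s\<bar>) * D)"
          by (simp add: sum_distrib_right)
        also have "\<dots> \<le> \<alpha> t * (exp (K * \<bar>t - s\<bar>) * D)"
        proof (rule mult_right_mono)
          show "(\<Sum>j<n. norm (A i j t)) \<le> \<alpha> t"
            unfolding \<alpha>_def using i by (intro member_le_sum[of i _ "\<lambda>i. \<Sum>j<n. norm (A i j t)"]) (auto simp: sum_nonneg)
        qed (simp add: D_def)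
        finally show ?thesis .
      qed
      have "dist (apply_bcontfun (T Z) p) (apply_bcontfun (T Z') p)
          = norm (W' y * (prim g y - prim g s))"
        using i fint[OF i] by (simp add: T V_def p discrete_inverse u_def y_def dist_norm g_def[abs_def] prim_diff algebra_simps)
      also have "\<dots> = norm (prim (\<lambda>t. W' y * g t) y - prim (\<lambda>t. W' y * g t) s)"
        by (simp add: prim_def mult.left_commute right_diff_distrib)
      also have "\<dots> \<le> (LINT t|unit_leb. \<alpha> t * exp (- K * \<bar>y - t\<bar>) * D)"
      proof (rule norm_prim_diff_le)
        show "integrable unit_leb (\<lambda>t. W' y * g t)" using g by simp
        show "integrable unit_leb (\<lambda>t. \<alpha> t * exp (- K * \<bar>y - t\<bar>) * D)"
        proof (rule Bochner_Integration.integrable_bound)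
          show "integrable unit_leb (\<lambda>t. (exp \<bar>K\<bar> * D) * \<alpha> t)" using \<alpha> by simp
          have "(\<lambda>t. exp (- K * \<bar>y - t\<bar>)) \<in> borel_measurable unit_leb"
            by (intro continuous_imp_measurable_on_sets_lebesgue continuous_intros) auto
          then show "(\<lambda>t. \<alpha> t * exp (- K * \<bar>y - t\<bar>) * D) \<in> borel_measurable unit_leb"
            using borel_measurable_integrable[OF \<alpha>] by measurable
          show "AE t in unit_leb. norm (\<alpha> t * exp (- K * \<bar>y - t\<bar>) * D) \<le> norm (exp \<bar>K\<bar> * D * \<alpha> t)"
          proof (rule AE_I2)
            fix t assume "t \<in> space unit_leb"
            then have "\<bar>y - t\<bar> \<le> 1" using y by auto
            then have "\<bar>K\<bar> * \<bar>y - t\<bar> \<le> \<bar>K\<bar> * 1" by (intro mult_left_mono) auto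
            moreover have "- K * \<bar>y - t\<bar> \<le> \<bar>K\<bar> * \<bar>y - t\<bar>" by (intro mult_right_mono) auto
            ultimately have "exp (- K * \<bar>y - t\<bar>) \<le> exp \<bar>K\<bar>" by simp
            then have "\<alpha> t * D * exp (- K * \<bar>y - t\<bar>) \<le> \<alpha> t * D * exp \<bar>K\<bar>"
              using \<alpha>0[of t] by (intro mult_left_mono) (auto simp: D_def)
            then show "norm (\<alpha> t * exp (- K * \<bar>y - t\<bar>) * D) \<le> norm (exp \<bar>K\<bar> * D * \<alpha> t)"
              using \<alpha>0[of t] by (simp add: abs_mult D_def mult_ac)
          qed
        qed
        show "0 \<le> \<alpha> t * exp (- K * \<bar>y - t\<bar>) * D" for t using \<alpha>0[of t] by (simp add: D_def)
        fix t assume t: "min y s < t" "t \<le> max y s"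
        have "norm (W' y * g t) \<le> exp (- K * \<bar>y - s\<bar>) * (\<alpha> t * (exp (K * \<bar>t - s\<bar>) * D))"
          using g_le[of t] by (simp add: norm_mult W'_def)
        also have "\<dots> = \<alpha> t * exp (- K * \<bar>y - s\<bar> + K * \<bar>t - s\<bar>) * D"
          by (simp only: exp_add mult_ac)
        \<comment> \<open>For \<open>t\<close> between \<open>s\<close> and \<open>y\<close> the
          distances add up, so the two weights merge into the kernel estimated in
          \<open>exp_weight_integral_small\<close>. This is why the weight is centred at
          \<open>s\<close>, where the value of \<open>Y\<close> is prescribed.\<close>
        also have "- K * \<bar>y - s\<bar> + K * \<bar>t - s\<bar> = - K * \<bar>y - t\<bar>"
        proof -
          have "\<bar>y - s\<bar> = \<bar>y - t\<bar> + \<bar>t - s\<bar>" using t by auto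
          then show ?thesis by (simp add: algebra_simps)
        qed
        finally show "norm (W' y * g t) \<le> \<alpha> t * exp (- K * \<bar>y - t\<bar>) * D" .
      qed
      also have "\<dots> = (LINT t|unit_leb. \<alpha> t * exp (- K * \<bar>y - t\<bar>)) * D" by simp
      also have "\<dots> \<le> 1 / 2 * D" using K[OF y] by (intro mult_right_mono) (auto simp: D_def)
      finally show ?thesis by (simp add: D_def)
    qed (simp add: T V_def p discrete_inverse)
  qed
  then obtain Z where Z: "T Z = Z"
    using banach_fix_type[of "1/2" T] by auto
  define Y where "Y i t = W t * apply_bcontfun Z (discrete i, t)" for i t
  have fY: "f (apply_bcontfun Z) i = (\<lambda>t. (\<Sum>j<n. A i j t * Y j t) + h i t)" for i
    by (simp add: f_def[abs_def] Y_def)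
  show ?thesis
  proof (rule that)
    show "continuous_on {0..1} (Y i)" for i unfolding Y_def by (rule Zc)
    fix i x assume i: "i < n" and x: "x \<in> {0..1::real}"
    have "Y i x = W x * V (apply_bcontfun Z) (discrete i, x)" using T[of Z] Z by (simp add: Y_def)
    also have "\<dots> = W x * W' x * (c i + (prim (f (apply_bcontfun Z) i) x - prim (f (apply_bcontfun Z) i) s))"
      using i x by (simp add: V_def u_def cl_id mult.assoc discrete_inverse)
    finally show "Y i x = c i + (prim (\<lambda>t. (\<Sum>j<n. A i j t * Y j t) + h i t) x
        - prim (\<lambda>t. (\<Sum>j<n. A i j t * Y j t) + h i t) s)"
      by (simp add: WW fY)
  qed
qed

subsection \<open>Quasi-derivatives\<close>

text \<open>Rests on completeness of Lebesgue measure; extension by 0 moves the question from [0,1]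
  to the whole line.\<close>

lemma borel_measurable_unit_leb_AE:
  fixes f g :: "real \<Rightarrow> complex"
  assumes f: "f \<in> borel_measurable unit_leb" and eq: "AE x in unit_leb. f x = g x"
  shows "g \<in> borel_measurable unit_leb"
proof -
  have "(\<lambda>x. if x \<in> {0..1} then f x else 0) \<in> borel_measurable lebesgue"
    using f by (subst borel_measurable_if) auto
  moreover have "AE x in lebesgue. (if x \<in> {0..1} then f x else 0) = (if x \<in> {0..1} then g x else 0)"
    using eq by (subst (asm) AE_restrict_space_iff) (auto elim!: AE_mp)
  ultimately have "(\<lambda>x. if x \<in> {0..1} then g x else 0) \<in> borel_measurable lebesgue"
    by (rule borel_measurable_AE)
  then show ?thesis by (subst (asm) borel_measurable_if) auto
qed

lemma integrable_unit_leb_AE: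
  fixes f g :: "real \<Rightarrow> complex"
  assumes "integrable unit_leb f" "AE x in unit_leb. f x = g x"
  shows "integrable unit_leb g"
  using integrable_cong_AE_imp[OF assms(1) _ assms(2)]
    borel_measurable_unit_leb_AE[OF borel_measurable_integrable[OF assms(1)] assms(2)] by simp

lemma Lp_2_AE:
  assumes "f \<in> Lp 2" "AE x in unit_leb. f x = g x" shows "g \<in> Lp 2"
proof -
  have meas: "f \<in> borel_measurable unit_leb" using assms by (simp add: Lp_def)
  then have meas': "g \<in> borel_measurable unit_leb"
    using assms(2) by (rule borel_measurable_unit_leb_AE)
  have "integrable unit_leb (\<lambda>x. cmod (f x) ^ 2)" using assms(1) by (simp add: Lp_def)
  then have "integrable unit_leb (\<lambda>x. cmod (g x) ^ 2)"
  proof (rule integrable_cong_AE_imp)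
    show "AE x in unit_leb. cmod (f x) ^ 2 = cmod (g x) ^ 2"
      using assms(2) by eventually_elim simp
  qed (use meas' in measurable)
  then show ?thesis using meas' by (simp add: Lp_def)
qed

lemma has_weak_deriv_AE:
  assumes "has_weak_deriv f g" "AE x in unit_leb. f x = f' x" "AE x in unit_leb. g x = g' x"
  shows "has_weak_deriv f' g'"
  by (intro has_weak_deriv_cong[OF assms] integrable_unit_leb_AE[OF _ assms(2)]
      integrable_unit_leb_AE[OF _ assms(3)] has_weak_deriv_integrable[OF assms(1)])

text \<open>Makes W_1^1 functions multipliers of L_1 and L_2: multiply by the continuous
  representative, then change the product on a null set.\<close>

lemma has_weak_deriv_AE_continuous:
  assumes "has_weak_deriv f g"
  obtains F where "continuous_on {0..1} F" "AE x in unit_leb. F x = f x"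
proof -
  obtain c where "AE x in unit_leb. f x = c + prim g x"
    using has_weak_deriv_imp_prim[OF assms] by blast
  then have "AE x in unit_leb. c + prim g x = f x" by (rule AE_symmetric)
  moreover have "continuous_on {0..1} (\<lambda>x. c + prim g x)"
    using assms by (intro continuous_intros prim_continuous has_weak_deriv_integrable)
  ultimately show ?thesis using that by blast
qed

lemma integrable_mult_has_weak_deriv:
  assumes "integrable unit_leb a" "has_weak_deriv f g"
  shows "integrable unit_leb (\<lambda>x. a x * f x)"
proof -
  obtain F where F: "continuous_on {0..1} F" "AE x in unit_leb. F x = f x"
    using has_weak_deriv_AE_continuous[OF assms(2)] by blast
  from F(2) have "AE x in unit_leb. a x * F x = a x * f x" by eventually_elim simp
  with integrable_mult_continuous[OF assms(1) F(1)] show ?thesis by (rule integrable_unit_leb_AE)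
qed

lemma Lp_2_mult_has_weak_deriv:
  assumes "a \<in> Lp 2" "has_weak_deriv f g"
  shows "(\<lambda>x. a x * f x) \<in> Lp 2"
proof -
  obtain F where F: "continuous_on {0..1} F" "AE x in unit_leb. F x = f x"
    using has_weak_deriv_AE_continuous[OF assms(2)] by blast
  from F(2) have "AE x in unit_leb. a x * F x = a x * f x" by eventually_elim simp
  with Lp_2_mult_continuous[OF assms(1) F(1)] show ?thesis by (rule Lp_2_AE)
qed

lemma Lp_2_has_weak_deriv:
  assumes "has_weak_deriv f g" shows "f \<in> Lp 2"
  using Lp_2_mult_has_weak_deriv[OF Lp_2_continuous[of "\<lambda>_. 1"] assms] by simp

lemma AE_sum_cong:
  fixes f g :: "'i \<Rightarrow> real \<Rightarrow> complex"
  assumes "finite I" "\<And>i. i \<in> I \<Longrightarrow> AE x in unit_leb. f i x = g i x"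
  shows "AE x in unit_leb. (\<Sum>i\<in>I. f i x) = (\<Sum>i\<in>I. g i x)"
proof -
  have "AE x in unit_leb. \<forall>i\<in>I. f i x = g i x"
    using assms by (intro AE_finite_allI)
  then show ?thesis by eventually_elim simp
qed

text \<open>\<open>W2 m\<close> is \<open>W\<^sub>2\<^sup>m[0,1]\<close> for \<open>m > 0\<close>, phrased through the iterates of \<^const>\<open>weak_deriv\<close>.\<close>

definition W2 :: "nat \<Rightarrow> (real \<Rightarrow> complex) set" where
  "W2 m = {y. (\<forall>i<m. has_weak_deriv ((weak_deriv ^^ i) y) ((weak_deriv ^^ Suc i) y))
     \<and> (weak_deriv ^^ m) y \<in> Lp 2}"

lemma W2_has_weak_deriv:
  "y \<in> W2 m \<Longrightarrow> i < m \<Longrightarrow> has_weak_deriv ((weak_deriv ^^ i) y) ((weak_deriv ^^ Suc i) y)"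
  by (simp add: W2_def)

lemma W2_top: "y \<in> W2 m \<Longrightarrow> (weak_deriv ^^ m) y \<in> Lp 2"
  by (simp add: W2_def)

text \<open>The entries of \<open>F\<close>, indexed from 0, with the entries required to vanish almost everywhere
  replaced by zero.\<close>

definition entry :: "nat \<Rightarrow> (nat \<Rightarrow> nat \<Rightarrow> real \<Rightarrow> complex) \<Rightarrow> nat \<Rightarrow> nat \<Rightarrow> real \<Rightarrow> complex" where
  "entry m F i j t = (if m \<le> Suc i \<and> j \<le> i \<and> j \<le> m then F (Suc i) (Suc j) t else 0)"

lemma entry_eq_0: "Suc i < m \<or> i < j \<or> m < j \<Longrightarrow> entry m F i j = (\<lambda>t. 0)"
  by (auto simp: entry_def fun_eq_iff)

lemma entry_Lp_2:
  assumes "F \<in> matrix_class m" "i < 2 * m" "Suc i = m \<or> j = m"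
  shows "entry m F i j \<in> Lp 2"
proof (cases "m \<le> Suc i \<and> j \<le> i \<and> j \<le> m")
  case True
  then have "entry m F i j = F (Suc i) (Suc j)" by (auto simp: entry_def fun_eq_iff)
  moreover have "F (Suc i) (Suc j) \<in> Lp 2"
  proof (cases "Suc i = m")
    case True
    then have "j < m" using \<open>m \<le> Suc i \<and> j \<le> i \<and> j \<le> m\<close> by auto
    then show ?thesis using assms True unfolding matrix_class_def by auto
  next
    case False
    then have "j = m" "Suc i \<in> {m+1..2*m}" using assms True by auto
    then show ?thesis using assms unfolding matrix_class_def by auto
  qed
  ultimately show ?thesis by simp
next
  case False
  then have "entry m F i j = (\<lambda>t. 0)" by (auto simp: entry_def fun_eq_iff)
  then show ?thesis by (simp add: Lp_2_continuous)
qed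

lemma entry_integrable:
  assumes "F \<in> matrix_class m" "i < 2 * m"
  shows "integrable unit_leb (entry m F i j)"
proof (cases "m \<le> Suc i \<and> j \<le> i \<and> j \<le> m")
  case True
  show ?thesis
  proof (cases "Suc i = m \<or> j = m")
    case True
    then show ?thesis using assms by (intro Lp_2_imp_integrable entry_Lp_2)
  next
    case False
    then have "Suc i \<in> {m+1..2*m}" "Suc j \<in> {1..m}" using assms True by auto
    then have "F (Suc i) (Suc j) \<in> Lp 1" using assms(1) unfolding matrix_class_def by blast
    moreover have "entry m F i j = F (Suc i) (Suc j)" using True by (auto simp: entry_def fun_eq_iff)
    ultimately show ?thesis using Lp_1_iff by simp
  qed
next
  case False
  then have "entry m F i j = (\<lambda>t. 0)" by (auto simp: entry_def fun_eq_iff)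
  then show ?thesis by simp
qed

lemma entry_AE:
  assumes "F \<in> matrix_class m" "i < 2 * m" "j \<le> i"
  shows "AE t in unit_leb. F (Suc i) (Suc j) t = entry m F i j t"
proof (cases "m \<le> Suc i \<and> j \<le> m")
  case True
  then show ?thesis using assms by (intro AE_I2) (simp add: entry_def)
next
  case False
  then have "AE t in unit_leb. F (Suc i) (Suc j) t = 0"
    using assms unfolding matrix_class_def by auto
  then show ?thesis using False by (auto simp: entry_def)
qed

text \<open>\<open>quasi_deriv\<close> uses the representatives picked by \<open>weak_deriv\<close>,
  so explicit constructions can match it only almost everywhere. A chain records just the defining
  equations, with \<open>v (2 * m)\<close> as the right-hand side. Summing over all \<open>j\<close>
  is harmless because \<open>entry\<close> vanishes above the diagonal.\<close>

definition quasi_chain ::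
  "nat \<Rightarrow> (nat \<Rightarrow> nat \<Rightarrow> real \<Rightarrow> complex) \<Rightarrow> (nat \<Rightarrow> real \<Rightarrow> complex) \<Rightarrow> bool" where
  "quasi_chain m F v \<longleftrightarrow>
     (\<forall>k<2*m. has_weak_deriv (v k) (\<lambda>x. v (Suc k) x + (\<Sum>j<2*m. entry m F k j x * v j x)))"

lemma sum_entry_AE:
  assumes F: "F \<in> matrix_class m" and k: "k < 2 * m"
    and v: "\<And>j. j \<le> k \<Longrightarrow> AE x in unit_leb. u j x = v j x"
  shows "AE x in unit_leb. (\<Sum>j=1..Suc k. F (Suc k) j x * u (j - 1) x)
      = (\<Sum>j<2*m. entry m F k j x * v j x)"
proof -
  have "AE x in unit_leb. (\<Sum>j\<in>{..k}. F (Suc k) (Suc j) x * u j x) = (\<Sum>j\<in>{..k}. entry m F k j x * v j x)"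
  proof (rule AE_sum_cong)
    fix j assume "j \<in> {..k}"
    then show "AE x in unit_leb. F (Suc k) (Suc j) x * u j x = entry m F k j x * v j x"
      using entry_AE[OF F k, of j] v[of j] by (auto elim: AE_mp)
  qed simp
  moreover have "(\<Sum>j<2*m. entry m F k j x * v j x) = (\<Sum>j\<in>{..k}. entry m F k j x * v j x)" for x
    using k entry_eq_0 by (intro sum.mono_neutral_right) auto
  moreover have "(\<Sum>j=1..Suc k. F (Suc k) j x * u (j - 1) x) = (\<Sum>j\<in>{..k}. F (Suc k) (Suc j) x * u j x)" for x
    by (subst sum.atLeast1_atMost_eq[unfolded One_nat_def[symmetric]])
       (simp add: lessThan_Suc_atMost)
  ultimately show ?thesis by simp
qed

lemma quasi_chain_quasi_deriv:
  assumes F: "F \<in> matrix_class m" and y: "y \<in> quasi_domain m F"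
  shows "quasi_chain m F (quasi_deriv F y)"
  unfolding quasi_chain_def
proof (intro allI impI)
  fix k assume k: "k < 2 * m"
  then have "quasi_deriv F y k \<in> sobolev 1 1" using y by (simp add: quasi_domain_def)
  then obtain g where "has_weak_deriv (quasi_deriv F y k) g" by auto
  then have "has_weak_deriv (quasi_deriv F y k) (weak_deriv (quasi_deriv F y k))"
    by (rule weak_deriv_eq)
  then show "has_weak_deriv (quasi_deriv F y k)
      (\<lambda>x. quasi_deriv F y (Suc k) x + (\<Sum>j<2*m. entry m F k j x * quasi_deriv F y j x))"
  proof (rule has_weak_deriv_AE)
    show "AE x in unit_leb. weak_deriv (quasi_deriv F y k) x
        = quasi_deriv F y (Suc k) x + (\<Sum>j<2*m. entry m F k j x * quasi_deriv F y j x)"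
      using sum_entry_AE[OF F k, of "quasi_deriv F y" "quasi_deriv F y", OF AE_I2[OF refl]]
      unfolding quasi_deriv.simps by eventually_elim simp
  qed simp
qed

text \<open>Weak derivatives are unique almost everywhere, so each equation of the chain determines
  the next member from the lower ones; hence the strong induction.\<close>

lemma quasi_chain_AE:
  assumes F: "F \<in> matrix_class m" and v: "quasi_chain m F v" and y: "AE x in unit_leb. y x = v 0 x"
  shows "k \<le> 2 * m \<Longrightarrow> AE x in unit_leb. quasi_deriv F y k x = v k x"
proof (induction k rule: less_induct)
  case (less k)
  show ?case
  proof (cases k)
    case (Suc l)
    then have l: "l < 2 * m" using less by simp
    have IH: "AE x in unit_leb. quasi_deriv F y j x = v j x" if "j \<le> l" for j
      using less that Suc by simp
    have "has_weak_deriv (v l) (\<lambda>x. v (Suc l) x + (\<Sum>j<2*m. entry m F l j x * v j x))"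
      using v l by (simp add: quasi_chain_def)
    then have "has_weak_deriv (quasi_deriv F y l) (\<lambda>x. v (Suc l) x + (\<Sum>j<2*m. entry m F l j x * v j x))"
      by (rule has_weak_deriv_AE) (use AE_symmetric[OF IH[of l]] in auto)
    then have "AE x in unit_leb. weak_deriv (quasi_deriv F y l) x
        = v (Suc l) x + (\<Sum>j<2*m. entry m F l j x * v j x)"
      by (rule weak_deriv_eq)
    moreover have "AE x in unit_leb. (\<Sum>j=1..Suc l. F (Suc l) j x * quasi_deriv F y (j - 1) x)
      = (\<Sum>j<2*m. entry m F l j x * v j x)"
      by (rule sum_entry_AE[OF F l IH])
    ultimately show ?thesis unfolding Suc quasi_deriv.simps by eventually_elim simp
  qed (use y in simp)
qed

lemma quasi_chain_imp_quasi_domain: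
  assumes F: "F \<in> matrix_class m" and v: "quasi_chain m F v" and y: "AE x in unit_leb. y x = v 0 x"
  shows "y \<in> quasi_domain m F"
  unfolding quasi_domain_def
proof (intro CollectI allI impI)
  fix k assume k: "k < 2 * m"
  have "has_weak_deriv (v k) (\<lambda>x. v (Suc k) x + (\<Sum>j<2*m. entry m F k j x * v j x))"
    using v k by (simp add: quasi_chain_def)
  then have "has_weak_deriv (quasi_deriv F y k) (\<lambda>x. v (Suc k) x + (\<Sum>j<2*m. entry m F k j x * v j x))"
    by (rule has_weak_deriv_AE) (use quasi_chain_AE[OF F v y, of k] k in \<open>auto intro: AE_symmetric\<close>)
  then show "quasi_deriv F y k \<in> sobolev 1 1"
    by (auto simp: has_weak_deriv_def intro!: bexI)
qed

text \<open>The quasi-derivatives of order \<open>k \<le> m\<close>; unlike the higher ones they exist for all \<open>y\<close> in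
  \<^term>\<open>W2 m\<close>.\<close>

definition low_quasi ::
  "nat \<Rightarrow> (nat \<Rightarrow> nat \<Rightarrow> real \<Rightarrow> complex) \<Rightarrow> (real \<Rightarrow> complex) \<Rightarrow> nat \<Rightarrow> real \<Rightarrow> complex" where
  "low_quasi m F y k x = (if k < m then (weak_deriv ^^ k) y x
     else (weak_deriv ^^ m) y x - (\<Sum>j<m. entry m F (m - 1) j x * (weak_deriv ^^ j) y x))"

lemma low_quasi_has_weak_deriv:
  "y \<in> W2 m \<Longrightarrow> k < m \<Longrightarrow> has_weak_deriv (low_quasi m F y k) ((weak_deriv ^^ Suc k) y)"
  using W2_has_weak_deriv[of y m k] by (simp add: low_quasi_def[abs_def])

lemma low_quasi_top_Lp_2:
  assumes "F \<in> matrix_class m" "y \<in> W2 m" "m \<ge> 1"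
  shows "low_quasi m F y m \<in> Lp 2"
proof -
  have "(\<lambda>x. \<Sum>j<m. entry m F (m - 1) j x * (weak_deriv ^^ j) y x) \<in> Lp 2"
    using assms by (intro Lp_2_sum Lp_2_mult_has_weak_deriv[OF entry_Lp_2 W2_has_weak_deriv]) auto
  from Lp_2_add[OF W2_top[OF assms(2)] Lp_2_cmult[OF this, of "-1"]]
  show ?thesis by (simp add: low_quasi_def[abs_def])
qed

text \<open>Below order \<open>m\<close> the entries vanish and quasi-derivatives are ordinary
  derivatives. In the step to \<open>m\<close>, y^(m) is y^[m] plus L_2 entries times continuous
  functions; y^[m] has a continuous representative because \<open>m < 2 * m\<close>, so y^(m) is in
  L_2.\<close>

lemma quasi_domain_W2:
  assumes F: "F \<in> matrix_class m" and y: "y \<in> quasi_domain m F" and m: "m \<ge> 1"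
  shows "y \<in> W2 m" and "k \<le> m \<Longrightarrow> AE x in unit_leb. quasi_deriv F y k x = low_quasi m F y k x"
proof -
  let ?q = "quasi_deriv F y" and ?D = "\<lambda>i. (weak_deriv ^^ i) y"
  have chain: "has_weak_deriv (?q k) (\<lambda>x. ?q (Suc k) x + (\<Sum>j<2*m. entry m F k j x * ?q j x))"
    if "k < 2 * m" for k
    using quasi_chain_quasi_deriv[OF F y] that by (simp add: quasi_chain_def)
  have low: "AE x in unit_leb. ?q k x = ?D k x" if "k < m" for k
    using that
  proof (induction k)
    case (Suc k)
    have "has_weak_deriv (?q k) (?q (Suc k))"
      using chain[of k] Suc.prems by (simp add: entry_eq_0 del: quasi_deriv.simps)
    moreover have "AE x in unit_leb. ?q k x = ?D k x"
      using Suc by simp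
    ultimately have "has_weak_deriv (?D k) (?q (Suc k))"
      using AE_I2[OF refl] by (rule has_weak_deriv_AE)
    from AE_symmetric[OF weak_deriv_eq(2)[OF this]] show ?case by simp
  qed simp
  have der: "has_weak_deriv (?D k) (?D (Suc k)) \<and>
      (AE x in unit_leb. ?D (Suc k) x = ?q (Suc k) x + (\<Sum>j<2*m. entry m F k j x * ?q j x))" if "k < m" for k
  proof -
    have "has_weak_deriv (?D k) (\<lambda>x. ?q (Suc k) x + (\<Sum>j<2*m. entry m F k j x * ?q j x))"
    proof (rule has_weak_deriv_AE)
      show "has_weak_deriv (?q k) (\<lambda>x. ?q (Suc k) x + (\<Sum>j<2*m. entry m F k j x * ?q j x))"
        using that by (intro chain) simp
    qed (rule low[OF that], rule AE_I2, rule refl)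
    from weak_deriv_eq[OF this] show ?thesis by simp
  qed
  have top: "AE x in unit_leb. ?D m x = ?q m x + (\<Sum>j<2*m. entry m F (m - 1) j x * ?q j x)"
    using der[of "m - 1"] m by simp
  have "(\<lambda>x. ?q m x + (\<Sum>j<2*m. entry m F (m - 1) j x * ?q j x)) \<in> Lp 2"
  proof (intro Lp_2_add Lp_2_sum)
    show "?q m \<in> Lp 2" using chain[of m] m by (intro Lp_2_has_weak_deriv) auto
    show "(\<lambda>x. entry m F (m - 1) j x * ?q j x) \<in> Lp 2" if "j \<in> {..<2*m}" for j
      using chain[of j] m that entry_Lp_2[OF F] by (intro Lp_2_mult_has_weak_deriv) auto
  qed
  then have "?D m \<in> Lp 2" using AE_symmetric[OF top] by (rule Lp_2_AE)
  then show "y \<in> W2 m" using der by (simp add: W2_def del: funpow.simps)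
  assume k: "k \<le> m"
  show "AE x in unit_leb. ?q k x = low_quasi m F y k x"
  proof (cases "k < m")
    case True
    then show ?thesis using low[OF True] by (simp add: low_quasi_def)
  next
    case False
    then have "k = m" using k by simp
    have "AE x in unit_leb. \<forall>j\<in>{..<m}. ?q j x = ?D j x"
      using low by (intro AE_finite_allI) auto
    then have "AE x in unit_leb. ?q m x = low_quasi m F y m x"
      using top
    proof eventually_elim
      case (elim x)
      have "(\<Sum>j<2*m. entry m F (m - 1) j x * ?q j x) = (\<Sum>j<m. entry m F (m - 1) j x * ?q j x)"
        using m by (intro sum.mono_neutral_right) (auto simp: entry_def)
      also have "\<dots> = (\<Sum>j<m. entry m F (m - 1) j x * ?D j x)" using elim by simp
      finally show ?case using elim by (simp add: low_quasi_def)
    qed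
    then show ?thesis using \<open>k = m\<close> by simp
  qed
qed

section \<open>Distributional quasi-derivatives beyond order m and their regularity\<close>

text \<open>The distributional quasi-derivatives starting from \<open>u = y\<^sup>[\<^sup>m\<^sup>]\<close> with lower order terms \<open>r\<close>.\<close>

fun dist_quasi :: "(real \<Rightarrow> complex) \<Rightarrow> (nat \<Rightarrow> real \<Rightarrow> complex) \<Rightarrow> nat \<Rightarrow> distr" where
  "dist_quasi u r 0 = reg_dist u"
| "dist_quasi u r (Suc s) = (\<lambda>z. dist_deriv (dist_quasi u r s) z - reg_dist (r s) z)"

lemma dist_quasi_regular:
  assumes "\<And>l. l < s \<Longrightarrow> has_weak_deriv (v l) (\<lambda>x. v (Suc l) x + r l x)"
    and "\<And>l. l < s \<Longrightarrow> integrable unit_leb (r l)" and "z \<in> test_fun"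
  shows "dist_quasi (v 0) r s z = reg_dist (v s) z"
  using assms
proof (induction s arbitrary: z)
  case (Suc s)
  have h: "has_weak_deriv (v s) (\<lambda>x. v (Suc s) x + r s x)" and r: "integrable unit_leb (r s)"
    using Suc.prems by auto
  have "integrable unit_leb (\<lambda>x. (v (Suc s) x + r s x) - r s x)"
    using has_weak_deriv_integrable[OF h] r by (intro Bochner_Integration.integrable_diff)
  then have v: "integrable unit_leb (v (Suc s))" by simp
  have "dist_quasi (v 0) r (Suc s) z = - (LINT x|unit_leb. v s x * ddx z x) - (LINT x|unit_leb. r s x * z x)"
    using Suc.IH[of "ddx z"] Suc.prems by (simp add: dist_deriv_def reg_dist_def test_fun_ddx)
  also have "\<dots> = (LINT x|unit_leb. (v (Suc s) x + r s x) * z x) - (LINT x|unit_leb. r s x * z x)"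
    using has_weak_deriv_integral[OF h Suc.prems(3)] by simp
  also have "\<dots> = (LINT x|unit_leb. v (Suc s) x * z x)"
    using integrable_mult_test_fun[OF v Suc.prems(3)] integrable_mult_test_fun[OF r Suc.prems(3)]
    by (simp add: distrib_right)
  finally show ?case by (simp add: reg_dist_def)
qed simp

lemma reg_dist_linear:
  assumes "integrable unit_leb f" "y \<in> test_fun" "z \<in> test_fun"
  shows "reg_dist f (\<lambda>x. y x + z x) = reg_dist f y + reg_dist f z"
    "reg_dist f (\<lambda>x. c * z x) = c * reg_dist f z"
  using integrable_mult_test_fun[OF assms(1,2)] integrable_mult_test_fun[OF assms(1,3)]
  by (simp_all add: reg_dist_def distrib_left mult.left_commute)

lemma ddx_linear:
  assumes "y \<in> test_fun" "z \<in> test_fun"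
  shows "ddx (\<lambda>x. y x + z x) = (\<lambda>x. ddx y x + ddx z x)" "ddx (\<lambda>x. c * z x) = (\<lambda>x. c * ddx z x)"
  by (intro ddx_eqI has_vector_derivative_add has_vector_derivative_mult_right test_fun_derivative assms)+

lemma dist_quasi_linear:
  assumes "integrable unit_leb u" "\<And>l. l < s \<Longrightarrow> integrable unit_leb (r l)" "y \<in> test_fun" "z \<in> test_fun"
  shows "dist_quasi u r s (\<lambda>x. y x + z x) = dist_quasi u r s y + dist_quasi u r s z
    \<and> dist_quasi u r s (\<lambda>x. c * z x) = c * dist_quasi u r s z"
  using assms(2-)
proof (induction s arbitrary: y z)
  case 0
  then show ?case using reg_dist_linear[OF assms(1)] by simp
next
  case (Suc s)
  then show ?case
    using reg_dist_linear(1)[of "r s" y z] reg_dist_linear(2)[of "r s" y z c]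
    by (simp add: dist_deriv_def ddx_linear test_fun_ddx algebra_simps)
qed

text \<open>If the distributional quasi-derivative number s + 1 is \<open>f\<close>, the derivative
  of number s is the integrable function \<open>f + r s\<close>. So number s is a constant plus a
  primitive, in particular regular, and the induction hypothesis applies to it.\<close>

lemma dist_quasi_regularity:
  assumes "integrable unit_leb u" "\<And>l. l < s \<Longrightarrow> integrable unit_leb (r l)"
    "integrable unit_leb f" "dist_quasi u r s =\<^sub>D reg_dist f"
  shows "\<exists>v. v 0 = u \<and> (AE x in unit_leb. v s x = f x)
    \<and> (\<forall>l<s. has_weak_deriv (v l) (\<lambda>x. v (Suc l) x + r l x))"
  using assms(2-)
proof (induction s arbitrary: f)
  case 0
  have "AE x in unit_leb. u x - f x = 0"
  proof (rule fundamental_lemma)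
    show "(LINT x|unit_leb. (u x - f x) * z x) = 0" if "z \<in> test_fun" for z
      using 0 that integrable_mult_test_fun[OF assms(1) that] integrable_mult_test_fun[OF 0(2) that]
      by (simp add: dist_eq_def reg_dist_def left_diff_distrib)
  qed (use 0 assms(1) in simp)
  then show ?case by (intro exI[of _ "\<lambda>_. u"]) simp
next
  case (Suc s)
  have r: "integrable unit_leb (r s)" using Suc.prems by simp
  define g where "g x = f x + r s x" for x
  have g: "integrable unit_leb g" unfolding g_def using Suc.prems r by simp
  have p: "integrable unit_leb (prim g)" by (intro integrable_continuous prim_continuous g)
  define S where "S z = dist_quasi u r s z - reg_dist (prim g) z" for z
  have lin: "dist_quasi u r s (\<lambda>x. y x + z x) = dist_quasi u r s y + dist_quasi u r s z
    \<and> dist_quasi u r s (\<lambda>x. c * z x) = c * dist_quasi u r s z" if "y \<in> test_fun" "z \<in> test_fun" for c y z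
    using assms(1) Suc.prems that by (intro dist_quasi_linear) auto
  have "\<exists>c. \<forall>z\<in>test_fun. S z = c * (LINT x|unit_leb. z x)"
  proof (rule constant_if_annihilates_derivatives)
    show "S (ddx z) = 0" if z: "z \<in> test_fun" for z
    proof -
      have "- dist_quasi u r s (ddx z) - reg_dist (r s) z = reg_dist f z"
        using Suc.prems(3) z by (simp add: dist_eq_def dist_deriv_def)
      moreover have "reg_dist (prim g) (ddx z) = - reg_dist g z"
        using has_weak_deriv_prim[OF g, of "prim g" 0] z by (simp add: has_weak_deriv_iff reg_dist_def)
      moreover have "reg_dist g z = reg_dist f z + reg_dist (r s) z"
        using integrable_mult_test_fun[OF Suc.prems(2) z] integrable_mult_test_fun[OF r z]
        by (simp add: reg_dist_def g_def distrib_right)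
      ultimately have "S (ddx z) = dist_quasi u r s (ddx z)
          + ((- dist_quasi u r s (ddx z) - reg_dist (r s) z) + reg_dist (r s) z)"
        by (simp only: S_def diff_minus_eq_add)
      then show ?thesis by simp
    qed
    show "S (\<lambda>x. y x + z x) = S y + S z" if "y \<in> test_fun" "z \<in> test_fun" for y z
      using conjunct1[OF lin[OF that]] reg_dist_linear(1)[OF p that] by (simp add: S_def)
    show "S (\<lambda>x. c * z x) = c * S z" if "z \<in> test_fun" for c z
      using conjunct2[OF lin[OF that that, of c]] reg_dist_linear(2)[OF p that that, of c]
      by (simp add: S_def right_diff_distrib)
  qed
  then obtain c where c: "\<And>z. z \<in> test_fun \<Longrightarrow> S z = c * (LINT x|unit_leb. z x)" by blast
  have pc: "integrable unit_leb (\<lambda>x. c + prim g x)"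
    using p finite_measure.integrable_const[OF finite_unit_leb] by (intro Bochner_Integration.integrable_add)
  have "dist_quasi u r s =\<^sub>D reg_dist (\<lambda>x. c + prim g x)"
    unfolding dist_eq_def
  proof
    fix z assume z: "z \<in> test_fun"
    have "reg_dist (\<lambda>x. c + prim g x) z = c * (LINT x|unit_leb. z x) + reg_dist (prim g) z"
      using integrable_test_fun[OF z] integrable_mult_test_fun[OF p z] by (simp add: reg_dist_def distrib_right)
    then show "dist_quasi u r s z = reg_dist (\<lambda>x. c + prim g x) z"
      using c[OF z] by (simp add: S_def algebra_simps)
  qed
  then obtain v where v: "v 0 = u" "AE x in unit_leb. v s x = c + prim g x"
    "\<And>l. l < s \<Longrightarrow> has_weak_deriv (v l) (\<lambda>x. v (Suc l) x + r l x)"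
    using Suc.IH[OF _ pc] Suc.prems by (metis less_SucI)
  have "has_weak_deriv (v s) g"
    by (rule has_weak_deriv_AE[OF has_weak_deriv_prim[OF g]]) (use AE_symmetric[OF v(2)] in auto)
  \<comment> \<open>The induction hypothesis says nothing about \<open>v (Suc s)\<close>, so this
    value may be set to \<open>f\<close>.\<close>
  then show ?case
    using v by (intro exI[of _ "v(Suc s := f)"]) (auto simp: less_Suc_eq g_def[abs_def])
qed

subsection \<open>Forms vanishing on the domain\<close>

definition form_on_W2 :: "nat \<Rightarrow> (nat \<Rightarrow> nat \<Rightarrow> real \<Rightarrow> complex) \<Rightarrow> (nat \<Rightarrow> real \<Rightarrow> complex)
    \<Rightarrow> (real \<Rightarrow> complex) \<Rightarrow> complex" where
  "form_on_W2 m F b y = (\<Sum>i\<le>m. LINT x|unit_leb. b i x * low_quasi m F y i x)"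

text \<open>The integrability that makes every term finite on W_2^m: quasi-derivatives of order
  below \<open>m\<close> have continuous representatives, the one of order \<open>m\<close> is only
  in L_2.\<close>

definition form_coeffs :: "nat \<Rightarrow> (nat \<Rightarrow> real \<Rightarrow> complex) set" where
  "form_coeffs m = {b. (\<forall>i<m. integrable unit_leb (b i)) \<and> b m \<in> Lp 2}"

lemma form_coeff_integrable:
  assumes "b \<in> form_coeffs m" "i \<le> m" shows "integrable unit_leb (b i)"
  using assms Lp_2_imp_integrable by (cases "i = m") (auto simp: form_coeffs_def)

lemma form_term_integrable:
  assumes "F \<in> matrix_class m" "m \<ge> 1" "b \<in> form_coeffs m" "y \<in> W2 m" "i \<le> m"
  shows "integrable unit_leb (\<lambda>x. b i x * low_quasi m F y i x)"
proof (cases "i = m")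
  case True
  then show ?thesis
    using assms low_quasi_top_Lp_2[OF assms(1,4,2)] by (auto simp: form_coeffs_def intro!: integrable_mult_Lp_2)
next
  case False
  then show ?thesis
    using assms form_coeff_integrable[OF assms(3,5)] low_quasi_has_weak_deriv[OF assms(4), of i F]
    by (intro integrable_mult_has_weak_deriv) auto
qed

text \<open>Lagrange's identity at a point: if w' = -A^T w - b and Y' = A Y + h, then the derivative
  of the sum of the w_i Y_i is w.h - b.Y, as the terms containing A cancel.\<close>

lemma sum_swap_bilinear:
  fixes a :: "nat \<Rightarrow> nat \<Rightarrow> complex"
  shows "(\<Sum>i<n. (- (\<Sum>k<n. a k i * w k) - b i) * Y i + w i * ((\<Sum>j<n. a i j * Y j) + h i))
    = (\<Sum>i<n. w i * h i) - (\<Sum>i<n. b i * Y i)"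
proof -
  have "(\<Sum>i<n. \<Sum>k<n. a k i * w k * Y i) = (\<Sum>i<n. \<Sum>k<n. w i * (a i k * Y k))"
    by (subst sum.swap) (simp add: mult_ac)
  then show ?thesis
    by (simp add: algebra_simps sum.distrib sum_subtractf sum_distrib_left sum_negf)
qed

text \<open>Solve the adjoint system for \<open>w\<close> with \<open>w(0) = 0\<close>, and then the system of
  quasi-derivatives for \<open>Y\<close> with right-hand side \<open>cnj w\<^bsub>2m-1\<^esub>\<close> and \<open>Y(1) = - cnj w(1)\<close>.
  Since the form vanishes at \<open>Y 0\<close>, integration by parts gives
  \<open>\<integral> |w\<^bsub>2m-1\<^esub>|\<^sup>2 + \<Sum> |w\<^sub>i(1)|\<^sup>2 = 0\<close>.\<close>

lemma adjoint_system:
  assumes F: "F \<in> matrix_class m" and m: "m \<ge> 1" and b: "b \<in> form_coeffs m"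
    and zero: "\<And>y. y \<in> quasi_domain m F \<Longrightarrow> form_on_W2 m F b y = 0"
  obtains w f where "\<And>i x. i < 2 * m \<Longrightarrow> w i x = prim (f i) x"
    and "\<And>i. i < 2 * m \<Longrightarrow> integrable unit_leb (f i)"
    and "\<And>i x. i < 2 * m \<Longrightarrow> f i x = - (\<Sum>k<2*m. entry m F k i x * w k x)
        - (if i = 0 then 0 else w (i - 1) x) - (if i \<le> m then b i x else 0)"
    and "\<And>i. i < 2 * m \<Longrightarrow> w i 1 = 0"
    and "AE x in unit_leb. w (2 * m - 1) x = 0"
proof -
  define n where "n = 2 * m"
  have n: "n \<ge> 2" using m by (simp add: n_def)
  \<comment> \<open>The superdiagonal 1 stands for the term y^[i+1] in the derivative of
    y^[i].\<close>
  define A where "A i j t = entry m F i j t + (if j = Suc i then 1 else 0)" for i j t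
  have A: "integrable unit_leb (A i j)" if "i < n" for i j
    using entry_integrable[OF F, of i j] that finite_measure.integrable_const[OF finite_unit_leb]
    unfolding A_def n_def by (intro Bochner_Integration.integrable_add) auto
  define b' where "b' i x = (if i \<le> m then b i x else 0)" for i x
  have b': "integrable unit_leb (b' i)" for i
    using form_coeff_integrable[OF b, of i] unfolding b'_def by (cases "i \<le> m") auto
  obtain w0 where w0: "\<And>i. i < n \<Longrightarrow> continuous_on {0..1} (w0 i)"
    "\<And>i x. i < n \<Longrightarrow> x \<in> {0..1} \<Longrightarrow> w0 i x = 0 +
      (prim (\<lambda>t. (\<Sum>k<n. - A k i t * w0 k t) + - b' i t) x - prim (\<lambda>t. (\<Sum>k<n. - A k i t * w0 k t) + - b' i t) 0)"
    by (rule linear_system_solvable[of n "\<lambda>i k t. - A k i t" "\<lambda>i t. - b' i t" 0 "\<lambda>_. 0"])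
       (use A b' in auto)
  define f0 where "f0 i t = (\<Sum>k<n. - A k i t * w0 k t) + - b' i t" for i t
  have f0: "integrable unit_leb (f0 i)" for i
    unfolding f0_def
    using A b' w0(1)
    by (intro Bochner_Integration.integrable_add Bochner_Integration.integrable_sum
        integrable_mult_continuous) auto
  \<comment> \<open>\<open>w0\<close> solves the system on [0,1] only; \<open>w\<close> and
    \<open>f\<close> are rebuilt so that \<open>w i\<close> is the primitive of \<open>f i\<close>
    at every point.\<close>
  define w where "w i = prim (f0 i)" for i
  have w_eq: "w0 i x = w i x" if "i < n" "x \<in> {0..1}" for i x
    using w0(2)[OF that] by (simp add: w_def f0_def[abs_def] prim_0)
  define f where "f i t = - (\<Sum>k<n. A k i t * w k t) - b' i t" for i t
  have f0_eq: "f i t = f0 i t" if "t \<in> {0..1}" for i t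
    using w_eq[OF _ that] by (simp add: f_def f0_def sum_negf)
  have f: "integrable unit_leb (f i)" for i
    using f0 Bochner_Integration.integrable_cong[of unit_leb unit_leb "f i" "f0 i"] f0_eq by simp
  have w: "w i x = prim (f i) x" for i x
    unfolding w_def by (rule prim_cong_AE) (use f f0 f0_eq in \<open>auto intro!: AE_I2\<close>)
  have wcont: "continuous_on {0..1} (w i)" for i
    unfolding w_def by (intro prim_continuous f0)
  \<comment> \<open>Conjugates turn the pairing with \<open>w\<close> into squared moduli, and the
    minus sign brings boundary terms and integral to the same side. In \<open>h\<close> only the
    last equation is inhomogeneous, since of the right-hand sides only y^[2m] is free.\<close>
  define c where "c i = - cnj (w i 1)" for i
  define h where "h i t = (if i = n - 1 then cnj (w (n - 1) t) else 0)" for i t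
  have hcont: "continuous_on {0..1} (h i)" for i
    unfolding h_def using wcont[of "n - 1"] by (cases "i = n - 1") (auto intro!: continuous_intros)
  have h: "integrable unit_leb (h i)" for i by (intro integrable_continuous hcont)
  obtain Y where Y: "\<And>i. i < n \<Longrightarrow> continuous_on {0..1} (Y i)"
    "\<And>i x. i < n \<Longrightarrow> x \<in> {0..1} \<Longrightarrow> Y i x = c i +
      (prim (\<lambda>t. (\<Sum>j<n. A i j t * Y j t) + h i t) x - prim (\<lambda>t. (\<Sum>j<n. A i j t * Y j t) + h i t) 1)"
    by (rule linear_system_solvable[of n A h 1 c]) (use A h in auto)
  define g where "g i t = (\<Sum>j<n. A i j t * Y j t) + h i t" for i t
  have g: "integrable unit_leb (g i)" if "i < n" for i
    unfolding g_def
    using A h Y(1) that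
    by (intro Bochner_Integration.integrable_add Bochner_Integration.integrable_sum
        integrable_mult_continuous) auto
  have Yg: "Y i x = (c i - prim (g i) 1) + prim (g i) x" if "i < n" "x \<in> {0..1}" for i x
    using Y(2)[OF that] by (simp add: g_def[abs_def])
  have Y1: "Y i 1 = c i" if "i < n" for i using Yg[OF that, of 1] by simp
  define v where "v k = (if k < n then Y k else h (n - 1))" for k
  have A_sum: "(\<Sum>j<n. A k j t * Y j t) = (if Suc k < n then Y (Suc k) t else 0)
      + (\<Sum>j<n. entry m F k j t * Y j t)" for k t
  proof -
    have "(\<Sum>j<n. (if j = Suc k then 1 else 0) * Y j t) = (if Suc k < n then Y (Suc k) t else 0)"
      using sum.delta'[of "{..<n}" "Suc k" "\<lambda>j. Y j t"] by (simp add: if_distrib[of "\<lambda>u. u * _"] cong: if_cong)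
    then show ?thesis by (simp add: A_def distrib_right sum.distrib add.commute)
  qed
  have "quasi_chain m F v"
    unfolding quasi_chain_def n_def[symmetric]
  proof (intro allI impI)
    fix k assume k: "k < n"
    have "has_weak_deriv (Y k) (g k)"
      by (rule has_weak_deriv_prim[OF g[OF k] Yg[OF k]])
    moreover have "g k = (\<lambda>x. v (Suc k) x + (\<Sum>j<n. entry m F k j x * v j x))"
    proof
      fix x
      have "v (Suc k) x = (if Suc k < n then Y (Suc k) x else 0) + h k x"
        using k by (auto simp: v_def h_def)
      moreover have "(\<Sum>j<n. entry m F k j x * v j x) = (\<Sum>j<n. entry m F k j x * Y j x)"
        by (simp add: v_def)
      ultimately show "g k x = v (Suc k) x + (\<Sum>j<n. entry m F k j x * v j x)"
        by (simp add: g_def A_sum)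
    qed
    ultimately show "has_weak_deriv (v k) (\<lambda>x. v (Suc k) x + (\<Sum>j<n. entry m F k j x * v j x))"
      using k by (simp add: v_def)
  qed
  then have dom: "Y 0 \<in> quasi_domain m F" and qY: "AE x in unit_leb. quasi_deriv F (Y 0) k x = v k x"
    if "k \<le> n" for k
    using quasi_chain_imp_quasi_domain[OF F, of v "Y 0"] quasi_chain_AE[OF F, of v "Y 0" k] n that
    by (auto simp: v_def n_def)
  have lq: "AE x in unit_leb. low_quasi m F (Y 0) k x = Y k x" if "k \<le> m" for k
  proof -
    have "k < n" using that n by (simp add: n_def)
    then show ?thesis
      using quasi_domain_W2(2)[OF F dom[of 0] m that] qY[of k] by (auto simp: v_def elim: AE_mp)
  qed
  have bY: "integrable unit_leb (\<lambda>x. b' i x * Y i x)" if "i < n" for i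
    using b' Y(1)[OF that] by (intro integrable_mult_continuous)
  have "(\<Sum>i<n. LINT x|unit_leb. b' i x * Y i x) = (\<Sum>i\<le>m. LINT x|unit_leb. b' i x * Y i x)"
    using m by (intro sum.mono_neutral_right) (auto simp: n_def b'_def)
  also have "\<dots> = form_on_W2 m F b (Y 0)"
    unfolding form_on_W2_def
  proof (intro sum.cong refl)
    fix i assume i: "i \<in> {..m}"
    then have "i < n" using m by (simp add: n_def)
    have W: "Y 0 \<in> W2 m" by (rule quasi_domain_W2[OF F dom[of 0] m]) simp
    show "(LINT x|unit_leb. b' i x * Y i x) = (LINT x|unit_leb. b i x * low_quasi m F (Y 0) i x)"
      by (rule integral_cong_AE)
         (use lq[of i] i bY[OF \<open>i < n\<close>] form_term_integrable[OF F m b W, of i] in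
            \<open>auto simp: b'_def elim: AE_mp intro!: borel_measurable_integrable\<close>)
  qed
  finally have form0: "(\<Sum>i<n. LINT x|unit_leb. b' i x * Y i x) = 0"
    using zero[OF dom[of 0]] by simp
  define N where "N = (LINT x|unit_leb. (cmod (w (n - 1) x))\<^sup>2)"
  have "(\<Sum>i<n. w i 1 * Y i 1) = (\<Sum>i<n. LINT x|unit_leb. f i x * Y i x + w i x * g i x)"
  proof (intro sum.cong refl)
    fix i assume "i \<in> {..<n}"
    then have "(LINT x|unit_leb. f i x * Y i x + w i x * g i x) = w i 1 * Y i 1 - w i 0 * Y i 0"
      using f g Yg w by (intro integral_by_parts[where a=0]) auto
    then show "w i 1 * Y i 1 = (LINT x|unit_leb. f i x * Y i x + w i x * g i x)"
      by (simp add: w prim_0)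
  qed
  also have "\<dots> = (LINT x|unit_leb. (\<Sum>i<n. f i x * Y i x + w i x * g i x))"
  proof (rule Bochner_Integration.integral_sum[symmetric])
    fix i assume "i \<in> {..<n}"
    then show "integrable unit_leb (\<lambda>x. f i x * Y i x + w i x * g i x)"
      using integrable_mult_continuous[OF f Y(1)] integrable_mult_continuous[OF g wcont]
      by (intro Bochner_Integration.integrable_add) (auto simp: mult.commute)
  qed
  also have "\<dots> = (LINT x|unit_leb. complex_of_real ((cmod (w (n - 1) x))\<^sup>2) - (\<Sum>i<n. b' i x * Y i x))"
  proof (intro Bochner_Integration.integral_cong refl)
    fix x
    have "(\<Sum>i<n. w i x * h i x) = w (n - 1) x * cnj (w (n - 1) x)"
      using sum.delta'[of "{..<n}" "n - 1" "\<lambda>i. w i x * cnj (w (n - 1) x)"] n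
      by (simp add: h_def if_distrib[of "\<lambda>u. _ * u"] cong: if_cong)
    then show "(\<Sum>i<n. f i x * Y i x + w i x * g i x)
        = complex_of_real ((cmod (w (n - 1) x))\<^sup>2) - (\<Sum>i<n. b' i x * Y i x)"
      unfolding f_def g_def sum_swap_bilinear by (simp only: complex_norm_square)
  qed
  also have "\<dots> = complex_of_real N - (\<Sum>i<n. LINT x|unit_leb. b' i x * Y i x)"
  proof -
    have "integrable unit_leb (\<lambda>x. complex_of_real ((cmod (w (n - 1) x))\<^sup>2))"
      by (intro integrable_continuous continuous_intros wcont)
    then show ?thesis
      using bY unfolding N_def by (subst Bochner_Integration.integral_diff) (auto simp: Bochner_Integration.integral_sum simp del: of_real_power)
  qed
  also have "\<dots> = complex_of_real N" using form0 by simp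
  finally have "complex_of_real N = (\<Sum>i<n. w i 1 * Y i 1)" by simp
  also have "\<dots> = complex_of_real (- (\<Sum>i<n. (cmod (w i 1))\<^sup>2))"
    by (simp add: Y1 c_def sum_negf complex_norm_square del: of_real_power)
  finally have N: "N + (\<Sum>i<n. (cmod (w i 1))\<^sup>2) = 0"
    by (simp only: of_real_eq_iff)
  have "N \<ge> 0" unfolding N_def by (intro integral_nonneg_AE) auto
  moreover have "(\<Sum>i<n. (cmod (w i 1))\<^sup>2) \<ge> 0" by (intro sum_nonneg) auto
  ultimately have "N = 0" "(\<Sum>i<n. (cmod (w i 1))\<^sup>2) = 0" using N by linarith+
  then have w1: "w i 1 = 0" if "i < n" for i
    using that by (subst (asm) sum_nonneg_eq_0_iff) auto
  have "integrable unit_leb (\<lambda>x. (cmod (w (n - 1) x))\<^sup>2)"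
    using Lp_2_continuous[OF wcont] by (simp add: Lp_def)
  then have "AE x in unit_leb. (cmod (w (n - 1) x))\<^sup>2 = 0"
    using \<open>N = 0\<close> unfolding N_def by (subst (asm) integral_nonneg_eq_0_iff_AE) auto
  then have wtop: "AE x in unit_leb. w (n - 1) x = 0" by simp
  have f_eq: "f i x = - (\<Sum>k<n. entry m F k i x * w k x)
        - (if i = 0 then 0 else w (i - 1) x) - (if i \<le> m then b i x else 0)" if "i < n" for i x
  proof -
    have "(\<Sum>k<n. (if i = Suc k then 1 else 0) * w k x) = (if i = 0 then 0 else w (i - 1) x)"
    proof (cases i)
      case (Suc l)
      then show ?thesis
        using that sum.delta[of "{..<n}" l "\<lambda>k. w k x"]
        by (simp add: if_distrib[of "\<lambda>u. u * _"] cong: if_cong)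
    qed simp
    then show ?thesis by (simp add: f_def A_def b'_def distrib_right sum.distrib)
  qed
  show ?thesis
    by (rule that[of w f]) (use w f w1 wtop f_eq in \<open>simp_all add: n_def\<close>)
qed

text \<open>The adjoint solution vanishes from index 2m - 1 down to m, which leaves w_(m-1) = -b_m.
  By the remaining adjoint equations the sum over i < m of the derivatives of w_i y^(i) is then
  minus the integrand of the form, for every \<open>y\<close> in \<open>W2 m\<close>. Its integral
  is 0 because all w_i vanish at both endpoints.\<close>

lemma form_vanishes_on_W2:
  assumes F: "F \<in> matrix_class m" and m: "m \<ge> 1" and b: "b \<in> form_coeffs m"
    and zero: "\<And>y. y \<in> quasi_domain m F \<Longrightarrow> form_on_W2 m F b y = 0"
    and y: "y \<in> W2 m"
  shows "form_on_W2 m F b y = 0"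
proof -
  obtain w f where w: "\<And>i x. i < 2 * m \<Longrightarrow> w i x = prim (f i) x"
    and f: "\<And>i. i < 2 * m \<Longrightarrow> integrable unit_leb (f i)"
    and f_eq: "\<And>i x. i < 2 * m \<Longrightarrow> f i x = - (\<Sum>k<2*m. entry m F k i x * w k x)
        - (if i = 0 then 0 else w (i - 1) x) - (if i \<le> m then b i x else 0)"
    and w1: "\<And>i. i < 2 * m \<Longrightarrow> w i 1 = 0"
    and wtop: "AE x in unit_leb. w (2 * m - 1) x = 0"
    by (rule adjoint_system[OF F m b zero]) (assumption, (rule that; assumption))
  have wd: "has_weak_deriv (w i) (f i)" if "i < 2 * m" for i
    using f[OF that] w[OF that] by (intro has_weak_deriv_prim[where a=0]) auto
  have wcont: "continuous_on {0..1} (w i)" if "i < 2 * m" for i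
  proof -
    have "w i = prim (f i)" using w[OF that] by (rule ext)
    then show ?thesis using prim_continuous[OF f[OF that]] by simp
  qed
  have f_zero: "AE x in unit_leb. f i x = 0" if "i < 2 * m" "AE x in unit_leb. w i x = 0" for i
  proof (rule has_weak_deriv_unique[OF wd[OF that(1)] _ that(2)])
    show "has_weak_deriv (\<lambda>x. 0) (\<lambda>x. 0)" by (simp add: has_weak_deriv_iff)
  qed
  \<comment> \<open>For k > m the entries in column k vanish and the form has no coefficient, so the
    adjoint equation reads f_k = -w_(k-1). If w_k is 0, so is its derivative f_k, and hence
    w_(k-1).\<close>
  have high: "AE x in unit_leb. w (2 * m - 1 - d) x = 0" if "d < m" for d
    using that
  proof (induction d)
    case 0
    then show ?case using wtop by simp
  next
    case (Suc d)
    define k where "k = 2 * m - 1 - d"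
    have k: "m < k" "k < 2 * m" "k - 1 = 2 * m - 1 - Suc d" using Suc.prems by (auto simp: k_def)
    have "AE x in unit_leb. f k x = 0"
      using Suc k by (intro f_zero) (auto simp: k_def)
    then have "AE x in unit_leb. w (k - 1) x = 0"
      by (rule AE_mp) (use k f_eq[of k] in \<open>auto simp: entry_eq_0\<close>)
    then show ?case using k by simp
  qed
  have w_high: "AE x in unit_leb. \<forall>k\<in>{m..<2*m}. w k x = 0"
  proof (rule AE_finite_allI)
    fix k assume "k \<in> {m..<2*m}"
    then show "AE x in unit_leb. w k x = 0" using high[of "2 * m - 1 - k"] by auto
  qed simp
  have "AE x in unit_leb. f m x = 0"
    using w_high m by (intro f_zero) (auto elim: AE_mp)
  then have w_pred: "AE x in unit_leb. w (m - 1) x = - b m x"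
    using w_high
  proof eventually_elim
    case (elim x)
    have "(\<Sum>k<2*m. entry m F k m x * w k x) = 0"
      using elim by (intro sum.neutral) (auto simp: entry_def)
    then show ?case using elim f_eq[of m x] m by (simp add: minus_equation_iff[of _ "b m x"])
  qed
  define D where "D i = (weak_deriv ^^ i) y" for i
  have Dint: "integrable unit_leb (D (Suc i))" if "i < m" for i
    using W2_has_weak_deriv[OF y that] by (auto simp: D_def dest: has_weak_deriv_integrable)
  have fD: "integrable unit_leb (\<lambda>x. f i x * D i x)" if "i < m" for i
    using W2_has_weak_deriv[OF y that] that f[of i] unfolding D_def by (intro integrable_mult_has_weak_deriv) auto
  have wD: "integrable unit_leb (\<lambda>x. w i x * D (Suc i) x)" if "i < m" for i
    using integrable_mult_continuous[OF Dint[OF that] wcont[of i]] that by (simp add: mult.commute)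
  have "(\<Sum>i<m. LINT x|unit_leb. f i x * D i x + w i x * D (Suc i) x) = 0"
  proof (rule sum.neutral, rule ballI)
    fix i assume "i \<in> {..<m}"
    then have i: "i < m" by simp
    obtain c where c: "AE x in unit_leb. D i x = c + prim (D (Suc i)) x"
      using has_weak_deriv_imp_prim[OF W2_has_weak_deriv[OF y i]] by (auto simp: D_def)
    \<comment> \<open>The continuous representative of \<open>D i\<close> is needed because boundary
      values are taken.\<close>
    define G where "G x = c + prim (D (Suc i)) x" for x
    have Gcont: "continuous_on {0..1} G"
      unfolding G_def by (intro continuous_intros prim_continuous Dint i)
    have "(LINT x|unit_leb. f i x * D i x + w i x * D (Suc i) x)
        = (LINT x|unit_leb. f i x * G x + w i x * D (Suc i) x)"
    proof (rule integral_cong_AE)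
      show "AE x in unit_leb. f i x * D i x + w i x * D (Suc i) x = f i x * G x + w i x * D (Suc i) x"
        using c by eventually_elim (simp add: G_def)
      show "(\<lambda>x. f i x * D i x + w i x * D (Suc i) x) \<in> borel_measurable unit_leb"
        using fD[OF i] wD[OF i] by (intro borel_measurable_integrable Bochner_Integration.integrable_add)
      show "(\<lambda>x. f i x * G x + w i x * D (Suc i) x) \<in> borel_measurable unit_leb"
        using integrable_mult_continuous[OF f Gcont, of i] wD[OF i] i
        by (intro borel_measurable_integrable Bochner_Integration.integrable_add) auto
    qed
    also have "\<dots> = w i 1 * G 1 - w i 0 * G 0"
      using f[of i] Dint[OF i] w[of i] i by (intro integral_by_parts[where a=0]) (auto simp: G_def)
    also have "\<dots> = 0" using w1[of i] w[of i] i by (simp add: prim_0)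
    finally show "(LINT x|unit_leb. f i x * D i x + w i x * D (Suc i) x) = 0" .
  qed
  then have "(LINT x|unit_leb. (\<Sum>i<m. f i x * D i x + w i x * D (Suc i) x)) = 0"
    using fD wD by (subst Bochner_Integration.integral_sum) auto
  moreover have "(LINT x|unit_leb. (\<Sum>i<m. f i x * D i x + w i x * D (Suc i) x))
      = (LINT x|unit_leb. - (\<Sum>i\<le>m. b i x * low_quasi m F y i x))"
  proof (rule integral_cong_AE)
    show "(\<lambda>x. \<Sum>i<m. f i x * D i x + w i x * D (Suc i) x) \<in> borel_measurable unit_leb"
      using fD wD
      by (intro borel_measurable_integrable Bochner_Integration.integrable_sum Bochner_Integration.integrable_add) auto
    show "(\<lambda>x. - (\<Sum>i\<le>m. b i x * low_quasi m F y i x)) \<in> borel_measurable unit_leb"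
      using form_term_integrable[OF F m b y]
      by (intro borel_measurable_integrable Bochner_Integration.integrable_minus Bochner_Integration.integrable_sum) auto
    show "AE x in unit_leb. (\<Sum>i<m. f i x * D i x + w i x * D (Suc i) x)
        = - (\<Sum>i\<le>m. b i x * low_quasi m F y i x)"
      using w_high w_pred
    proof eventually_elim
      case (elim x)
      have entries: "(\<Sum>k<2*m. entry m F k i x * w k x) = entry m F (m - 1) i x * w (m - 1) x" if "i < m" for i
      proof -
        have "(\<Sum>k<2*m. entry m F k i x * w k x) = (\<Sum>k\<in>{m - 1}. entry m F k i x * w k x)"
          using m elim(1) by (intro sum.mono_neutral_right) (auto simp: entry_def)
        then show ?thesis by simp
      qed
      \<comment> \<open>Of the telescoping sum only w_(m-1) y^(m) survives; the entries of row m - 1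
        complete y^(m) to y^[m], and w_(m-1) = -b_m gives the top term of the form.\<close>
      have tele: "(\<Sum>i<l. w i x * D (Suc i) x - (if i = 0 then 0 else w (i - 1) x) * D i x)
          = (if l = 0 then 0 else w (l - 1) x * D l x)" for l
        by (induction l) auto
      have "(\<Sum>i<m. f i x * D i x + w i x * D (Suc i) x)
        = (\<Sum>i<m. (w i x * D (Suc i) x - (if i = 0 then 0 else w (i - 1) x) * D i x)
            - w (m - 1) x * (entry m F (m - 1) i x * D i x) - b i x * D i x)"
      proof (intro sum.cong refl)
        fix i assume "i \<in> {..<m}"
        define q where "q = (if i = 0 then 0 else w (i - 1) x)"
        have f: "f i x = - (entry m F (m - 1) i x * w (m - 1) x) - q - b i x"
          using f_eq[of i x] entries[of i] \<open>i \<in> {..<m}\<close> by (simp add: q_def)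
        show "f i x * D i x + w i x * D (Suc i) x
          = (w i x * D (Suc i) x - (if i = 0 then 0 else w (i - 1) x) * D i x)
            - w (m - 1) x * (entry m F (m - 1) i x * D i x) - b i x * D i x"
          unfolding q_def[symmetric] f by (simp add: algebra_simps)
      qed
      also have "\<dots> = w (m - 1) x * (D m x - (\<Sum>i<m. entry m F (m - 1) i x * D i x)) - (\<Sum>i<m. b i x * D i x)"
        unfolding sum_subtractf using tele[of m, unfolded sum_subtractf] m
        by (simp add: sum_distrib_left right_diff_distrib)
      also have "\<dots> = - (b m x * low_quasi m F y m x + (\<Sum>i<m. b i x * low_quasi m F y i x))"
        using elim(2) by (simp add: low_quasi_def D_def)
      also have "\<dots> = - (\<Sum>i\<le>m. b i x * low_quasi m F y i x)"
        by (simp add: lessThan_Suc_atMost[symmetric] add.commute)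
      finally show ?case .
    qed
  qed
  moreover have "(LINT x|unit_leb. - (\<Sum>i\<le>m. b i x * low_quasi m F y i x)) = - form_on_W2 m F b y"
    unfolding form_on_W2_def using form_term_integrable[OF F m b y] by (simp add: Bochner_Integration.integral_sum)
  ultimately show ?thesis by simp
qed

subsection \<open>Independence of the associated matrix\<close>

text \<open>The coefficients are chosen before \<open>y\<close>, as
  \<open>form_vanishes_on_W2\<close> requires; they may depend on a test function hidden in
  \<open>\<Lambda>\<close>.\<close>

definition representable ::
  "nat \<Rightarrow> (nat \<Rightarrow> nat \<Rightarrow> real \<Rightarrow> complex) \<Rightarrow> ((real \<Rightarrow> complex) \<Rightarrow> complex) \<Rightarrow> bool" where
  "representable m F \<Lambda> \<longleftrightarrow> (\<exists>b\<in>form_coeffs m. \<forall>y\<in>W2 m. \<Lambda> y = form_on_W2 m F b y)"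

lemma representable_cong:
  "representable m F \<Lambda> \<Longrightarrow> (\<And>y. y \<in> W2 m \<Longrightarrow> \<Lambda> y = \<Lambda>' y) \<Longrightarrow> representable m F \<Lambda>'"
  unfolding representable_def by metis

lemma representable_term:
  assumes "i \<le> m" "integrable unit_leb a" "i = m \<Longrightarrow> a \<in> Lp 2"
  shows "representable m F (\<lambda>y. LINT x|unit_leb. a x * low_quasi m F y i x)"
  unfolding representable_def
proof (intro bexI ballI)
  let ?b = "\<lambda>k. if k = i then a else (\<lambda>x. 0)"
  show "?b \<in> form_coeffs m" using assms by (auto simp: form_coeffs_def Lp_2_continuous)
  fix y
  have "form_on_W2 m F ?b y
      = (\<Sum>k\<le>m. if k = i then LINT x|unit_leb. a x * low_quasi m F y i x else 0)"
    unfolding form_on_W2_def by (intro sum.cong) auto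
  then show "(LINT x|unit_leb. a x * low_quasi m F y i x) = form_on_W2 m F ?b y"
    using assms(1) by simp
qed

lemma representable_scale:
  assumes "representable m F \<Lambda>" shows "representable m F (\<lambda>y. c * \<Lambda> y)"
proof -
  obtain b where b: "b \<in> form_coeffs m" "\<And>y. y \<in> W2 m \<Longrightarrow> \<Lambda> y = form_on_W2 m F b y"
    using assms unfolding representable_def by blast
  show ?thesis
    unfolding representable_def
  proof (intro bexI ballI)
    show "(\<lambda>i x. c * b i x) \<in> form_coeffs m"
      using b(1) by (auto simp: form_coeffs_def Lp_2_cmult)
    show "c * \<Lambda> y = form_on_W2 m F (\<lambda>i x. c * b i x) y" if "y \<in> W2 m" for y
      using b(2)[OF that] by (simp add: form_on_W2_def sum_distrib_left mult.assoc)
  qed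
qed

lemma representable_add:
  assumes F: "F \<in> matrix_class m" and m: "m \<ge> 1" and "representable m F \<Lambda>" "representable m F \<Lambda>'"
  shows "representable m F (\<lambda>y. \<Lambda> y + \<Lambda>' y)"
proof -
  obtain b b' where b: "b \<in> form_coeffs m" "\<And>y. y \<in> W2 m \<Longrightarrow> \<Lambda> y = form_on_W2 m F b y"
    and b': "b' \<in> form_coeffs m" "\<And>y. y \<in> W2 m \<Longrightarrow> \<Lambda>' y = form_on_W2 m F b' y"
    using assms(3,4) unfolding representable_def by metis
  show ?thesis
    unfolding representable_def
  proof (intro bexI ballI)
    show "(\<lambda>i x. b i x + b' i x) \<in> form_coeffs m"
      using b(1) b'(1) by (auto simp: form_coeffs_def Lp_2_add)
    fix y assume y: "y \<in> W2 m"
    have "form_on_W2 m F (\<lambda>i x. b i x + b' i x) y = form_on_W2 m F b y + form_on_W2 m F b' y"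
      unfolding form_on_W2_def sum.distrib[symmetric]
      using form_term_integrable[OF F m b(1) y] form_term_integrable[OF F m b'(1) y]
      by (intro sum.cong) (auto simp: distrib_right)
    then show "\<Lambda> y + \<Lambda>' y = form_on_W2 m F (\<lambda>i x. b i x + b' i x) y"
      using b(2)[OF y] b'(2)[OF y] by simp
  qed
qed

lemma representable_sum:
  assumes F: "F \<in> matrix_class m" and m: "m \<ge> 1" and I: "finite I"
    and \<Lambda>: "\<And>i. i \<in> I \<Longrightarrow> representable m F (\<Lambda> i)"
  shows "representable m F (\<lambda>y. \<Sum>i\<in>I. \<Lambda> i y)"
  using I \<Lambda>
proof (induction I)
  case empty
  show ?case using representable_scale[OF representable_term[of 0 m "\<lambda>_. 0" F], of 0]
    by (simp add: Lp_2_continuous)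
next
  case (insert i I)
  then show ?case using representable_add[OF F m, of "\<Lambda> i" "\<lambda>y. \<Sum>i\<in>I. \<Lambda> i y"] by simp
qed

text \<open>Quasi-derivatives for two matrices agree below order \<open>m\<close>, and at order
  \<open>m\<close> they differ by L_2 multiples of lower derivatives. Multiplied by b_m in L_2 these
  multiples are integrable and join the lower coefficients.\<close>

lemma representable_matrix_change:
  assumes F: "F \<in> matrix_class m" and G: "G \<in> matrix_class m" and m: "m \<ge> 1"
    and \<Lambda>: "representable m G \<Lambda>"
  shows "representable m F \<Lambda>"
proof -
  obtain b where b: "b \<in> form_coeffs m" and b_eq: "\<And>y. y \<in> W2 m \<Longrightarrow> \<Lambda> y = form_on_W2 m G b y"
    using \<Lambda> unfolding representable_def by blast
  have bm: "b m \<in> Lp 2" using b by (simp add: form_coeffs_def)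
  define e where "e j x = b m x * (entry m F (m - 1) j x + (-1) * entry m G (m - 1) j x)" for j x
  have e: "integrable unit_leb (e j)" for j
    unfolding e_def using m by (intro integrable_mult_Lp_2 bm Lp_2_add Lp_2_cmult entry_Lp_2 F G) auto
  have low: "low_quasi m F y j = low_quasi m G y j" if "j < m" for j y
    using that by (simp add: low_quasi_def fun_eq_iff)
  have eD: "integrable unit_leb (\<lambda>x. e j x * low_quasi m F y j x)" if "j < m" "y \<in> W2 m" for j y
    by (rule integrable_mult_has_weak_deriv[OF e low_quasi_has_weak_deriv[OF that(2,1)]])
  have "representable m F (\<lambda>y. (\<Sum>i\<le>m. LINT x|unit_leb. b i x * low_quasi m F y i x)
      + (\<Sum>j<m. LINT x|unit_leb. e j x * low_quasi m F y j x))"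
  proof (intro representable_add[OF F m] representable_sum[OF F m])
    show "representable m F (\<lambda>y. LINT x|unit_leb. b i x * low_quasi m F y i x)" if "i \<in> {..m}" for i
      using that bm form_coeff_integrable[OF b] by (intro representable_term) auto
    show "representable m F (\<lambda>y. LINT x|unit_leb. e j x * low_quasi m F y j x)" if "j \<in> {..<m}" for j
      using that e by (intro representable_term) auto
  qed auto
  then show ?thesis
  proof (rule representable_cong)
    fix y assume y: "y \<in> W2 m"
    have bF: "integrable unit_leb (\<lambda>x. b m x * low_quasi m F y m x)"
      using form_term_integrable[OF F m b y] by simp
    have "(LINT x|unit_leb. b m x * low_quasi m G y m x)
        = (LINT x|unit_leb. b m x * low_quasi m F y m x + (\<Sum>j<m. e j x * low_quasi m F y j x))"
      by (intro Bochner_Integration.integral_cong refl)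
         (simp add: low_quasi_def e_def algebra_simps sum_distrib_left sum.distrib sum_subtractf)
    also have "\<dots> = (LINT x|unit_leb. b m x * low_quasi m F y m x)
        + (\<Sum>j<m. LINT x|unit_leb. e j x * low_quasi m F y j x)"
    proof -
      have "integrable unit_leb (\<lambda>x. \<Sum>j<m. e j x * low_quasi m F y j x)"
        using eD[OF _ y] by (intro Bochner_Integration.integrable_sum) auto
      moreover have "(LINT x|unit_leb. (\<Sum>j<m. e j x * low_quasi m F y j x))
          = (\<Sum>j<m. LINT x|unit_leb. e j x * low_quasi m F y j x)"
        using eD[OF _ y] by (intro Bochner_Integration.integral_sum) auto
      ultimately show ?thesis using bF by simp
    qed
    finally show "(\<Sum>i\<le>m. LINT x|unit_leb. b i x * low_quasi m F y i x)
        + (\<Sum>j<m. LINT x|unit_leb. e j x * low_quasi m F y j x) = \<Lambda> y"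
      unfolding b_eq[OF y] form_on_W2_def using low by (simp add: lessThan_Suc_atMost[symmetric])
  qed
qed

text \<open>The lower order terms in the step from y^[m+l] to y^[m+l+1]. Columns of index above
  \<open>m\<close> vanish, so they make sense for every \<open>y\<close> in \<open>W2 m\<close>
  although y^[m+l] need not.\<close>

definition remainder ::
  "nat \<Rightarrow> (nat \<Rightarrow> nat \<Rightarrow> real \<Rightarrow> complex) \<Rightarrow> (real \<Rightarrow> complex) \<Rightarrow> nat \<Rightarrow> real \<Rightarrow> complex" where
  "remainder m F y l x = (\<Sum>j\<le>m. entry m F (m + l) j x * low_quasi m F y j x)"

lemma entry_form_coeffs:
  assumes "F \<in> matrix_class m" "l < m"
  shows "entry m F (m + l) \<in> form_coeffs m"
  using assms by (auto simp: form_coeffs_def intro!: entry_integrable entry_Lp_2)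

lemma remainder_integrable:
  assumes "F \<in> matrix_class m" "m \<ge> 1" "y \<in> W2 m" "l < m"
  shows "integrable unit_leb (remainder m F y l)"
  unfolding remainder_def
  using form_term_integrable[OF assms(1,2) entry_form_coeffs[OF assms(1,4)] assms(3)]
  by (intro Bochner_Integration.integrable_sum) auto

text \<open>Each step moves one derivative onto \<open>z\<close> and adds a form whose coefficients
  are a row of entries multiplied by \<open>z\<close>.\<close>

lemma representable_dist_quasi:
  assumes F: "F \<in> matrix_class m" and m: "m \<ge> 1"
  shows "s \<le> m \<Longrightarrow> z \<in> test_fun \<Longrightarrow>
    representable m F (\<lambda>y. dist_quasi (low_quasi m F y m) (remainder m F y) s z)"
proof (induction s arbitrary: z)
  case 0
  have "representable m F (\<lambda>y. LINT x|unit_leb. z x * low_quasi m F y m x)"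
    using 0 by (intro representable_term integrable_test_fun Lp_2_continuous test_fun_continuous) auto
  then show ?case by (simp add: reg_dist_def mult.commute)
next
  case (Suc s)
  have ez: "(\<lambda>j x. entry m F (m + s) j x * z x) \<in> form_coeffs m"
    using entry_form_coeffs[OF F, of s] Suc.prems
    by (auto simp: form_coeffs_def intro!: integrable_mult_test_fun Lp_2_mult_continuous test_fun_continuous)
  have "representable m F (\<lambda>y. (-1) * dist_quasi (low_quasi m F y m) (remainder m F y) s (ddx z)
      + (-1) * (\<Sum>j\<le>m. LINT x|unit_leb. (entry m F (m + s) j x * z x) * low_quasi m F y j x))"
  proof (intro representable_add[OF F m] representable_scale representable_sum[OF F m])
    show "representable m F (\<lambda>y. LINT x|unit_leb. (entry m F (m + s) j x * z x) * low_quasi m F y j x)"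
      if "j \<in> {..m}" for j
      using that form_coeff_integrable[OF ez, of j] ez by (intro representable_term) (auto simp: form_coeffs_def)
  qed (use Suc in \<open>auto intro!: test_fun_ddx\<close>)
  then show ?case
  proof (rule representable_cong)
    fix y assume y: "y \<in> W2 m"
    have "reg_dist (remainder m F y s) z
        = (LINT x|unit_leb. (\<Sum>j\<le>m. (entry m F (m + s) j x * z x) * low_quasi m F y j x))"
      unfolding reg_dist_def remainder_def
      by (intro Bochner_Integration.integral_cong refl)
         (unfold sum_distrib_right, intro sum.cong refl, simp add: mult_ac)
    also have "\<dots> = (\<Sum>j\<le>m. LINT x|unit_leb. (entry m F (m + s) j x * z x) * low_quasi m F y j x)"
      using form_term_integrable[OF F m ez y] by (intro Bochner_Integration.integral_sum) auto
    finally show "(-1) * dist_quasi (low_quasi m F y m) (remainder m F y) s (ddx z)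
      + (-1) * (\<Sum>j\<le>m. LINT x|unit_leb. (entry m F (m + s) j x * z x) * low_quasi m F y j x)
      = dist_quasi (low_quasi m F y m) (remainder m F y) (Suc s) z"
      by (simp add: dist_deriv_def)
  qed
qed

lemma dist_quasi_on_quasi_domain:
  assumes F: "F \<in> matrix_class m" and m: "m \<ge> 1" and y: "y \<in> quasi_domain m F" and z: "z \<in> test_fun"
  shows "dist_quasi (low_quasi m F y m) (remainder m F y) m z = reg_dist (quasi_deriv F y (2 * m)) z"
proof -
  have W: "y \<in> W2 m" by (rule quasi_domain_W2(1)[OF F y m])
  \<comment> \<open>\<open>dist_quasi\<close> starts literally from \<open>low_quasi\<close>, which
    equals y^[m] only almost everywhere; hence the exception at index 0.\<close>
  define v where "v l = (if l = 0 then low_quasi m F y m else quasi_deriv F y (m + l))" for l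
  have v: "AE x in unit_leb. quasi_deriv F y (m + l) x = v l x" for l
    using quasi_domain_W2(2)[OF F y m, of m] by (auto simp: v_def simp del: quasi_deriv.simps)
  have "dist_quasi (v 0) (remainder m F y) m z = reg_dist (v m) z"
  proof (rule dist_quasi_regular)
    fix l assume l: "l < m"
    show "integrable unit_leb (remainder m F y l)" by (rule remainder_integrable[OF F m W l])
    have "AE x in unit_leb. (\<Sum>j\<le>m. entry m F (m + l) j x * quasi_deriv F y j x) = remainder m F y l x"
      unfolding remainder_def
    proof (rule AE_sum_cong)
      fix j assume "j \<in> {..m}"
      then have "AE x in unit_leb. quasi_deriv F y j x = low_quasi m F y j x"
        by (intro quasi_domain_W2(2)[OF F y m]) simp
      then show "AE x in unit_leb. entry m F (m + l) j x * quasi_deriv F y j x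
          = entry m F (m + l) j x * low_quasi m F y j x" by eventually_elim simp
    qed simp
    then have "AE x in unit_leb. (\<Sum>j<2*m. entry m F (m + l) j x * quasi_deriv F y j x) = remainder m F y l x"
    proof eventually_elim
      case (elim x)
      have "(\<Sum>j<2*m. entry m F (m + l) j x * quasi_deriv F y j x)
          = (\<Sum>j\<le>m. entry m F (m + l) j x * quasi_deriv F y j x)"
        using m by (intro sum.mono_neutral_right) (auto simp: entry_def)
      then show ?case using elim by simp
    qed
    then have rem: "AE x in unit_leb. quasi_deriv F y (m + Suc l) x
        + (\<Sum>j<2*m. entry m F (m + l) j x * quasi_deriv F y j x) = v (Suc l) x + remainder m F y l x"
      using v[of "Suc l"] by eventually_elim (simp del: quasi_deriv.simps)
    have "has_weak_deriv (quasi_deriv F y (m + l)) (\<lambda>x. quasi_deriv F y (m + Suc l) x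
        + (\<Sum>j<2*m. entry m F (m + l) j x * quasi_deriv F y j x))"
      using quasi_chain_quasi_deriv[OF F y] l by (simp add: quasi_chain_def del: quasi_deriv.simps)
    from has_weak_deriv_AE[OF this v rem]
    show "has_weak_deriv (v l) (\<lambda>x. v (Suc l) x + remainder m F y l x)" .
  qed (rule z)
  then show ?thesis using m by (simp add: v_def mult_2 del: quasi_deriv.simps)
qed

section \<open>The differential expression, tested against z, as a form\<close>

lemma funpow_dist_deriv: "(dist_deriv ^^ k) T z = (-1) ^ k * T ((ddx ^^ k) z)"
  by (induction k arbitrary: z) (simp_all add: dist_deriv_def funpow_swap1[of ddx])

lemma has_weak_deriv_test_fun_mult:
  assumes h: "has_weak_deriv f g" and c: "c \<in> test_fun"
  shows "has_weak_deriv (\<lambda>x. c x * f x) (\<lambda>x. ddx c x * f x + c x * g x)"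
  unfolding has_weak_deriv_iff
proof (intro conjI ballI)
  have f: "integrable unit_leb f" and g: "integrable unit_leb g"
    using h by (auto dest: has_weak_deriv_integrable)
  have cf: "integrable unit_leb (\<lambda>x. c x * f x)" and cg: "integrable unit_leb (\<lambda>x. c x * g x)"
    and c'f: "integrable unit_leb (\<lambda>x. ddx c x * f x)"
    using integrable_mult_test_fun[OF f c] integrable_mult_test_fun[OF g c]
      integrable_mult_test_fun[OF f test_fun_ddx[OF c]] by (simp_all add: mult.commute)
  show "integrable unit_leb (\<lambda>x. c x * f x)"
    "integrable unit_leb (\<lambda>x. ddx c x * f x + c x * g x)" using cf cg c'f by auto
  fix z assume z: "z \<in> test_fun"
  have "ddx (\<lambda>x. c x * z x) = (\<lambda>x. c x * ddx z x + ddx c x * z x)"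
    by (intro ddx_eqI has_vector_derivative_mult test_fun_derivative c z)
  then have "(LINT x|unit_leb. f x * (c x * ddx z x + ddx c x * z x)) = - (LINT x|unit_leb. g x * (c x * z x))"
    using has_weak_deriv_integral[OF h test_fun_mult[OF c z]] by simp
  moreover have "(LINT x|unit_leb. f x * (c x * ddx z x + ddx c x * z x))
      = (LINT x|unit_leb. c x * f x * ddx z x) + (LINT x|unit_leb. ddx c x * f x * z x)"
    using integrable_mult_test_fun[OF cf test_fun_ddx[OF z]] integrable_mult_test_fun[OF c'f z]
    by (simp add: distrib_left mult_ac)
  moreover have "(LINT x|unit_leb. (ddx c x * f x + c x * g x) * z x)
      = (LINT x|unit_leb. ddx c x * f x * z x) + (LINT x|unit_leb. g x * (c x * z x))"
  proof -
    have "(LINT x|unit_leb. (ddx c x * f x + c x * g x) * z x)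
        = (LINT x|unit_leb. ddx c x * f x * z x) + (LINT x|unit_leb. c x * g x * z x)"
      unfolding distrib_right
      by (intro Bochner_Integration.integral_add integrable_mult_test_fun c'f cg z)
    then show ?thesis by (simp add: mult_ac)
  qed
  ultimately show "(LINT x|unit_leb. c x * f x * ddx z x)
      = - (LINT x|unit_leb. (ddx c x * f x + c x * g x) * z x)"
    by (simp add: algebra_simps)
qed

lemma has_weak_deriv_sum:
  assumes "finite I" "\<And>i. i \<in> I \<Longrightarrow> has_weak_deriv (f i) (g i)"
  shows "has_weak_deriv (\<lambda>x. \<Sum>i\<in>I. f i x) (\<lambda>x. \<Sum>i\<in>I. g i x)"
  unfolding has_weak_deriv_iff
proof (intro conjI ballI)
  have f: "integrable unit_leb (f i)" and g: "integrable unit_leb (g i)" if "i \<in> I" for i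
    using assms(2)[OF that] by (auto dest: has_weak_deriv_integrable)
  show "integrable unit_leb (\<lambda>x. \<Sum>i\<in>I. f i x)" "integrable unit_leb (\<lambda>x. \<Sum>i\<in>I. g i x)"
    using f g by auto
  fix z assume z: "z \<in> test_fun"
  have "(LINT x|unit_leb. (\<Sum>i\<in>I. f i x) * ddx z x) = (\<Sum>i\<in>I. LINT x|unit_leb. f i x * ddx z x)"
    unfolding sum_distrib_right using f z
    by (intro Bochner_Integration.integral_sum integrable_mult_test_fun test_fun_ddx) auto
  also have "\<dots> = (\<Sum>i\<in>I. - (LINT x|unit_leb. g i x * z x))"
    using has_weak_deriv_integral[OF assms(2) z] by (intro sum.cong) auto
  also have "\<dots> = - (\<Sum>i\<in>I. LINT x|unit_leb. g i x * z x)" by (rule sum_negf)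
  also have "(\<Sum>i\<in>I. LINT x|unit_leb. g i x * z x) = (LINT x|unit_leb. (\<Sum>i\<in>I. g i x) * z x)"
    unfolding sum_distrib_right using g z
    by (intro Bochner_Integration.integral_sum[symmetric] integrable_mult_test_fun) auto
  finally show "(LINT x|unit_leb. (\<Sum>i\<in>I. f i x) * ddx z x) = - (LINT x|unit_leb. (\<Sum>i\<in>I. g i x) * z x)" .
qed

text \<open>The coefficients depend on the test function but not on \<open>y\<close>, which is all
  that a form requires; binomial coefficients are never made explicit. The bound
  \<open>k + i \<le> m\<close> guarantees that the derivatives of \<open>y\<close> involved
  exist.\<close>

lemma leibniz_weak_deriv:
  assumes \<zeta>: "\<zeta> \<in> test_fun"
  shows "k + i \<le> m \<Longrightarrow> \<exists>c. (\<forall>l. c l \<in> test_fun) \<and> (\<forall>y\<in>W2 m. AE x in unit_leb.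
    (weak_deriv ^^ i) (\<lambda>t. (weak_deriv ^^ k) y t * \<zeta> t) x = (\<Sum>l\<le>i. c l x * (weak_deriv ^^ (k + l)) y x))"
proof (induction i)
  case 0
  show ?case using \<zeta> by (intro exI[of _ "\<lambda>_. \<zeta>"]) (simp add: mult.commute)
next
  case (Suc i)
  then have "k + i \<le> m" by simp
  from Suc.IH[OF this] obtain c where c: "\<And>l. c l \<in> test_fun"
    and eq: "\<And>y. y \<in> W2 m \<Longrightarrow> AE x in unit_leb.
    (weak_deriv ^^ i) (\<lambda>t. (weak_deriv ^^ k) y t * \<zeta> t) x = (\<Sum>l\<le>i. c l x * (weak_deriv ^^ (k + l)) y x)"
    by blast
  \<comment> \<open>Differentiating c_l D_l gives c_l' D_l + c_l D_(l+1), so the new coefficient is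
    c_l' + c_(l-1), with the missing terms at both ends set to 0.\<close>
  define c' where "c' l x = (if l \<le> i then ddx (c l) x else 0) + (if l = 0 then 0 else c (l - 1) x)" for l x
  have "c' l \<in> test_fun" for l
    unfolding c'_def using c test_fun_ddx[OF c] test_fun_zero
    by (cases "l \<le> i"; cases "l = 0") (auto intro: test_fun_add)
  moreover have "AE x in unit_leb. (weak_deriv ^^ Suc i) (\<lambda>t. (weak_deriv ^^ k) y t * \<zeta> t) x
      = (\<Sum>l\<le>Suc i. c' l x * (weak_deriv ^^ (k + l)) y x)" if y: "y \<in> W2 m" for y
  proof -
    let ?D = "\<lambda>l. (weak_deriv ^^ (k + l)) y"
    have "has_weak_deriv (\<lambda>x. \<Sum>l\<le>i. c l x * ?D l x) (\<lambda>x. \<Sum>l\<le>i. ddx (c l) x * ?D l x + c l x * ?D (Suc l) x)"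
      using W2_has_weak_deriv[OF y] Suc.prems
      by (intro has_weak_deriv_sum has_weak_deriv_test_fun_mult c) auto
    then have "has_weak_deriv ((weak_deriv ^^ i) (\<lambda>t. (weak_deriv ^^ k) y t * \<zeta> t))
        (\<lambda>x. \<Sum>l\<le>i. ddx (c l) x * ?D l x + c l x * ?D (Suc l) x)"
      by (rule has_weak_deriv_AE) (use AE_symmetric[OF eq[OF y]] in auto)
    from weak_deriv_eq(2)[OF this]
    have "AE x in unit_leb. (weak_deriv ^^ Suc i) (\<lambda>t. (weak_deriv ^^ k) y t * \<zeta> t) x
      = (\<Sum>l\<le>i. ddx (c l) x * ?D l x + c l x * ?D (Suc l) x)" by simp
    moreover have "(\<Sum>l\<le>i. ddx (c l) x * ?D l x + c l x * ?D (Suc l) x) = (\<Sum>l\<le>Suc i. c' l x * ?D l x)" for x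
    proof -
      have "(\<Sum>l\<le>Suc i. c' l x * ?D l x) = (\<Sum>l\<le>Suc i. (if l \<le> i then ddx (c l) x else 0) * ?D l x)
          + (\<Sum>l\<le>Suc i. (if l = 0 then 0 else c (l - 1) x) * ?D l x)"
        by (simp only: c'_def distrib_right sum.distrib)
      also have "(\<Sum>l\<le>Suc i. (if l = 0 then 0 else c (l - 1) x) * ?D l x) = (\<Sum>l\<le>i. c l x * ?D (Suc l) x)"
        by (subst sum.atMost_Suc_shift) simp
      finally show ?thesis by (simp add: sum.distrib)
    qed
    ultimately show ?thesis by simp
  qed
  ultimately show ?case by blast
qed

lemma zero_matrix_class: "(\<lambda>_ _ _. 0) \<in> matrix_class m"
  by (auto simp: matrix_class_def Lp_2_continuous Lp_1_iff[unfolded One_nat_def])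

lemma low_quasi_zero_matrix: "i \<le> m \<Longrightarrow> low_quasi m (\<lambda>_ _ _. 0) y i = (weak_deriv ^^ i) y"
  by (auto simp: low_quasi_def entry_def fun_eq_iff)

text \<open>The primitive \<open>\<sigma>\<close> selected in \<open>dist_prod\<close> depends on
  \<open>i\<close> and \<open>\<tau>\<close> alone, so one choice serves all \<open>y\<close>. After
  the Leibniz expansion the coefficients are \<open>\<sigma>\<close> times test functions, hence in
  L_2 and admissible even in front of y^(m).\<close>

lemma representable_dist_prod:
  assumes m: "m \<ge> 1" and \<tau>: "\<tau> \<in> W2_neg i" and ki: "k + i \<le> m" and z: "z \<in> test_fun"
  shows "representable m (\<lambda>_ _ _. 0)
    (\<lambda>y. (dist_deriv ^^ l) (dist_prod i \<tau> ((weak_deriv ^^ k) y)) z)"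
proof -
  define \<sigma> where "\<sigma> = (SOME \<sigma>. primitive i \<tau> \<sigma>)"
  have "primitive i \<tau> \<sigma>"
    unfolding \<sigma>_def using someI_ex[of "primitive i \<tau>"] \<tau> by (simp add: W2_neg_def)
  then have \<sigma>: "\<sigma> \<in> Lp 2" by (simp add: primitive_def)
  define \<zeta> where "\<zeta> = (ddx ^^ l) z"
  have "\<zeta> \<in> test_fun" unfolding \<zeta>_def using z by (rule test_fun_funpow_ddx)
  from leibniz_weak_deriv[OF this ki] obtain c where c: "\<And>l. c l \<in> test_fun"
    and eq: "\<And>y. y \<in> W2 m \<Longrightarrow> AE x in unit_leb.
    (weak_deriv ^^ i) (\<lambda>t. (weak_deriv ^^ k) y t * \<zeta> t) x = (\<Sum>l\<le>i. c l x * (weak_deriv ^^ (k + l)) y x)"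
    by blast
  have \<sigma>c: "(\<lambda>x. \<sigma> x * c j x) \<in> Lp 2" for j
    using \<sigma> c by (intro Lp_2_mult_continuous test_fun_continuous)
  let ?D = "\<lambda>y j. low_quasi m (\<lambda>_ _ _. 0) y (k + j)"
  have int: "integrable unit_leb (\<lambda>x. \<sigma> x * c j x * ?D y j x)" if "y \<in> W2 m" "j \<le> i" for y j
  proof -
    have "(\<lambda>_ x. \<sigma> x * c j x) \<in> form_coeffs m"
      using \<sigma>c by (simp add: form_coeffs_def Lp_2_imp_integrable)
    from form_term_integrable[OF zero_matrix_class m this that(1), of "k + j"]
    show ?thesis using that ki by simp
  qed
  have "representable m (\<lambda>_ _ _. 0)
      (\<lambda>y. (-1) ^ l * ((-1) ^ i * (\<Sum>j\<le>i. LINT x|unit_leb. (\<sigma> x * c j x) * ?D y j x)))"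
    using ki \<sigma>c
    by (intro representable_scale representable_sum[OF zero_matrix_class m] representable_term Lp_2_imp_integrable) auto
  then show ?thesis
  proof (rule representable_cong)
    fix y assume y: "y \<in> W2 m"
    have "(LINT x|unit_leb. \<sigma> x * (weak_deriv ^^ i) (\<lambda>t. (weak_deriv ^^ k) y t * \<zeta> t) x)
        = (LINT x|unit_leb. (\<Sum>j\<le>i. \<sigma> x * c j x * ?D y j x))"
    proof -
      have ae: "AE x in unit_leb. (\<Sum>j\<le>i. \<sigma> x * c j x * ?D y j x)
          = \<sigma> x * (weak_deriv ^^ i) (\<lambda>t. (weak_deriv ^^ k) y t * \<zeta> t) x"
        using eq[OF y]
      proof eventually_elim
        case (elim x)
        show ?case
          unfolding elim sum_distrib_left using ki
          by (intro sum.cong) (auto simp: low_quasi_zero_matrix mult.assoc)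
      qed
      have sum: "integrable unit_leb (\<lambda>x. \<Sum>j\<le>i. \<sigma> x * c j x * ?D y j x)"
        using int[OF y] by (intro Bochner_Integration.integrable_sum) auto
      show ?thesis
        by (rule integral_cong_AE[OF _ _ AE_symmetric[OF ae]])
           (intro borel_measurable_integrable integrable_unit_leb_AE[OF sum ae] sum)+
    qed
    also have "\<dots> = (\<Sum>j\<le>i. LINT x|unit_leb. \<sigma> x * c j x * ?D y j x)"
      using int[OF y] by (intro Bochner_Integration.integral_sum) auto
    finally show "(-1) ^ l * ((-1) ^ i * (\<Sum>j\<le>i. LINT x|unit_leb. (\<sigma> x * c j x) * ?D y j x))
        = (dist_deriv ^^ l) (dist_prod i \<tau> ((weak_deriv ^^ k) y)) z"
      by (simp add: funpow_dist_deriv dist_prod_def \<sigma>_def \<zeta>_def)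
  qed
qed

lemma representable_diff_expr:
  assumes m: "m \<ge> 1" and T: "\<T> \<in> coeff_space m" and z: "z \<in> test_fun"
  shows "representable m (\<lambda>_ _ _. 0) (\<lambda>y. diff_expr m \<T> y z)"
  unfolding diff_expr_def
proof (intro representable_add[OF zero_matrix_class m] representable_sum[OF zero_matrix_class m] representable_scale)
  \<comment> \<open>All 2m derivatives of the leading term go onto \<open>z\<close>, which leaves a
    form of order 0.\<close>
  have "representable m (\<lambda>_ _ _. 0)
      (\<lambda>y. LINT x|unit_leb. (ddx ^^ (2 * m)) z x * low_quasi m (\<lambda>_ _ _. 0) y 0 x)"
    using m test_fun_funpow_ddx[OF z] by (intro representable_term integrable_test_fun) auto
  then show "representable m (\<lambda>_ _ _. 0) (\<lambda>y. (dist_deriv ^^ (2 * m)) (reg_dist y) z)"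
    by (simp add: low_quasi_zero_matrix funpow_dist_deriv reg_dist_def mult.commute)
  have T': "\<T> \<nu> \<in> W2_neg (sing_order m \<nu>)" if "\<nu> < 2 * m" for \<nu>
    using T that by (simp add: coeff_space_def)
  fix k assume "k \<in> {..<m}"
  then have k: "k < m" by simp
  \<comment> \<open>The orders are balanced: m - k derivatives meet y^(k), and m - k - 1 derivatives
    meet y^(k) or y^(k+1), so none of order above \<open>m\<close> arises.\<close>
  show "representable m (\<lambda>_ _ _. 0) (\<lambda>y. (dist_deriv ^^ k)
      (dist_prod (sing_order m (2 * k)) (\<T> (2 * k)) ((weak_deriv ^^ k) y)) z)"
    using k by (intro representable_dist_prod[OF m T' _ z]) (auto simp: sing_order_def)
  show "representable m (\<lambda>_ _ _. 0) (\<lambda>y. (dist_deriv ^^ (k + 1))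
      (dist_prod (sing_order m (2 * k + 1)) (\<T> (2 * k + 1)) ((weak_deriv ^^ k) y)) z)"
    using k by (intro representable_dist_prod[OF m T' _ z]) (auto simp: sing_order_def)
  show "representable m (\<lambda>_ _ _. 0) (\<lambda>y. (dist_deriv ^^ k)
      (dist_prod (sing_order m (2 * k + 1)) (\<T> (2 * k + 1)) ((weak_deriv ^^ (k + 1)) y)) z)"
    using k by (intro representable_dist_prod[OF m T' _ z]) (auto simp: sing_order_def)
qed auto

text \<open>The hinge of the proof: an identity assumed only on the domain of \<open>F\<close>
  spreads to W_2^m, and so becomes available for functions from the domain of any other
  matrix.\<close>

lemma diff_expr_on_W2:
  assumes m: "m \<ge> 1" and T: "\<T> \<in> coeff_space m" and F: "F \<in> assoc_matrices m \<T>"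
    and y: "y \<in> W2 m" and z: "z \<in> test_fun"
  shows "diff_expr m \<T> y z = dist_quasi (low_quasi m F y m) (remainder m F y) m z"
proof -
  have FM: "F \<in> matrix_class m" using F by (simp add: assoc_matrices_def)
  define \<Lambda> where "\<Lambda> y = diff_expr m \<T> y z
      + (-1) * dist_quasi (low_quasi m F y m) (remainder m F y) m z" for y
  have "representable m F \<Lambda>"
    unfolding \<Lambda>_def
    using representable_matrix_change[OF FM zero_matrix_class m representable_diff_expr[OF m T z]]
      representable_dist_quasi[OF FM m _ z]
    by (intro representable_add[OF FM m] representable_scale) auto
  then obtain b where b: "b \<in> form_coeffs m" and \<Lambda>_eq: "\<And>y. y \<in> W2 m \<Longrightarrow> \<Lambda> y = form_on_W2 m F b y"
    unfolding representable_def by blast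
  have "form_on_W2 m F b u = 0" if u: "u \<in> quasi_domain m F" for u
  proof -
    have "u \<in> W2 m" by (rule quasi_domain_W2(1)[OF FM u m])
    then have "form_on_W2 m F b u = \<Lambda> u" by (simp add: \<Lambda>_eq)
    also have "\<dots> = 0"
      using F u z dist_quasi_on_quasi_domain[OF FM m u z]
      by (simp add: \<Lambda>_def assoc_matrices_def dist_eq_def del: quasi_deriv.simps)
    finally show ?thesis .
  qed
  then have "\<Lambda> y = 0"
    using form_vanishes_on_W2[OF FM m b _ y] \<Lambda>_eq[OF y] by simp
  then show ?thesis by (simp add: \<Lambda>_def)
qed

text \<open>\<open>F\<close> supplies the integrable function \<open>f\<close> representing l(y);
  \<open>diff_expr_on_W2\<close> is then applied with \<open>G\<close>, and
  \<open>dist_quasi_regularity\<close> lifts the resulting equation to a chain for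
  \<open>G\<close>.\<close>

lemma quasi_domain_subset:
  assumes m: "m \<ge> 1" and T: "\<T> \<in> coeff_space m"
    and F: "F \<in> assoc_matrices m \<T>" and G: "G \<in> assoc_matrices m \<T>"
  shows "quasi_domain m F \<subseteq> quasi_domain m G"
proof
  fix y assume y: "y \<in> quasi_domain m F"
  have FM: "F \<in> matrix_class m" and GM: "G \<in> matrix_class m"
    using F G by (auto simp: assoc_matrices_def)
  have W: "y \<in> W2 m" by (rule quasi_domain_W2(1)[OF FM y m])
  define f where "f = quasi_deriv F y (2 * m)"
  have chain: "has_weak_deriv (quasi_deriv F y k)
      (\<lambda>x. quasi_deriv F y (Suc k) x + (\<Sum>j<2*m. entry m F k j x * quasi_deriv F y j x))" if "k < 2 * m" for k
    using quasi_chain_quasi_deriv[OF FM y] that by (simp add: quasi_chain_def del: quasi_deriv.simps)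
  have f: "integrable unit_leb f"
  proof -
    define k where "k = 2 * m - 1"
    have k: "k < 2 * m" "Suc k = 2 * m" using m by (auto simp: k_def)
    have "integrable unit_leb (\<lambda>x. \<Sum>j<2*m. entry m F k j x * quasi_deriv F y j x)"
    proof (rule Bochner_Integration.integrable_sum)
      fix j assume "j \<in> {..<2 * m}"
      then show "integrable unit_leb (\<lambda>x. entry m F k j x * quasi_deriv F y j x)"
        by (intro integrable_mult_has_weak_deriv[OF entry_integrable[OF FM k(1)] chain]) simp
    qed
    from Bochner_Integration.integrable_diff[OF has_weak_deriv_integrable(2)[OF chain[OF k(1)]] this]
    show ?thesis by (simp add: k f_def del: quasi_deriv.simps)
  qed
  let ?u = "low_quasi m G y m" and ?r = "remainder m G y"
  have reg: "dist_quasi ?u ?r m =\<^sub>D reg_dist f"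
    unfolding dist_eq_def
  proof
    fix z assume z: "z \<in> test_fun"
    have "dist_quasi ?u ?r m z = diff_expr m \<T> y z"
      by (rule diff_expr_on_W2[OF m T G W z, symmetric])
    also have "\<dots> = reg_dist f z"
      using F y z by (simp add: assoc_matrices_def dist_eq_def f_def)
    finally show "dist_quasi ?u ?r m z = reg_dist f z" .
  qed
  have "\<exists>v. v 0 = ?u \<and> (AE x in unit_leb. v m x = f x)
      \<and> (\<forall>l<m. has_weak_deriv (v l) (\<lambda>x. v (Suc l) x + ?r l x))"
    by (rule dist_quasi_regularity[OF Lp_2_imp_integrable[OF low_quasi_top_Lp_2[OF GM W m]] _ f reg])
       (rule remainder_integrable[OF GM m W])
  then obtain v where v: "v 0 = ?u" "\<And>l. l < m \<Longrightarrow> has_weak_deriv (v l) (\<lambda>x. v (Suc l) x + ?r l x)"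
    by auto
  \<comment> \<open>The chain is glued at order \<open>m\<close>: ordinary derivatives below, the
    regular functions \<open>v\<close> from there on, with \<open>V m = v 0\<close> equal to y^[m]
    for \<open>G\<close>. The junction is the case \<open>Suc k = m\<close>, where the entries of
    row m - 1 turn y^[m] back into y^(m).\<close>
  define V where "V k = (if k < m then (weak_deriv ^^ k) y else v (k - m))" for k
  have V_low: "V k = low_quasi m G y k" if "k \<le> m" for k
    using that v(1) by (cases "k = m") (auto simp: V_def low_quasi_def fun_eq_iff)
  have "quasi_chain m G V"
    unfolding quasi_chain_def
  proof (intro allI impI)
    fix k assume k: "k < 2 * m"
    consider "Suc k < m" | "Suc k = m" | "m \<le> k" by linarith
    then show "has_weak_deriv (V k) (\<lambda>x. V (Suc k) x + (\<Sum>j<2*m. entry m G k j x * V j x))"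
    proof cases
      case 1
      then show ?thesis using W2_has_weak_deriv[OF W, of k] by (simp add: V_def entry_eq_0)
    next
      case 2
      have "(weak_deriv ^^ m) y = (\<lambda>x. V (Suc k) x + (\<Sum>j<2*m. entry m G k j x * V j x))"
      proof
        fix x
        have "(\<Sum>j<2*m. entry m G k j x * V j x) = (\<Sum>j<m. entry m G k j x * V j x)"
          using 2 by (intro sum.mono_neutral_right) (auto simp: entry_def)
        also have "\<dots> = (\<Sum>j<m. entry m G (m - 1) j x * (weak_deriv ^^ j) y x)"
          using 2 by (intro sum.cong) (auto simp: V_def)
        finally show "(weak_deriv ^^ m) y x = V (Suc k) x + (\<Sum>j<2*m. entry m G k j x * V j x)"
          using V_low[of m] 2 by (simp add: low_quasi_def)
      qed
      then show ?thesis using W2_has_weak_deriv[OF W, of k] 2 by (simp add: V_def)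
    next
      case 3
      define l where "l = k - m"
      have l: "k = m + l" "l < m" using 3 k by (auto simp: l_def)
      have "(\<Sum>j<2*m. entry m G k j x * V j x) = ?r l x" for x
      proof -
        have "(\<Sum>j<2*m. entry m G k j x * V j x) = (\<Sum>j\<le>m. entry m G k j x * V j x)"
          using m by (intro sum.mono_neutral_right) (auto simp: entry_def)
        also have "\<dots> = ?r l x"
          unfolding remainder_def using l V_low by (intro sum.cong) auto
        finally show ?thesis .
      qed
      then show ?thesis using v(2)[OF l(2)] l by (simp add: V_def)
    qed
  qed
  then show "y \<in> quasi_domain m G"
    using m by (intro quasi_chain_imp_quasi_domain[OF GM]) (auto simp: V_def)
qed

theorem theorem2p10:
  fixes m :: nat
    and \<T> :: "nat \<Rightarrow> distr"
    and F F' :: "nat \<Rightarrow> nat \<Rightarrow> real \<Rightarrow> complex"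
  assumes "m \<ge> 1"
    and "\<T> \<in> coeff_space m"
    and "F \<in> assoc_matrices m \<T>"
    and "F' \<in> assoc_matrices m \<T>"
  shows "quasi_domain m F = quasi_domain m F'"
  using quasi_domain_subset[OF assms] quasi_domain_subset[OF assms(1,2,4,3)] by (rule equalityI)


end
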